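(* Let $\rho > 2$ and let $f \colon \mathbb{R}^2 \to \mathbb{R}$ be a band-limited function in the Sobolev space $W_2^{\rho}(\mathbb{R}^2)$. Let $0 < T < 1$, let $\theta_1, \theta_2$ be grid angles, and let $\mathbf{\Xi}$ be the associated grid matrix, as specified in the context. Then $$\epsilon_{\mathbf{\Xi}}(f) = \epsilon_{\mathbf{\Xi},\mathrm{asym}}(f) + \mathcal{O}\big(T^{\min(\rho,3)}\big),$$ where $$\epsilon_{\mathbf{\Xi},\mathrm{asym}}(f) = \frac{T^2}{12\sqrt{5}} \left( \int_{\mathbb{R}^2} \left\langle \mathbf{H}_f(\mathbf{x}), \begin{bmatrix} \alpha & \gamma \\ 0 & \beta \end{bmatrix} \right\rangle^2 \mathrm{d}\mathbf{x} \right)^{\frac12},$$ $\mathbf{H}_f$ denotes the Hessian of $f$, and $$\alpha = \frac{\cos^2(\theta_1) + \cos(\theta_1)\cos(\theta_2) + \cos^2(\theta_2)}{|\sin(\theta_2-\theta_1)|},$$ $$\beta = \frac{\sin^2(\theta_1) + \sin(\theta_1)\sin(\theta_2) + \sin^2(\theta_2)}{|\sin(\theta_2-\theta_1)|},$$ $$\gamma = \frac{\sin(2\theta_1) + \sin(\theta_1+\theta_2) + \sin(2\theta_2)}{|\sin(\theta_2-\theta_1)|}.$$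
   Context: Grid matrix: the angles satisfy $0 \le \theta_1 < 2\pi$ and $\delta = \theta_2 - \theta_1 \in (0, 2\pi)$ with $\delta \neq \pi$. For a stepsize $T>0$, $$\mathbf{\Xi} = \frac{T}{\sqrt{|\sin(\theta_2-\theta_1)|}} \begin{bmatrix} \cos\theta_1 & \cos\theta_2 \\ \sin\theta_1 & \sin\theta_2 \end{bmatrix},$$ so that $|\det \mathbf{\Xi}| = T^2$. Cartesian box spline: $\varphi \colon \mathbb{R}^2 \to \mathbb{R}$ is $$\varphi(\mathbf{x}) = \max\big(1 + \min(x_1,x_2,0) - \max(x_1,x_2,0),\, 0\big).$$ Equivalently, its Fourier transform $\hat\varphi(\boldsymbol{\omega}) = \int_{\mathbb{R}^2} \varphi(\mathbf{x}) e^{-\mathrm{j}\boldsymbol{\omega}^\top \mathbf{x}}\,\mathrm{d}\mathbf{x}$ is $\mathrm{sinc}\big(\tfrac{\omega_1+\omega_2}{2}\big)\,\mathrm{sinc}\big(\tfrac{\omega_1}{2}\big)\,\mathrm{sinc}\big(\tfrac{\omega_2}{2}\big)$, with $\mathrm{sinc}(\omega) = \sin(\omega)/\omega$ and $\mathrm{sinc}(0)=1$. CPWL search space: $$\mathcal{V}_{\mathbf{\Xi}} = \Big\{ \sum_{\mathbf{k}\in\mathbb{Z}^2} c[\mathbf{k}]\, \varphi(\mathbf{\Xi}^{-1}\,\cdot\, - \mathbf{k}) \colon c \in \ell_2(\mathbb{Z}^2) \Big\}.$$ The shifted functions $\varphi(\mathbf{\Xi}^{-1}\cdot - \mathbf{k})$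 form a Riesz basis of $\mathcal{V}_{\mathbf{\Xi}}$, which is thus a closed subspace of $L_2(\mathbb{R}^2)$. Approximation error: $P_{\mathcal{V}_{\mathbf{\Xi}}}\{f\} = \arg\min_{s \in \mathcal{V}_{\mathbf{\Xi}}} \|f - s\|_{L_2}$ is the orthogonal projection of $f$ onto $\mathcal{V}_{\mathbf{\Xi}}$, and $\epsilon_{\mathbf{\Xi}}(f) = \|f - P_{\mathcal{V}_{\mathbf{\Xi}}}\{f\}\|_{L_2}$. Conventions: all functions and coefficient sequences are real-valued. "Band-limited" means that the Fourier transform $\hat f$ has compact support. $\langle \mathbf{A}, \mathbf{B}\rangle = \sum_{i,j} A_{ij}B_{ij}$ is the Frobenius inner product of matrices. The $\mathcal{O}$ notation refers to the dependence on the stepsize $T \in (0,1)$ (as $T\to 0$), with $f$, $\rho$, $\theta_1$, $\theta_2$ fixed; the implicit constant may depend on these. *)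

theory Defs
  imports "HOL-Analysis.Analysis"
begin

definition grid_matrix :: "real \<Rightarrow> real \<Rightarrow> real \<Rightarrow> real^2^2" where
  "grid_matrix T \<theta>1 \<theta>2 =
     (T / sqrt \<bar>sin (\<theta>2 - \<theta>1)\<bar>) *\<^sub>R
       vector [vector [cos \<theta>1, cos \<theta>2],
               vector [sin \<theta>1, sin \<theta>2]]"

definition grid_angles :: "real \<Rightarrow> real \<Rightarrow> bool" where
  "grid_angles \<theta>1 \<theta>2 \<longleftrightarrow>
     0 \<le> \<theta>1 \<and> \<theta>1 < 2 * pi \<and> 0 < \<theta>2 - \<theta>1 \<and> \<theta>2 - \<theta>1 < 2 * pi \<and> \<theta>2 - \<theta>1 \<noteq> pi"

definition box_spline :: "real^2 \<Rightarrow> real" where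
  "box_spline x = max (1 + min (x$1) (min (x$2) 0) - max (x$1) (max (x$2) 0)) 0"

definition real_of_int_vec :: "int^2 \<Rightarrow> real^2" where
  "real_of_int_vec k = (\<chi> i. real_of_int (k $ i))"

text \<open>At every point only finitely many terms of the series are nonzero, so the pointwise sum
  always exists; for square-summable coefficients it agrees with the sum in \<open>L\<^sub>2\<close>.\<close>

definition cpwl_space :: "real^2^2 \<Rightarrow> (real^2 \<Rightarrow> real) set" where
  "cpwl_space \<Xi> =
     {s. \<exists>c :: int^2 \<Rightarrow> real. (\<lambda>k. (c k)\<^sup>2) summable_on UNIV \<and>
        s = (\<lambda>x. \<Sum>\<^sub>\<infinity>k\<in>UNIV. c k * box_spline (matrix_inv \<Xi> *v x - real_of_int_vec k))}"

definition square_integrable :: "(real^2 \<Rightarrow> real) \<Rightarrow> bool" where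
  "square_integrable f \<longleftrightarrow>
     f \<in> borel_measurable lborel \<and> integrable lborel (\<lambda>x. (f x)\<^sup>2)"

text \<open>Meaningful for square-integrable functions only: the Bochner integral of a
  non-integrable function is \<open>0\<close>. It is applied below to differences of a square-integrable
  function and elements of \<^const>\<open>cpwl_space\<close>, which are square-integrable if the matrix is
  invertible.\<close>

definition L2_norm :: "(real^2 \<Rightarrow> real) \<Rightarrow> real" where
  "L2_norm f = sqrt (\<integral>x. (f x)\<^sup>2 \<partial>lborel)"

definition cpwl_projection :: "real^2^2 \<Rightarrow> (real^2 \<Rightarrow> real) \<Rightarrow> (real^2 \<Rightarrow> real)" where
  "cpwl_projection \<Xi> f = arg_min (\<lambda>s. L2_norm (\<lambda>x. f x - s x)) (\<lambda>s. s \<in> cpwl_space \<Xi>)"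

definition approx_error :: "real^2^2 \<Rightarrow> (real^2 \<Rightarrow> real) \<Rightarrow> real" where
  "approx_error \<Xi> f = L2_norm (\<lambda>x. f x - cpwl_projection \<Xi> f x)"

definition truncated_fourier :: "real \<Rightarrow> (real^2 \<Rightarrow> real) \<Rightarrow> real^2 \<Rightarrow> complex" where
  "truncated_fourier R f \<omega> =
     (LINT x:cball 0 R|lborel. complex_of_real (f x) * exp (- (\<i> * complex_of_real (\<omega> \<bullet> x))))"

text \<open>The Fourier--Plancherel transform of a square-integrable function: the limit in \<open>L\<^sub>2\<close> of the
  Fourier integrals over growing balls, unique up to equality almost everywhere. It agrees
  almost everywhere with the Fourier integral if the function is also integrable.\<close>

definition fourier_L2 :: "(real^2 \<Rightarrow> real) \<Rightarrow> real^2 \<Rightarrow> complex" where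
  "fourier_L2 f = (SOME g. g \<in> borel_measurable lborel \<and>
     integrable lborel (\<lambda>\<omega>. (cmod (g \<omega>))\<^sup>2) \<and>
     ((\<lambda>R. \<integral>\<^sup>+\<omega>. ennreal ((cmod (g \<omega> - truncated_fourier R f \<omega>))\<^sup>2) \<partial>lborel) \<longlongrightarrow> 0) at_top)"

definition sobolev_space :: "real \<Rightarrow> (real^2 \<Rightarrow> real) set" where
  "sobolev_space \<rho> = {f. square_integrable f \<and>
     integrable lborel (\<lambda>\<omega>. (1 + (norm \<omega>)\<^sup>2) powr \<rho> * (cmod (fourier_L2 f \<omega>))\<^sup>2)}"

definition band_limited :: "(real^2 \<Rightarrow> real) \<Rightarrow> bool" where
  "band_limited f \<longleftrightarrow>
     (\<exists>K. compact K \<and> (AE \<omega> in lborel. \<omega> \<notin> K \<longrightarrow> fourier_L2 f \<omega> = 0))"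

definition partial_deriv :: "2 \<Rightarrow> (real^2 \<Rightarrow> real) \<Rightarrow> real^2 \<Rightarrow> real" where
  "partial_deriv i g x = frechet_derivative g (at x) (axis i 1)"

definition classical_hessian :: "(real^2 \<Rightarrow> real) \<Rightarrow> real^2 \<Rightarrow> real^2^2" where
  "classical_hessian g x = (\<chi> i j. partial_deriv i (partial_deriv j g) x)"

definition twice_continuously_differentiable :: "(real^2 \<Rightarrow> real) \<Rightarrow> bool" where
  "twice_continuously_differentiable g \<longleftrightarrow>
     (\<forall>x. g differentiable (at x)) \<and>
     (\<forall>j x. partial_deriv j g differentiable (at x)) \<and>
     continuous_on UNIV (classical_hessian g)"

text \<open>A band-limited square-integrable function is only determined up to a null set, but it agrees
  almost everywhere with exactly one continuous function, which is smooth. The Hessian is that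
  of this representative; if the function is itself smooth, it is its own representative.\<close>

definition smooth_representative :: "(real^2 \<Rightarrow> real) \<Rightarrow> real^2 \<Rightarrow> real" where
  "smooth_representative f =
     (SOME g. twice_continuously_differentiable g \<and> (AE x in lborel. g x = f x))"

definition hessian :: "(real^2 \<Rightarrow> real) \<Rightarrow> real^2 \<Rightarrow> real^2^2" where
  "hessian f = classical_hessian (smooth_representative f)"

definition coeff_\<alpha> :: "real \<Rightarrow> real \<Rightarrow> real" where
  "coeff_\<alpha> \<theta>1 \<theta>2 =
     ((cos \<theta>1)\<^sup>2 + cos \<theta>1 * cos \<theta>2 + (cos \<theta>2)\<^sup>2) / \<bar>sin (\<theta>2 - \<theta>1)\<bar>"

definition coeff_\<beta> :: "real \<Rightarrow> real \<Rightarrow> real" where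
  "coeff_\<beta> \<theta>1 \<theta>2 =
     ((sin \<theta>1)\<^sup>2 + sin \<theta>1 * sin \<theta>2 + (sin \<theta>2)\<^sup>2) / \<bar>sin (\<theta>2 - \<theta>1)\<bar>"

definition coeff_\<gamma> :: "real \<Rightarrow> real \<Rightarrow> real" where
  "coeff_\<gamma> \<theta>1 \<theta>2 =
     (sin (2 * \<theta>1) + sin (\<theta>1 + \<theta>2) + sin (2 * \<theta>2)) / \<bar>sin (\<theta>2 - \<theta>1)\<bar>"

text \<open>The inner product on the type \<^typ>\<open>real^2^2\<close> is the Frobenius inner product.\<close>

definition asym_error :: "real \<Rightarrow> real \<Rightarrow> real \<Rightarrow> (real^2 \<Rightarrow> real) \<Rightarrow> real" where
  "asym_error T \<theta>1 \<theta>2 f =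
     T\<^sup>2 / (12 * sqrt 5) *
     sqrt (\<integral>x. (hessian f x \<bullet>
                 vector [vector [coeff_\<alpha> \<theta>1 \<theta>2, coeff_\<gamma> \<theta>1 \<theta>2],
                         vector [0, coeff_\<beta> \<theta>1 \<theta>2]])\<^sup>2 \<partial>lborel)"

end

theory Submission
  imports Defs "HOL-Probability.Probability"
begin

text \<open>A band-limited function is, almost everywhere, a Fourier integral \<open>g(x) = \<integral> G(w) exp (i w \<bullet> x) dw\<close> whose spectrum
\<open>G\<close> is square integrable and vanishes outside a ball (\<open>band_limited_representation\<close>). Composing with the
grid matrix \<open>X\<close> gives \<open>h(u) = g(X u)\<close>, whose frequencies \<open>\<xi> = X\<^sup>T w\<close> satisfy \<open>\<bar>\<xi>\<^sub>1\<bar> + \<bar>\<xi>\<^sub>2\<bar> \<le> \<tau>\<close> with \<open>\<tau>\<close>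
proportional to the stepsize. The plane is cut into the cells \<open>k + [0,1)\<^sup>2\<close>; on a cell every spline of
the search space interpolates its coefficients at the four corners linearly on the two triangles
below and above the diagonal.

Up to third order in \<open>\<tau>\<close> the problem is explicit. Put \<open>Q = \<partial>\<^sub>1\<^sub>1 + \<partial>\<^sub>1\<^sub>2 + \<partial>\<^sub>2\<^sub>2\<close> and take the spline with
coefficients \<open>(h - Q h / 12)(k)\<close>. By Taylor expansion of the exponentials, its residual at \<open>k + v\<close> is
\<open>n\<^sub>0(k) \<beta>(v\<^sub>1) + n\<^sub>1(k) \<beta>(v\<^sub>2) - n\<^sub>2(k) \<beta>(\<bar>v\<^sub>1 - v\<^sub>2\<bar>)\<close> plus a remainder with symbol at most \<open>\<tau>\<^sup>3\<close>
(\<open>cell_quadratic_identity\<close>, \<open>remainder_symbol_bound\<close>). Here \<open>\<beta>\<close> is half the second Bernoulli polynomial and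
\<open>n\<^sub>0 = (\<partial>\<^sub>1\<^sub>1 + \<partial>\<^sub>1\<^sub>2) h\<close>, \<open>n\<^sub>1 = (\<partial>\<^sub>2\<^sub>2 + \<partial>\<^sub>1\<^sub>2) h\<close>, \<open>n\<^sub>2 = \<partial>\<^sub>1\<^sub>2 h\<close>. Since all frequencies lie in one period of
the dual lattice, Bessel's inequality (\<open>bessel\<close>) turns every bound on a symbol into a bound in \<open>\<ell>\<^sub>2\<close> for
the samples on the lattice; this controls all remainders at once.

The three functions of \<open>v\<close> have mean zero over the cell, are mutually orthogonal, and each has mean
square \<open>1/720\<close> (\<open>cell_residual_gram\<close>). Two things follow. The norm of the leading residual is the square
root of \<open>(\<Sum>\<^sub>k n\<^sub>0(k)\<^sup>2 + n\<^sub>1(k)\<^sup>2 + n\<^sub>2(k)\<^sup>2) / 720\<close>. And the leading residual is nearly orthogonal to every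
spline (\<open>leading_residual_orth\<close>): the shape functions of the cell add up to one, so only differences
of \<open>n\<^sub>j\<close> between neighbouring lattice points survive in the inner product, and these are of order \<open>\<tau>\<^sup>3\<close>.
The coefficients of a spline are bounded by its norm (\<open>cpwl_riesz\<close>), so the best
approximation cannot improve on the chosen one by more than \<open>O(\<tau>\<^sup>3)\<close>.

It remains to evaluate the norm. Replacing lattice samples by the values in the whole cell costs
\<open>O(\<tau>\<^sup>3)\<close> again, and \<open>n\<^sub>0\<^sup>2 + n\<^sub>1\<^sup>2 + n\<^sub>2\<^sup>2\<close> differs from \<open>(Q h)\<^sup>2\<close> by twice the null Lagrangian
\<open>(\<partial>\<^sub>1\<^sub>2 h)\<^sup>2 - \<partial>\<^sub>1\<^sub>1 h \<partial>\<^sub>2\<^sub>2 h\<close>, whose integral vanishes (\<open>null_lagrangian\<close>). For a grid matrix, \<open>Q h\<close> is \<open>T\<^sup>2\<close> times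
the inner product of the Hessian of \<open>f\<close> with the given matrix, and \<open>sqrt 720 = 12 sqrt 5\<close>. This settles
small \<open>T\<close>; for \<open>T\<close> bounded away from zero both errors are bounded, so a larger constant suffices.

The Fourier analysis rests on a single identity, Parseval's relation damped by a Gaussian
(\<open>regularised_parseval\<close>): \<open>\<integral> FT u \<cdot> cnj (FT v) \<cdot> exp (- \<epsilon> \<bar>w\<bar>\<^sup>2 / 2)\<close> is a double integral of
\<open>u(x) cnj (v(y))\<close> against a Gaussian kernel in \<open>x - y\<close>. Letting \<open>\<epsilon>\<close> tend to zero yields the boundedness of
the transform, the pairing with Lipschitz test functions that identifies a band-limited function with
its Fourier integral, and the null Lagrangian.\<close>

section \<open>Square-integrable functions\<close>

definition in_L2 :: "'a measure \<Rightarrow> ('a \<Rightarrow> 'b::{real_normed_vector, second_countable_topology}) \<Rightarrow> bool" where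
  "in_L2 M F \<longleftrightarrow> F \<in> borel_measurable M \<and> integrable M (\<lambda>x. (norm (F x))\<^sup>2)"

definition L2n :: "'a measure \<Rightarrow> ('a \<Rightarrow> 'b::{real_normed_vector, second_countable_topology}) \<Rightarrow> real" where
  "L2n M F = sqrt (\<integral>x. (norm (F x))\<^sup>2 \<partial>M)"

lemma L2n_nonneg [simp]: "0 \<le> L2n M F"
  by (simp add: L2n_def)

lemma L2n_sq: "(L2n M F)\<^sup>2 = (\<integral>x. (norm (F x))\<^sup>2 \<partial>M)"
  by (simp add: L2n_def)

lemma in_L2_measurable: "in_L2 M F \<Longrightarrow> F \<in> borel_measurable M"
  by (simp add: in_L2_def)

lemma in_L2_integrable: "in_L2 M F \<Longrightarrow> integrable M (\<lambda>x. (norm (F x))\<^sup>2)"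
  by (simp add: in_L2_def)

lemma in_L2_norm: "in_L2 M F \<Longrightarrow> in_L2 M (\<lambda>x. norm (F x))"
  by (auto simp: in_L2_def)

lemma L2n_norm: "L2n M (\<lambda>x. norm (F x)) = L2n M F"
  by (simp add: L2n_def)

lemma in_L2_bound:
  assumes "in_L2 M G" "F \<in> borel_measurable M" "\<And>x. x \<in> space M \<Longrightarrow> norm (F x) \<le> c * norm (G x)"
  shows "in_L2 M F" and "0 \<le> c \<Longrightarrow> L2n M F \<le> c * L2n M G"
proof -
  have *: "norm (F x)^2 \<le> c^2 * norm (G x)^2" if "x \<in> space M" for x
    using assms(3)[OF that] power_mono[of "norm (F x)" "c * norm (G x)" 2] by (simp add: power_mult_distrib)
  have i: "integrable M (\<lambda>x. c\<^sup>2 * (norm (G x))\<^sup>2)"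
    using assms(1) by (auto simp: in_L2_def)
  show L: "in_L2 M F"
    unfolding in_L2_def
  proof (intro conjI assms(2))
    show "integrable M (\<lambda>x. (norm (F x))\<^sup>2)"
      by (rule Bochner_Integration.integrable_bound[OF i]) (use assms(2) * in \<open>auto intro!: AE_I2\<close>)
  qed
  assume "0 \<le> c"
  have "(\<integral>x. (norm (F x))\<^sup>2 \<partial>M) \<le> (\<integral>x. c\<^sup>2 * (norm (G x))\<^sup>2 \<partial>M)"
    by (rule integral_mono[OF in_L2_integrable[OF L] i *])
  then have "(L2n M F)^2 \<le> (c * L2n M G)^2"
    by (simp add: L2n_sq power_mult_distrib)
  then show "L2n M F \<le> c * L2n M G"
    by (rule power2_le_imp_le) (use \<open>0 \<le> c\<close> in simp)
qed

lemma in_L2_zero [simp]: "in_L2 M (\<lambda>x. 0)"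
  by (simp add: in_L2_def)

lemma in_L2_add:
  assumes "in_L2 M F" "in_L2 M G" shows "in_L2 M (\<lambda>x. F x + G x)"
proof -
  have i: "integrable M (\<lambda>x. 2 * (norm (F x))\<^sup>2 + 2 * (norm (G x))\<^sup>2)"
    using assms by (auto simp: in_L2_def)
  have m: "F \<in> borel_measurable M" "G \<in> borel_measurable M" using assms by (auto simp: in_L2_def)
  have "norm (F x + G x)^2 \<le> 2 * (norm (F x))\<^sup>2 + 2 * (norm (G x))\<^sup>2" for x
  proof -
    have "norm (F x + G x)^2 \<le> (norm (F x) + norm (G x))^2"
      by (intro power_mono norm_triangle_ineq) auto
    also have "\<dots> \<le> 2 * (norm (F x))\<^sup>2 + 2 * (norm (G x))\<^sup>2"
      using sum_squares_bound[of "norm (F x)" "norm (G x)"] by (simp add: power2_sum)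
    finally show ?thesis .
  qed
  then show ?thesis
    unfolding in_L2_def using m
    by (auto intro!: Bochner_Integration.integrable_bound[OF i])
qed

lemma in_L2_scaleR:
  fixes c :: real
  assumes "in_L2 M F" shows "in_L2 M (\<lambda>x. c *\<^sub>R F x)"
  by (rule in_L2_bound(1)[OF assms, where c="\<bar>c\<bar>"]) (use assms in \<open>auto simp: in_L2_def\<close>)

lemma in_L2_uminus:
  assumes "in_L2 M F" shows "in_L2 M (\<lambda>x. - F x)"
  using in_L2_scaleR[OF assms, of "-1"] by simp

lemma in_L2_diff:
  assumes "in_L2 M F" "in_L2 M G" shows "in_L2 M (\<lambda>x. F x - G x)"
  using in_L2_add[OF assms(1) in_L2_uminus[OF assms(2)]] by simp

lemma in_L2_cmult:
  fixes c :: "'b::{real_normed_div_algebra, second_countable_topology}"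
  assumes "in_L2 M F" shows "in_L2 M (\<lambda>x. c * F x)"
  by (rule in_L2_bound(1)[OF assms, where c="norm c"]) (use assms in \<open>auto simp: in_L2_def norm_mult\<close>)

lemma L2n_scaleR: "L2n M (\<lambda>x. c *\<^sub>R F x) = \<bar>c\<bar> * L2n M F"
  by (simp add: L2n_def power_mult_distrib real_sqrt_mult)

lemma in_L2_sum:
  assumes "\<And>i. i \<in> I \<Longrightarrow> in_L2 M (F i)" shows "in_L2 M (\<lambda>x. \<Sum>i\<in>I. F i x)"
  using assms by (induction I rule: infinite_finite_induct) (auto intro: in_L2_add)

lemma Cauchy_Schwarz_integral:
  fixes F G :: "'a \<Rightarrow> real"
  assumes "in_L2 M F" "in_L2 M G"
  shows "integrable M (\<lambda>x. F x * G x)" "\<bar>\<integral>x. F x * G x \<partial>M\<bar> \<le> L2n M F * L2n M G"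
proof -
  have m: "F \<in> borel_measurable M" "G \<in> borel_measurable M" using assms by (auto simp: in_L2_def)
  have iF: "integrable M (\<lambda>x. (F x)\<^sup>2)" and iG: "integrable M (\<lambda>x. (G x)\<^sup>2)" using assms by (auto simp: in_L2_def)
  have i: "integrable M (\<lambda>x. (F x)\<^sup>2 + (G x)\<^sup>2)" using iF iG by auto
  show I: "integrable M (\<lambda>x. F x * G x)"
  proof (rule Bochner_Integration.integrable_bound[OF i])
    show "AE x in M. norm (F x * G x) \<le> norm ((F x)\<^sup>2 + (G x)\<^sup>2)"
    proof (rule AE_I2)
      fix x
      have "2 * (\<bar>F x\<bar> * \<bar>G x\<bar>) \<le> (F x)\<^sup>2 + (G x)\<^sup>2"
        using sum_squares_bound[of "\<bar>F x\<bar>" "\<bar>G x\<bar>"] by (simp add: mult.assoc)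
      then show "norm (F x * G x) \<le> norm ((F x)\<^sup>2 + (G x)\<^sup>2)"
        using mult_nonneg_nonneg[of "\<bar>F x\<bar>" "\<bar>G x\<bar>"] unfolding real_norm_def abs_mult by linarith
    qed
  qed (use m in auto)
  define a b c where "a = (\<integral>x. (F x)\<^sup>2 \<partial>M)" and "b = (\<integral>x. F x * G x \<partial>M)" and "c = (\<integral>x. (G x)\<^sup>2 \<partial>M)"
  have a0: "0 \<le> a" and c0: "0 \<le> c" by (simp_all add: a_def c_def)
  have q: "0 \<le> a * t^2 + 2 * b * t + c" for t
  proof -
    have "0 \<le> (\<integral>x. (t * F x + G x)^2 \<partial>M)" by simp
    also have "(\<integral>x. (t * F x + G x)^2 \<partial>M) = (\<integral>x. t\<^sup>2 * (F x)\<^sup>2 + 2 * t * (F x * G x) + (G x)\<^sup>2 \<partial>M)"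
      by (intro Bochner_Integration.integral_cong) (auto simp: power2_eq_square algebra_simps)
    also have "\<dots> = a * t^2 + 2 * b * t + c"
      using iF iG I by (simp add: a_def b_def c_def)
    finally show ?thesis .
  qed
  have "b^2 \<le> a * c"
  proof (cases "a = 0")
    case True
    have "b = 0"
    proof (rule ccontr)
      assume "b \<noteq> 0"
      have "2 * b * (- (c + 1) / (2 * b)) + c = -1" using \<open>b \<noteq> 0\<close> by (simp add: field_simps)
      then show False using q[of "- (c + 1) / (2 * b)"] True by simp
    qed
    then show ?thesis using a0 c0 by simp
  next
    case False
    then have "a * (- b / a)^2 + 2 * b * (- b / a) + c = c - b^2 / a"
      by (simp add: field_simps power2_eq_square)
    then have "b^2 / a \<le> c" using q[of "- b / a"] by simp
    then show ?thesis using False a0 by (simp add: field_simps)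
  qed
  then have "sqrt (b^2) \<le> sqrt (a * c)" by (rule real_sqrt_le_mono)
  then show "\<bar>\<integral>x. F x * G x \<partial>M\<bar> \<le> L2n M F * L2n M G"
    by (simp add: L2n_def a_def b_def c_def real_sqrt_mult)
qed

lemma L2n_triangle:
  assumes "in_L2 M F" "in_L2 M G" shows "L2n M (\<lambda>x. F x + G x) \<le> L2n M F + L2n M G"
proof -
  have FG: "in_L2 M (\<lambda>x. norm (F x))" "in_L2 M (\<lambda>x. norm (G x))" using assms by (auto intro: in_L2_norm)
  note cs = Cauchy_Schwarz_integral[OF FG]
  have iF: "integrable M (\<lambda>x. (norm (F x))\<^sup>2)" and iG: "integrable M (\<lambda>x. (norm (G x))\<^sup>2)" using assms by (auto simp: in_L2_def)
  have "(L2n M (\<lambda>x. F x + G x))^2 \<le> (\<integral>x. (norm (F x))\<^sup>2 + 2 * (norm (F x) * norm (G x)) + (norm (G x))\<^sup>2 \<partial>M)"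
    unfolding L2n_sq
  proof (rule integral_mono)
    show "integrable M (\<lambda>x. (norm (F x + G x))\<^sup>2)" using in_L2_add[OF assms] by (simp add: in_L2_def)
    show "integrable M (\<lambda>x. (norm (F x))\<^sup>2 + 2 * (norm (F x) * norm (G x)) + (norm (G x))\<^sup>2)"
      using iF iG cs by auto
    show "(norm (F x + G x))\<^sup>2 \<le> (norm (F x))\<^sup>2 + 2 * (norm (F x) * norm (G x)) + (norm (G x))\<^sup>2" for x
      using power_mono[OF norm_triangle_ineq[of "F x" "G x"], of 2] by (simp add: power2_sum)
  qed
  also have "\<dots> = (L2n M F)^2 + 2 * (\<integral>x. norm (F x) * norm (G x) \<partial>M) + (L2n M G)^2"
    using iF iG cs by (simp add: L2n_sq)
  also have "\<dots> \<le> (L2n M F)^2 + 2 * (L2n M F * L2n M G) + (L2n M G)^2"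
    using cs(2) by (simp add: L2n_norm)
  also have "\<dots> = (L2n M F + L2n M G)^2" by (simp add: power2_sum)
  finally show ?thesis by (rule power2_le_imp_le) simp
qed

lemma L2n_triangle_rev:
  assumes "in_L2 M F" "in_L2 M G" shows "\<bar>L2n M F - L2n M G\<bar> \<le> L2n M (\<lambda>x. F x - G x)"
proof -
  have d: "in_L2 M (\<lambda>x. F x - G x)" "in_L2 M (\<lambda>x. G x - F x)" by (auto intro: in_L2_diff assms)
  have "L2n M (\<lambda>x. G x - F x) = L2n M (\<lambda>x. F x - G x)" by (simp add: L2n_def norm_minus_commute)
  then show ?thesis
    using L2n_triangle[OF d(1) assms(2)] L2n_triangle[OF d(2) assms(1)] by simp
qed

text \<open>The norms are indexed by a real radius, as in the definition of the Plancherel transform. Along a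
sequence of radii with increments of norm at most \<open>2\<^sup>-\<^sup>n\<close> the functions converge almost everywhere, and
Fatou's lemma bounds the distance of the limit from every later member of the family.\<close>

lemma L2_complete:
  fixes F :: "real \<Rightarrow> 'a \<Rightarrow> complex"
  assumes L: "\<And>R. in_L2 M (F R)"
    and C: "\<And>e. 0 < e \<Longrightarrow> \<exists>R0. \<forall>R\<ge>R0. \<forall>S\<ge>R0. L2n M (\<lambda>x. F R x - F S x) \<le> e"
  shows "\<exists>g. in_L2 M g \<and> ((\<lambda>R. \<integral>\<^sup>+x. ennreal ((cmod (g x - F R x))\<^sup>2) \<partial>M) \<longlongrightarrow> 0) at_top"
proof -
  have [measurable]: "F R \<in> borel_measurable M" for R using L by (rule in_L2_measurable)
  have nn: "(\<integral>\<^sup>+x. ennreal ((cmod (F R x - F S x))\<^sup>2) \<partial>M) = ennreal ((L2n M (\<lambda>x. F R x - F S x))\<^sup>2)" for R S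
    using in_L2_integrable[OF in_L2_diff[OF L L]] by (simp add: L2n_sq nn_integral_eq_integral)
  obtain R where R: "\<And>n. \<forall>r\<ge>R n. \<forall>s\<ge>R n. L2n M (\<lambda>x. F r x - F s x) \<le> (1/2)^n" for n :: nat
  proof -
    have "\<forall>n. \<exists>R0. \<forall>r\<ge>R0. \<forall>s\<ge>R0. L2n M (\<lambda>x. F r x - F s x) \<le> (1/2)^n" using C by simp
    then show ?thesis using that by metis
  qed
  define r where "r n = Max (R ` {..n}) + real n" for n
  have rR: "R m \<le> r n" if "m \<le> n" for m n
    using that Max_ge[of "R ` {..n}" "R m"] by (simp add: r_def add_increasing2)
  have d: "L2n M (\<lambda>x. F (r (Suc n)) x - F (r n) x) \<le> (1/2)^n" for n
    using R[of n] rR[of n n] rR[of n "Suc n"] by auto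
  \<comment> \<open>The weights keep the integrals summable, and a finite weighted sum at a point bounds
    the increments there by a geometric sequence.\<close>
  have "(\<integral>\<^sup>+x. (\<Sum>n. ennreal (2^n * (cmod (F (r (Suc n)) x - F (r n) x))\<^sup>2)) \<partial>M)
      = (\<Sum>n. \<integral>\<^sup>+x. ennreal (2^n) * ennreal ((cmod (F (r (Suc n)) x - F (r n) x))\<^sup>2) \<partial>M)"
    by (subst nn_integral_suminf) (auto simp: ennreal_mult)
  also have "\<dots> = (\<Sum>n. ennreal (2^n) * ennreal ((L2n M (\<lambda>x. F (r (Suc n)) x - F (r n) x))\<^sup>2))"
    by (subst nn_integral_cmult) (auto simp: nn)
  also have "\<dots> \<le> (\<Sum>n. ennreal ((1/2)^n))"
  proof (intro suminf_le allI summableI)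
    fix n
    have "2^n * (L2n M (\<lambda>x. F (r (Suc n)) x - F (r n) x))\<^sup>2 \<le> 2^n * ((1/2)^n)^2"
      using d[of n] by (intro mult_left_mono power_mono) auto
    also have "\<dots> = (1/2)^n" by (simp add: power2_eq_square power_one_over)
    finally show "ennreal (2^n) * ennreal ((L2n M (\<lambda>x. F (r (Suc n)) x - F (r n) x))\<^sup>2) \<le> ennreal ((1/2)^n)"
      by (simp add: ennreal_leI flip: ennreal_mult)
  qed
  also have "\<dots> = ennreal (\<Sum>n. (1/2)^n)"
    by (rule suminf_ennreal2) (auto intro: summable_geometric)
  finally have fin: "(\<integral>\<^sup>+x. (\<Sum>n. ennreal (2^n * (cmod (F (r (Suc n)) x - F (r n) x))\<^sup>2)) \<partial>M) \<noteq> \<infinity>"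
    using neq_top_trans by (auto simp: top_unique)
  have "AE x in M. (\<Sum>n. ennreal (2^n * (cmod (F (r (Suc n)) x - F (r n) x))\<^sup>2)) \<noteq> \<infinity>"
    by (rule nn_integral_PInf_AE[OF _ fin]) measurable
  then have conv: "AE x in M. convergent (\<lambda>n. F (r n) x)"
  proof eventually_elim
    case (elim x)
    define a where "a n = cmod (F (r (Suc n)) x - F (r n) x)" for n
    define K where "K = enn2real (\<Sum>n. ennreal (2^n * (a n)\<^sup>2))"
    have K: "(\<Sum>n. ennreal (2^n * (a n)\<^sup>2)) = ennreal K"
      using elim by (simp add: K_def a_def less_top)
    have K0: "0 \<le> K" by (simp add: K_def)
    have "a n \<le> sqrt K * (sqrt (1/2))^n" for n
    proof -
      have "(\<Sum>k\<in>{n}. ennreal (2^k * (a k)\<^sup>2)) \<le> (\<Sum>k. ennreal (2^k * (a k)\<^sup>2))"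
        by (rule sum_le_suminf) auto
      then have "ennreal (2^n * (a n)\<^sup>2) \<le> ennreal K" by (simp only: K) simp
      then have "2^n * (a n)\<^sup>2 \<le> K" using K0 by (simp add: ennreal_le_iff)
      then have "(a n)\<^sup>2 \<le> K * (1/2)^n" by (simp add: field_simps power_one_over)
      then have "sqrt ((a n)\<^sup>2) \<le> sqrt (K * (1/2)^n)" by (rule real_sqrt_le_mono)
      then show ?thesis by (simp add: real_sqrt_mult real_sqrt_power a_def)
    qed
    then have A: "norm (F (r (Suc n)) x - F (r n) x) \<le> sqrt K * (sqrt (1/2))^n" for n
      unfolding a_def .
    have "summable (\<lambda>n. sqrt K * (sqrt (1/2))^n)"
      by (intro summable_mult summable_geometric) (simp add: real_sqrt_divide)
    then have "summable (\<lambda>n. F (r (Suc n)) x - F (r n) x)"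
      by (rule summable_comparison_test') (rule A)
    then obtain l where "(\<lambda>n. \<Sum>k<n. F (r (Suc k)) x - F (r k) x) \<longlonglongrightarrow> l"
      by (auto simp: summable_def sums_def)
    then have "(\<lambda>n. F (r n) x - F (r 0) x) \<longlonglongrightarrow> l" unfolding sum_lessThan_telescope[of "\<lambda>n. F (r n) x"] .
    from tendsto_add[OF this tendsto_const[of "F (r 0) x"]] show ?case
      by (auto simp: convergent_def)
  qed
  define g where "g x = lim (\<lambda>n. F (r n) x)" for x
  have [measurable]: "g \<in> borel_measurable M" unfolding g_def by measurable
  have lim: "AE x in M. (\<lambda>n. F (r n) x) \<longlonglongrightarrow> g x"
    using conv by eventually_elim (simp add: g_def convergent_LIMSEQ_iff)
  have bd: "(\<integral>\<^sup>+x. ennreal ((cmod (g x - F s x))\<^sup>2) \<partial>M) \<le> ennreal (((1/2)^m)\<^sup>2)" if s: "r m \<le> s" for m s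
  proof -
    have "(\<integral>\<^sup>+x. ennreal ((cmod (g x - F s x))\<^sup>2) \<partial>M)
        = (\<integral>\<^sup>+x. liminf (\<lambda>n. ennreal ((cmod (F (r n) x - F s x))\<^sup>2)) \<partial>M)"
    proof (rule nn_integral_cong_AE, use lim in eventually_elim)
      case (elim x)
      have "(\<lambda>n. ennreal ((cmod (F (r n) x - F s x))\<^sup>2)) \<longlonglongrightarrow> ennreal ((cmod (g x - F s x))\<^sup>2)"
        by (intro tendsto_intros elim)
      then show ?case using lim_imp_Liminf by force
    qed
    also have "\<dots> \<le> liminf (\<lambda>n. \<integral>\<^sup>+x. ennreal ((cmod (F (r n) x - F s x))\<^sup>2) \<partial>M)"
      by (rule nn_integral_liminf) measurable
    also have "\<dots> \<le> ennreal (((1/2)^m)\<^sup>2)"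
    proof (rule Liminf_le)
      show "\<forall>\<^sub>F n in sequentially. (\<integral>\<^sup>+x. ennreal ((cmod (F (r n) x - F s x))\<^sup>2) \<partial>M) \<le> ennreal (((1/2)^m)\<^sup>2)"
        using eventually_ge_at_top[of m]
      proof eventually_elim
        case (elim n)
        have "L2n M (\<lambda>x. F (r n) x - F s x) \<le> (1/2)^m" using R[of m] rR[OF elim] rR[of m m] s by auto
        then show ?case unfolding nn by (intro ennreal_leI power_mono) auto
      qed
    qed simp
    finally show ?thesis .
  qed
  have "in_L2 M (\<lambda>x. g x - F (r 0) x)"
    unfolding in_L2_def
  proof (intro conjI integrableI_bounded)
    have "(\<integral>\<^sup>+x. ennreal (norm ((norm (g x - F (r 0) x))\<^sup>2)) \<partial>M) \<le> ennreal (((1/2)^0)\<^sup>2)"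
      using bd[of 0 "r 0"] by simp
    also have "\<dots> < \<infinity>" by simp
    finally show "(\<integral>\<^sup>+x. ennreal (norm ((norm (g x - F (r 0) x))\<^sup>2)) \<partial>M) < \<infinity>" .
  qed measurable
  from in_L2_add[OF this L[of "r 0"]] have gL: "in_L2 M g" by simp
  have "((\<lambda>R. \<integral>\<^sup>+x. ennreal ((cmod (g x - F R x))\<^sup>2) \<partial>M) \<longlongrightarrow> 0) at_top"
  proof (rule order_tendstoI)
    fix a :: ennreal assume "0 < a"
    have "(\<lambda>m. ennreal (((1/2)^m)\<^sup>2)) \<longlonglongrightarrow> ennreal (0\<^sup>2)"
      by (intro tendsto_ennrealI tendsto_power LIMSEQ_realpow_zero) auto
    then have "\<forall>\<^sub>F m in sequentially. ennreal (((1/2)^m)\<^sup>2) < a"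
      using \<open>0 < a\<close> by (auto simp: order_tendsto_iff)
    then obtain m where m: "ennreal (((1/2)^m)\<^sup>2) < a" by (auto simp: eventually_sequentially)
    show "\<forall>\<^sub>F R in at_top. (\<integral>\<^sup>+x. ennreal ((cmod (g x - F R x))\<^sup>2) \<partial>M) < a"
      using eventually_ge_at_top[of "r m"] by eventually_elim (use bd m order.strict_trans1 in blast)
  qed simp
  then show ?thesis using gL by blast
qed

section \<open>Gaussian integrals in the plane\<close>

text \<open>Lebesgue measure on the vector type is the product measure of its coordinates; this gives access to
Fubini's theorem for products of functions of one coordinate.\<close>

lemma lborel_real2:
  "(lborel :: (real^2) measure) = distr (lborel \<Otimes>\<^sub>M lborel) borel (\<lambda>(a,b). vector [a, b])"
proof (rule lborel_eqI)
  have m[measurable]: "(\<lambda>(a,b). vector [a, b] :: real^2) \<in> borel_measurable (lborel \<Otimes>\<^sub>M lborel)"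
  proof -
    have "(\<lambda>(a,b). vector [a, b] :: real^2) = (\<lambda>p. fst p *\<^sub>R axis 1 1 + snd p *\<^sub>R axis 2 1)"
      by (auto simp: fun_eq_iff vec_eq_iff forall_2 axis_def)
    then show ?thesis by simp
  qed
  fix l u :: "real^2" assume le: "\<And>b. b \<in> Basis \<Longrightarrow> l \<bullet> b \<le> u \<bullet> b"
  have B: "(Basis :: (real^2) set) = {axis 1 1, axis 2 1}"
    by (auto simp: Basis_vec_def UNIV_2)
  have ne: "axis 1 1 \<noteq> (axis 2 1 :: real^2)" by (simp add: axis_eq_axis)
  have le1: "l$1 \<le> u$1" "l$2 \<le> u$2" using le[of "axis 1 1"] le[of "axis 2 1"] by (auto simp: B inner_axis)
  have "emeasure (distr (lborel \<Otimes>\<^sub>M lborel) borel (\<lambda>(a,b). vector [a, b])) (box l u)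
      = emeasure (lborel \<Otimes>\<^sub>M lborel) ({l$1<..<u$1} \<times> {l$2<..<u$2})"
    by (subst emeasure_distr[OF m]) (auto simp: mem_box B inner_axis space_pair_measure intro!: arg_cong2[where f=emeasure])
  also have "\<dots> = (u$1 - l$1) * (u$2 - l$2)"
    using le1 by (subst lborel.emeasure_pair_measure_Times) (auto simp: ennreal_mult)
  finally show "emeasure (distr (lborel \<Otimes>\<^sub>M lborel) borel (\<lambda>(a,b). vector [a, b])) (box l u)
      = (\<Prod>b\<in>Basis. (u - l) \<bullet> b)"
    by (simp add: B ne inner_axis)
qed simp

lemma vector2_measurable [measurable]: "(\<lambda>(a,b). vector [a, b] :: real^2) \<in> borel_measurable (lborel \<Otimes>\<^sub>M lborel)"
proof -
  have "(\<lambda>(a,b). vector [a, b] :: real^2) = (\<lambda>p. fst p *\<^sub>R axis 1 1 + snd p *\<^sub>R axis 2 1)"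
    by (auto simp: fun_eq_iff vec_eq_iff forall_2 axis_def)
  then show ?thesis by simp
qed

lemma has_bochner_integral_real2_prod:
  fixes f g :: "real \<Rightarrow> complex"
  assumes f: "integrable lborel f" and g: "integrable lborel g"
  shows "integrable lborel (\<lambda>x::real^2. f (x$1) * g (x$2))"
    and "(\<integral>x. f (x$1) * g (x$2) \<partial>(lborel :: (real^2) measure)) = (\<integral>x. f x \<partial>lborel) * (\<integral>x. g x \<partial>lborel)"
proof -
  have [measurable]: "f \<in> borel_measurable borel" "g \<in> borel_measurable borel"
    using f g by auto
  have meas: "(\<lambda>x::real^2. f (x$1) * g (x$2)) \<in> borel_measurable borel" by measurable
  have I: "integrable (lborel \<Otimes>\<^sub>M lborel) (\<lambda>(a, b). f a * g b)"
  proof (rule lborel_pair.Fubini_integrable)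
    show "integrable lborel (\<lambda>x. \<integral>y. norm (case (x, y) of (a, b) \<Rightarrow> f a * g b) \<partial>lborel)"
      using f g by (simp add: norm_mult)
    show "AE x in lborel. integrable lborel (\<lambda>y. case (x, y) of (a, b) \<Rightarrow> f a * g b)" using g by simp
  qed measurable
  show "integrable lborel (\<lambda>x::real^2. f (x$1) * g (x$2))"
    by (subst lborel_real2, subst integrable_distr_eq) (use I meas in \<open>auto simp: case_prod_unfold\<close>)
  have "(\<integral>x. f (x$1) * g (x$2) \<partial>(lborel :: (real^2) measure)) = (\<integral>p. (case p of (a,b) \<Rightarrow> f a * g b) \<partial>(lborel \<Otimes>\<^sub>M lborel))"
    by (subst lborel_real2, subst integral_distr) (use meas in \<open>auto simp: case_prod_unfold\<close>)
  also have "\<dots> = (\<integral>a. \<integral>b. f a * g b \<partial>lborel \<partial>lborel)"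
    using lborel_pair.integral_fst'[OF I] by simp
  finally show "(\<integral>x. f (x$1) * g (x$2) \<partial>(lborel :: (real^2) measure)) = (\<integral>x. f x \<partial>lborel) * (\<integral>x. g x \<partial>lborel)"
    using f g by simp
qed

text \<open>A rescaling of the characteristic function of the standard normal distribution.\<close>

lemma gaussian_fourier_1:
  fixes e t :: real assumes e: "0 < e"
  shows "integrable lborel (\<lambda>x. complex_of_real (exp (- e * x\<^sup>2 / 2)) * exp (\<i> * complex_of_real (x * t)))"
    and "(\<integral>x. complex_of_real (exp (- e * x\<^sup>2 / 2)) * exp (\<i> * complex_of_real (x * t)) \<partial>lborel)
      = complex_of_real (sqrt (2 * pi / e) * exp (- t\<^sup>2 / (2 * e)))"
proof -
  let ?h = "\<lambda>s x. complex_of_real (std_normal_density x) * exp (\<i> * complex_of_real (s * x))"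
  have i: "integrable lborel (?h s)" for s
  proof (rule Bochner_Integration.integrable_bound[of _ "std_normal_density"])
    show "integrable lborel std_normal_density" using integrable_normal_moment[of 1 0 0] by simp
  qed (auto simp: norm_mult)
  have v: "(\<integral>x. ?h s x \<partial>lborel) = complex_of_real (exp (- s\<^sup>2 / 2))" for s
  proof -
    have "complex_of_real (exp (- s\<^sup>2 / 2)) = char std_normal_distribution s"
      by (simp add: char_std_normal_distribution)
    also have "\<dots> = (\<integral>x. std_normal_density x *\<^sub>R exp (\<i> * complex_of_real (s * x)) \<partial>lborel)"
      unfolding char_def by (subst integral_density) (auto simp: normal_density_nonneg)
    finally show ?thesis by (simp add: scaleR_conv_of_real)
  qed
  define s where "s = t / sqrt e"
  have se: "sqrt e > 0" using e by simp
  have eq: "?h s (0 + sqrt e * x) = complex_of_real (1 / sqrt (2 * pi)) * (complex_of_real (exp (- e * x\<^sup>2 / 2)) * exp (\<i> * complex_of_real (x * t)))" for x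
    using e by (simp add: std_normal_density_def power_mult_distrib s_def mult_ac)
  have I: "integrable lborel (\<lambda>x. ?h s (0 + sqrt e * x))"
    by (rule lborel_integrable_real_affine[OF i]) (use se in auto)
  let ?G = "\<lambda>x. complex_of_real (exp (- e * x\<^sup>2 / 2)) * exp (\<i> * complex_of_real (x * t))"
  define c where "c = sqrt (2 * pi / e)"
  have c: "complex_of_real c * (complex_of_real (sqrt e) * complex_of_real (1 / sqrt (2 * pi))) = 1"
  proof -
    have "c * (sqrt e * (1 / sqrt (2 * pi))) = 1" using e by (simp add: c_def real_sqrt_divide)
    then show ?thesis by (metis of_real_1 of_real_mult)
  qed
  have G: "?G x = complex_of_real (sqrt (2 * pi)) * ?h s (0 + sqrt e * x)" for x
    unfolding eq by simp
  show "integrable lborel ?G"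
    unfolding G by (rule integrable_mult_right[OF I])
  have "complex_of_real (exp (- s\<^sup>2 / 2)) = \<bar>sqrt e\<bar> *\<^sub>R (\<integral>x. ?h s (0 + sqrt e * x) \<partial>lborel)"
    unfolding v[symmetric] by (rule lborel_integral_real_affine) (use se in auto)
  also have "\<dots> = complex_of_real (sqrt e) * (complex_of_real (1 / sqrt (2 * pi)) * (\<integral>x. ?G x \<partial>lborel))"
    unfolding eq integral_mult_right_zero scaleR_conv_of_real using se by simp
  finally have "complex_of_real c * complex_of_real (exp (- s\<^sup>2 / 2))
      = complex_of_real c * (complex_of_real (sqrt e) * complex_of_real (1 / sqrt (2 * pi))) * (\<integral>x. ?G x \<partial>lborel)"
    by (simp only: mult.assoc)
  moreover have "- s\<^sup>2 / 2 = - t\<^sup>2 / (2 * e)" using e by (simp add: s_def power_divide)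
  ultimately show "(\<integral>x. ?G x \<partial>lborel)
      = complex_of_real (sqrt (2 * pi / e) * exp (- t\<^sup>2 / (2 * e)))"
    unfolding c by (simp add: c_def mult.commute)
qed

lemma inner_vec2: "(x::real^2) \<bullet> y = x$1 * y$1 + x$2 * y$2"
  by (simp add: inner_vec_def sum_2)

lemma norm_vec2: "(norm (x::real^2))\<^sup>2 = (x$1)\<^sup>2 + (x$2)\<^sup>2"
  unfolding power2_norm_eq_inner inner_vec2 by (simp add: power2_eq_square)

lemma gaussian_fourier_2:
  fixes e :: real and x :: "real^2" assumes e: "0 < e"
  shows "integrable lborel (\<lambda>w::real^2. complex_of_real (exp (- e * (norm w)\<^sup>2 / 2)) * exp (\<i> * complex_of_real (w \<bullet> x)))"
    and "(\<integral>w. complex_of_real (exp (- e * (norm w)\<^sup>2 / 2)) * exp (\<i> * complex_of_real (w \<bullet> x)) \<partial>(lborel :: (real^2) measure))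
      = complex_of_real (2 * pi / e * exp (- (norm x)\<^sup>2 / (2 * e)))"
proof -
  let ?g = "\<lambda>t x. complex_of_real (exp (- e * x\<^sup>2 / 2)) * exp (\<i> * complex_of_real (x * t))"
  have eq: "complex_of_real (exp (- e * (norm w)\<^sup>2 / 2)) * exp (\<i> * complex_of_real (w \<bullet> x)) = ?g (x$1) (w$1) * ?g (x$2) (w$2)" for w :: "real^2"
  proof -
    have a: "exp (- e * (norm w)\<^sup>2 / 2) = exp (- e * (w$1)\<^sup>2 / 2) * exp (- e * (w$2)\<^sup>2 / 2)"
      unfolding norm_vec2 exp_add[symmetric] by (simp add: field_simps)
    have b: "exp (\<i> * complex_of_real (w \<bullet> x)) = exp (\<i> * complex_of_real (w$1 * x$1)) * exp (\<i> * complex_of_real (w$2 * x$2))"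
      unfolding inner_vec2 exp_add[symmetric] by (simp add: algebra_simps)
    show ?thesis unfolding a b by simp
  qed
  note P = has_bochner_integral_real2_prod[OF gaussian_fourier_1(1)[OF e, of "x$1"] gaussian_fourier_1(1)[OF e, of "x$2"]]
  show "integrable lborel (\<lambda>w::real^2. complex_of_real (exp (- e * (norm w)\<^sup>2 / 2)) * exp (\<i> * complex_of_real (w \<bullet> x)))"
    unfolding eq by (rule P(1))
  have "2 * pi / e * exp (- (norm x)\<^sup>2 / (2 * e)) = (sqrt (2 * pi / e) * sqrt (2 * pi / e)) * (exp (- (x$1)\<^sup>2 / (2 * e)) * exp (- (x$2)\<^sup>2 / (2 * e)))"
    unfolding norm_vec2 exp_add[symmetric] using e by (simp add: diff_divide_distrib)
  also have "\<dots> = (sqrt (2 * pi / e) * exp (- (x$1)\<^sup>2 / (2 * e))) * (sqrt (2 * pi / e) * exp (- (x$2)\<^sup>2 / (2 * e)))"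
    by (simp only: mult_ac)
  finally have E: "2 * pi / e * exp (- (norm x)\<^sup>2 / (2 * e)) = (sqrt (2 * pi / e) * exp (- (x$1)\<^sup>2 / (2 * e))) * (sqrt (2 * pi / e) * exp (- (x$2)\<^sup>2 / (2 * e)))" .
  show "(\<integral>w. complex_of_real (exp (- e * (norm w)\<^sup>2 / 2)) * exp (\<i> * complex_of_real (w \<bullet> x)) \<partial>(lborel :: (real^2) measure))
      = complex_of_real (2 * pi / e * exp (- (norm x)\<^sup>2 / (2 * e)))"
    unfolding eq P(2) gaussian_fourier_1(2)[OF e] E of_real_mult[symmetric] ..
qed

section \<open>Parseval's identity with Gaussian damping\<close>

text \<open>The heat kernel at time \<open>e / 2\<close>: the density of a centred Gaussian vector with covariance \<open>e\<close> times
the identity. It is the Fourier transform of the damping factor \<open>exp (- e \<bar>w\<bar>\<^sup>2 / 2)\<close> divided by \<open>4 \<pi>\<^sup>2\<close>.\<close>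

definition gauss_kernel :: "real \<Rightarrow> real^2 \<Rightarrow> real" where
  "gauss_kernel e z = exp (- (norm z)\<^sup>2 / (2 * e)) / (2 * pi * e)"

lemma gauss_kernel_nonneg: "0 < e \<Longrightarrow> 0 \<le> gauss_kernel e z"
  by (simp add: gauss_kernel_def)

lemma gauss_kernel_measurable [measurable]: "gauss_kernel e \<in> borel_measurable borel"
  unfolding gauss_kernel_def by measurable

lemma gauss_kernel_minus: "gauss_kernel e (x - y) = gauss_kernel e (y - x)"
  by (simp add: gauss_kernel_def norm_minus_commute)

lemma gauss_kernel_nn_integral:
  assumes "0 < e" shows "(\<integral>\<^sup>+z. ennreal (gauss_kernel e z) \<partial>lborel) = 1"
proof -
  have e': "0 < 1/e" using assms by simp
  have eq: "complex_of_real (exp (- (1/e) * (norm w)\<^sup>2 / 2)) * exp (\<i> * complex_of_real (w \<bullet> 0)) = complex_of_real (2 * pi * e * gauss_kernel e w)" for w :: "real^2"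
    using assms by (simp add: gauss_kernel_def)
  have I: "integrable lborel (\<lambda>w. 2 * pi * e * gauss_kernel e w)"
    using gaussian_fourier_2(1)[OF e', of 0] unfolding eq complex_of_real_integrable_eq .
  have "complex_of_real (\<integral>w. 2 * pi * e * gauss_kernel e w \<partial>lborel) = complex_of_real (2 * pi * e)"
    using gaussian_fourier_2(2)[OF e', of 0] unfolding eq integral_complex_of_real by simp
  then have v: "(\<integral>w. 2 * pi * e * gauss_kernel e w \<partial>lborel) = 2 * pi * e"
    unfolding of_real_eq_iff .
  then have v': "(\<integral>w. gauss_kernel e w \<partial>lborel) = 1" using assms by simp
  have "integrable lborel (\<lambda>w. (1 / (2 * pi * e)) * (2 * pi * e * gauss_kernel e w))"
    by (rule integrable_mult_right[OF I])
  then have I': "integrable lborel (gauss_kernel e)" using assms by simp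
  show ?thesis
    using nn_integral_eq_integral[OF I'] gauss_kernel_nonneg[OF assms] v' by simp
qed

lemma nn_integral_reflect:
  fixes f :: "real^2 \<Rightarrow> ennreal"
  assumes [measurable]: "f \<in> borel_measurable borel"
  shows "(\<integral>\<^sup>+y. f (x - y) \<partial>lborel) = (\<integral>\<^sup>+y. f y \<partial>lborel)"
proof -
  have "(\<integral>\<^sup>+y. f y \<partial>lborel) = (\<integral>\<^sup>+y. f y \<partial>(density (distr lborel borel (\<lambda>y. x + (-1) *\<^sub>R y)) (\<lambda>_. ennreal (\<bar>-1\<bar>^DIM(real^2)))))"
    by (subst lborel_affine[of "-1" x]) auto
  also have "\<dots> = (\<integral>\<^sup>+y. f (x + (-1) *\<^sub>R y) \<partial>lborel)"
    by (simp add: density_1 nn_integral_distr)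
  finally show ?thesis by simp
qed

lemma gauss_kernel_nn_integral_shift:
  assumes "0 < e"
  shows "(\<integral>\<^sup>+y. ennreal (gauss_kernel e (x - y)) \<partial>lborel) = 1" "(\<integral>\<^sup>+y. ennreal (gauss_kernel e (y - x)) \<partial>lborel) = 1"
proof -
  show "(\<integral>\<^sup>+y. ennreal (gauss_kernel e (x - y)) \<partial>lborel) = 1"
    using nn_integral_reflect[of "\<lambda>y. ennreal (gauss_kernel e y)" x] gauss_kernel_nn_integral[OF assms] by simp
  then show "(\<integral>\<^sup>+y. ennreal (gauss_kernel e (y - x)) \<partial>lborel) = 1" by (simp add: gauss_kernel_minus)
qed

text \<open>On the scale \<open>sqrt e\<close> of the kernel a factor \<open>norm z\<close> is absorbed by doubling the variance, because
\<open>t \<le> exp (t\<^sup>2 / 4)\<close>. Each such factor therefore gains \<open>sqrt e\<close>.\<close>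

lemma norm_mult_gauss_kernel:
  assumes "0 < e" shows "norm z * gauss_kernel e z \<le> 2 * sqrt e * gauss_kernel (2 * e) z"
proof -
  define t where "t = norm z / sqrt e"
  have z: "norm z = sqrt e * t" and t: "(norm z)\<^sup>2 = e * t\<^sup>2" using assms by (simp_all add: t_def power_divide)
  have "t \<le> 1 + t\<^sup>2 / 4" using zero_le_power2[of "t/2 - 1"] by (simp add: power2_diff power_divide)
  also have "\<dots> \<le> exp (t\<^sup>2 / 4)" by (rule exp_ge_add_one_self)
  finally have "t * exp (- t\<^sup>2 / 2) \<le> exp (t\<^sup>2 / 4) * exp (- t\<^sup>2 / 2)" by (rule mult_right_mono) simp
  also have "\<dots> = exp (- t\<^sup>2 / 4)" unfolding exp_add[symmetric] by (simp add: field_simps)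
  finally have *: "t * exp (- t\<^sup>2 / 2) \<le> exp (- t\<^sup>2 / 4)" .
  have g: "gauss_kernel e z = exp (- t\<^sup>2 / 2) / (2 * pi * e)" "gauss_kernel (2 * e) z = exp (- t\<^sup>2 / 4) / (4 * pi * e)"
    using assms by (simp_all add: gauss_kernel_def t)
  have "norm z * gauss_kernel e z = sqrt e / (2 * pi * e) * (t * exp (- t\<^sup>2 / 2))"
    unfolding g z by simp
  also have "\<dots> \<le> sqrt e / (2 * pi * e) * exp (- t\<^sup>2 / 4)"
    using assms by (intro mult_left_mono *) auto
  also have "\<dots> = 2 * sqrt e * gauss_kernel (2 * e) z"
    using assms by (simp add: g)
  finally show ?thesis .
qed

text \<open>Schur's test: the kernel has integral one in either variable. The last bound uses
\<open>a b \<le> a\<^sup>2 + b\<^sup>2\<close> under the integral, which keeps it free of products of norms.\<close>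

lemma gauss_kernel_schur:
  fixes a b :: "real^2 \<Rightarrow> real"
  assumes e: "0 < e" and [measurable]: "a \<in> borel_measurable borel" "b \<in> borel_measurable borel"
    and n: "\<And>x. 0 \<le> a x" "\<And>x. 0 \<le> b x"
  shows "(\<integral>\<^sup>+p. ennreal (a (fst p) * gauss_kernel e (fst p - snd p)) \<partial>(lborel \<Otimes>\<^sub>M lborel)) = (\<integral>\<^sup>+x. ennreal (a x) \<partial>lborel)"
    and "(\<integral>\<^sup>+p. ennreal (b (snd p) * gauss_kernel e (fst p - snd p)) \<partial>(lborel \<Otimes>\<^sub>M lborel)) = (\<integral>\<^sup>+x. ennreal (b x) \<partial>lborel)"
    and "(\<integral>\<^sup>+p. ennreal (a (fst p) * b (snd p) * gauss_kernel e (fst p - snd p)) \<partial>(lborel \<Otimes>\<^sub>M lborel))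
      \<le> (\<integral>\<^sup>+x. ennreal ((a x)\<^sup>2) \<partial>lborel) + (\<integral>\<^sup>+x. ennreal ((b x)\<^sup>2) \<partial>lborel)"
proof -
  have 1: "(\<integral>\<^sup>+p. ennreal (a (fst p) * gauss_kernel e (fst p - snd p)) \<partial>(lborel \<Otimes>\<^sub>M lborel)) = (\<integral>\<^sup>+x. ennreal (a x) \<partial>lborel)"
    if [measurable]: "a \<in> borel_measurable borel" and "\<And>x. 0 \<le> a x" for a :: "real^2 \<Rightarrow> real"
    using that(2) gauss_kernel_nn_integral_shift[OF e]
    by (subst lborel.nn_integral_fst[symmetric]) (auto simp: ennreal_mult gauss_kernel_nonneg[OF e] nn_integral_cmult)
  have 2: "(\<integral>\<^sup>+p. ennreal (b (snd p) * gauss_kernel e (fst p - snd p)) \<partial>(lborel \<Otimes>\<^sub>M lborel)) = (\<integral>\<^sup>+x. ennreal (b x) \<partial>lborel)"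
    if [measurable]: "b \<in> borel_measurable borel" and "\<And>x. 0 \<le> b x" for b :: "real^2 \<Rightarrow> real"
    using that(2) gauss_kernel_nn_integral_shift[OF e]
    by (subst lborel_pair.nn_integral_snd[symmetric]) (auto simp: ennreal_mult gauss_kernel_nonneg[OF e] nn_integral_cmult)
  show "(\<integral>\<^sup>+p. ennreal (a (fst p) * gauss_kernel e (fst p - snd p)) \<partial>(lborel \<Otimes>\<^sub>M lborel)) = (\<integral>\<^sup>+x. ennreal (a x) \<partial>lborel)"
    "(\<integral>\<^sup>+p. ennreal (b (snd p) * gauss_kernel e (fst p - snd p)) \<partial>(lborel \<Otimes>\<^sub>M lborel)) = (\<integral>\<^sup>+x. ennreal (b x) \<partial>lborel)"
    by (rule 1 2; use n in measurable)+
  have "(\<integral>\<^sup>+p. ennreal (a (fst p) * b (snd p) * gauss_kernel e (fst p - snd p)) \<partial>(lborel \<Otimes>\<^sub>M lborel))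
     \<le> (\<integral>\<^sup>+p. ennreal ((a (fst p))\<^sup>2 * gauss_kernel e (fst p - snd p)) + ennreal ((b (snd p))\<^sup>2 * gauss_kernel e (fst p - snd p)) \<partial>(lborel \<Otimes>\<^sub>M lborel))"
  proof (rule nn_integral_mono)
    fix p :: "(real^2) \<times> (real^2)"
    let ?a = "a (fst p)" and ?b = "b (snd p)" and ?g = "gauss_kernel e (fst p - snd p)"
    have "0 \<le> ?a * ?b" using n by simp
    then have "?a * ?b \<le> ?a\<^sup>2 + ?b\<^sup>2" using sum_squares_bound[of ?a ?b] by linarith
    then have "?a * ?b * ?g \<le> (?a\<^sup>2 + ?b\<^sup>2) * ?g" by (rule mult_right_mono) (rule gauss_kernel_nonneg[OF e])
    then have "ennreal (?a * ?b * ?g) \<le> ennreal (?a\<^sup>2 * ?g + ?b\<^sup>2 * ?g)" by (intro ennreal_leI) (simp add: distrib_right)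
    also have "\<dots> = ennreal (?a\<^sup>2 * ?g) + ennreal (?b\<^sup>2 * ?g)" by (rule ennreal_plus) (auto simp: gauss_kernel_nonneg[OF e])
    finally show "ennreal (?a * ?b * ?g) \<le> ennreal (?a\<^sup>2 * ?g) + ennreal (?b\<^sup>2 * ?g)" .
  qed
  also have "\<dots> = (\<integral>\<^sup>+x. ennreal ((a x)\<^sup>2) \<partial>lborel) + (\<integral>\<^sup>+x. ennreal ((b x)\<^sup>2) \<partial>lborel)"
    using 1[of "\<lambda>x. (a x)\<^sup>2"] 2[of "\<lambda>x. (b x)\<^sup>2"] by (subst nn_integral_add) simp_all
  finally show "(\<integral>\<^sup>+p. ennreal (a (fst p) * b (snd p) * gauss_kernel e (fst p - snd p)) \<partial>(lborel \<Otimes>\<^sub>M lborel))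
      \<le> (\<integral>\<^sup>+x. ennreal ((a x)\<^sup>2) \<partial>lborel) + (\<integral>\<^sup>+x. ennreal ((b x)\<^sup>2) \<partial>lborel)" .
qed

definition FT :: "(real^2 \<Rightarrow> complex) \<Rightarrow> real^2 \<Rightarrow> complex" where
  "FT u w = (\<integral>x. u x * exp (- (\<i> * complex_of_real (w \<bullet> x))) \<partial>lborel)"

lemma norm_exp_i [simp]: "cmod (exp (- (\<i> * complex_of_real t))) = 1" "cmod (exp (\<i> * complex_of_real t)) = 1"
  by auto

lemma integrable_mult_char:
  fixes u :: "real^2 \<Rightarrow> complex"
  assumes "integrable lborel u"
  shows "integrable lborel (\<lambda>x. u x * exp (- (\<i> * complex_of_real (w \<bullet> x))))"
    "integrable lborel (\<lambda>x. u x * exp (\<i> * complex_of_real (w \<bullet> x)))"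
  by (rule Bochner_Integration.integrable_bound[OF assms]; use assms in \<open>auto simp: norm_mult intro!: borel_measurable_times\<close>)+

lemma FT_measurable [measurable]:
  assumes "u \<in> borel_measurable borel" shows "FT u \<in> borel_measurable borel"
proof -
  note [measurable] = assms
  have "(\<lambda>w. \<integral>x. u x * exp (- (\<i> * complex_of_real (w \<bullet> x))) \<partial>lborel) \<in> borel_measurable lborel"
    by (rule lborel.borel_measurable_lebesgue_integral) measurable
  then show ?thesis by (simp add: FT_def[abs_def])
qed

lemma integrable_prod_mult:
  fixes u :: "'a::euclidean_space \<Rightarrow> complex" and v :: "'b::euclidean_space \<Rightarrow> complex"
  assumes u: "integrable lborel u" and v: "integrable lborel v"
  shows "integrable (lborel \<Otimes>\<^sub>M lborel) (\<lambda>p. u (fst p) * v (snd p))"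
    and "(\<integral>p. u (fst p) * v (snd p) \<partial>(lborel \<Otimes>\<^sub>M lborel)) = (\<integral>x. u x \<partial>lborel) * (\<integral>x. v x \<partial>lborel)"
proof -
  have [measurable]: "u \<in> borel_measurable borel" "v \<in> borel_measurable borel" using u v by auto
  show I: "integrable (lborel \<Otimes>\<^sub>M lborel) (\<lambda>p. u (fst p) * v (snd p))"
  proof (rule lborel_pair.Fubini_integrable)
    show "integrable lborel (\<lambda>x. \<integral>y. norm (u (fst (x, y)) * v (snd (x, y))) \<partial>lborel)"
      using u v by (simp add: norm_mult)
    show "AE x in lborel. integrable lborel (\<lambda>y. u (fst (x, y)) * v (snd (x, y)))" using v by simp
  qed measurable
  have "(\<integral>p. u (fst p) * v (snd p) \<partial>(lborel \<Otimes>\<^sub>M lborel)) = (\<integral>a. \<integral>b. u a * v b \<partial>lborel \<partial>lborel)"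
    using lborel_pair.integral_fst'[OF I] by simp
  then show "(\<integral>p. u (fst p) * v (snd p) \<partial>(lborel \<Otimes>\<^sub>M lborel)) = (\<integral>x. u x \<partial>lborel) * (\<integral>x. v x \<partial>lborel)"
    using u v by simp
qed

lemma exp_gauss_integrable: "0 < e \<Longrightarrow> integrable lborel (\<lambda>w::real^2. complex_of_real (exp (- e * (norm w)\<^sup>2 / 2)))"
  using gaussian_fourier_2(1)[of e 0] by simp

lemma cnj_borel_measurable [measurable]: "cnj \<in> borel_measurable borel"
  by (intro borel_measurable_continuous_onI continuous_intros)

text \<open>Both transforms are absolutely convergent integrals and the Gaussian makes the outer one absolutely
convergent as well, so Fubini's theorem applies and the integration over \<open>w\<close> produces the kernel.\<close>

lemma regularised_parseval:
  fixes u v :: "real^2 \<Rightarrow> complex"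
  assumes e: "0 < e" and u: "integrable lborel u" and v: "integrable lborel v"
  shows "(\<integral>w. FT u w * cnj (FT v w) * complex_of_real (exp (- e * (norm w)\<^sup>2 / 2)) \<partial>lborel)
    = 4 * pi\<^sup>2 * (\<integral>p. u (fst p) * cnj (v (snd p)) * complex_of_real (gauss_kernel e (fst p - snd p)) \<partial>(lborel \<Otimes>\<^sub>M lborel))"
proof -
  have [measurable]: "u \<in> borel_measurable borel" "v \<in> borel_measurable borel" using u v by auto
  have v': "integrable lborel (\<lambda>x. cnj (v x))" using v by simp
  let ?E = "\<lambda>w. complex_of_real (exp (- e * (norm w)\<^sup>2 / 2))"
  let ?P = "\<lambda>w p. u (fst p) * cnj (v (snd p)) * exp (\<i> * complex_of_real (w \<bullet> (snd p - fst p)))"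
  have 1: "FT u w * cnj (FT v w) = (\<integral>p. ?P w p \<partial>lborel)" for w :: "real^2"
  proof -
    have c: "cnj (FT v w) = (\<integral>x. cnj (v x) * exp (\<i> * complex_of_real (w \<bullet> x)) \<partial>lborel)"
      unfolding FT_def Bochner_Integration.integral_cnj[symmetric] by (simp add: exp_cnj)
    have "FT u w * cnj (FT v w) = (\<integral>p. (u (fst p) * exp (- (\<i> * complex_of_real (w \<bullet> fst p)))) * (cnj (v (snd p)) * exp (\<i> * complex_of_real (w \<bullet> snd p))) \<partial>(lborel \<Otimes>\<^sub>M lborel))"
      unfolding c unfolding FT_def
      by (rule integrable_prod_mult(2)[symmetric]) (intro integrable_mult_char u v')+
    also have "\<dots> = (\<integral>p. ?P w p \<partial>lborel)"
    proof (unfold lborel_prod, rule Bochner_Integration.integral_cong[OF refl])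
      fix p :: "(real^2) \<times> (real^2)"
      have "exp (- (\<i> * complex_of_real (w \<bullet> fst p))) * exp (\<i> * complex_of_real (w \<bullet> snd p)) = exp (\<i> * complex_of_real (w \<bullet> (snd p - fst p)))"
        unfolding exp_add[symmetric] by (simp add: algebra_simps inner_diff_right)
      moreover have "u (fst p) * exp (- (\<i> * complex_of_real (w \<bullet> fst p))) * (cnj (v (snd p)) * exp (\<i> * complex_of_real (w \<bullet> snd p)))
        = u (fst p) * cnj (v (snd p)) * (exp (- (\<i> * complex_of_real (w \<bullet> fst p))) * exp (\<i> * complex_of_real (w \<bullet> snd p)))"
        by (simp only: mult_ac)
      ultimately show "u (fst p) * exp (- (\<i> * complex_of_real (w \<bullet> fst p))) * (cnj (v (snd p)) * exp (\<i> * complex_of_real (w \<bullet> snd p))) = ?P w p"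
        by (simp only:)
    qed
    finally show ?thesis .
  qed
  have J: "integrable lborel (\<lambda>p. u (fst p) * cnj (v (snd p)))"
    using integrable_prod_mult(1)[OF u v'] by (simp add: lborel_prod)
  note I0 = integrable_prod_mult(1)[OF exp_gauss_integrable[OF e] J]
  have I: "integrable (lborel \<Otimes>\<^sub>M lborel) (\<lambda>(w,p). ?P w p * ?E w)"
  proof (rule Bochner_Integration.integrable_bound[OF I0])
    have "(\<lambda>q. ?P (fst q) (snd q) * ?E (fst q)) \<in> borel_measurable (lborel \<Otimes>\<^sub>M (lborel \<Otimes>\<^sub>M lborel))"
      by measurable
    then show "(\<lambda>(w,p). ?P w p * ?E w) \<in> borel_measurable (lborel \<Otimes>\<^sub>M lborel)"
      unfolding lborel_prod case_prod_unfold .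
  qed (auto simp: norm_mult)
  have "(\<integral>w. FT u w * cnj (FT v w) * ?E w \<partial>lborel) = (\<integral>w. (\<integral>p. ?P w p * ?E w \<partial>lborel) \<partial>lborel)"
    unfolding 1 by simp
  also have "\<dots> = (\<integral>p. (\<integral>w. ?P w p * ?E w \<partial>lborel) \<partial>lborel)"
    by (rule lborel_pair.Fubini_integral[OF I, symmetric])
  also have "\<dots> = (\<integral>p. 4 * pi\<^sup>2 * (u (fst p) * cnj (v (snd p)) * complex_of_real (gauss_kernel e (fst p - snd p))) \<partial>lborel)"
  proof (rule Bochner_Integration.integral_cong[OF refl])
    fix p :: "(real^2) \<times> (real^2)"
    have "(\<integral>w. ?P w p * ?E w \<partial>lborel) = u (fst p) * cnj (v (snd p)) * (\<integral>w. ?E w * exp (\<i> * complex_of_real (w \<bullet> (snd p - fst p))) \<partial>lborel)"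
      unfolding integral_mult_right_zero[symmetric] by (simp only: mult_ac)
    also have "\<dots> = u (fst p) * cnj (v (snd p)) * complex_of_real (4 * pi\<^sup>2 * gauss_kernel e (fst p - snd p))"
      unfolding gaussian_fourier_2(2)[OF e] using e by (simp add: gauss_kernel_def norm_minus_commute power2_eq_square)
    finally show "(\<integral>w. ?P w p * ?E w \<partial>lborel) = 4 * pi\<^sup>2 * (u (fst p) * cnj (v (snd p)) * complex_of_real (gauss_kernel e (fst p - snd p)))"
      by simp
  qed
  finally show ?thesis by (simp add: lborel_prod)
qed

section \<open>Consequences of the damped identity\<close>

lemma in_L2_borel: "in_L2 lborel F \<Longrightarrow> F \<in> borel_measurable borel"
  by (simp add: in_L2_def)

lemma L2_mult_integrable:
  fixes F G :: "'a \<Rightarrow> complex"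
  assumes "in_L2 M F" "in_L2 M G"
  shows "integrable M (\<lambda>x. F x * G x)" "cmod (\<integral>x. F x * G x \<partial>M) \<le> L2n M F * L2n M G"
proof -
  note cs = Cauchy_Schwarz_integral[OF in_L2_norm[OF assms(1)] in_L2_norm[OF assms(2)]]
  have [measurable]: "F \<in> borel_measurable M" "G \<in> borel_measurable M" using assms by (auto intro: in_L2_measurable)
  show "integrable M (\<lambda>x. F x * G x)"
    by (rule Bochner_Integration.integrable_bound[OF cs(1)]) (auto simp: norm_mult)
  have "cmod (\<integral>x. F x * G x \<partial>M) \<le> (\<integral>x. cmod (F x * G x) \<partial>M)" by (rule integral_norm_bound)
  also have "\<dots> \<le> L2n M F * L2n M G" using cs(2) by (simp add: norm_mult L2n_norm)
  finally show "cmod (\<integral>x. F x * G x \<partial>M) \<le> L2n M F * L2n M G" .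
qed

lemma in_L2_cnj: "in_L2 M F \<Longrightarrow> in_L2 M (\<lambda>x. cnj (F x))"
  by (auto simp: in_L2_def)

lemma L2_nn_integral:
  assumes "in_L2 M F" shows "(\<integral>\<^sup>+x. ennreal ((norm (F x))\<^sup>2) \<partial>M) = ennreal ((L2n M F)\<^sup>2)"
  using in_L2_integrable[OF assms] by (simp add: L2n_sq nn_integral_eq_integral)

lemma in_L2I_nn:
  assumes "F \<in> borel_measurable M" "(\<integral>\<^sup>+x. ennreal ((norm (F x))\<^sup>2) \<partial>M) \<le> ennreal C" "0 \<le> C"
  shows "in_L2 M F" "(L2n M F)\<^sup>2 \<le> C"
proof -
  note [measurable] = assms(1)
  show L: "in_L2 M F"
    unfolding in_L2_def
  proof (intro conjI integrableI_bounded)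
    have "(\<integral>\<^sup>+x. ennreal (norm ((norm (F x))\<^sup>2)) \<partial>M) \<le> ennreal C" using assms(2) by simp
    also have "\<dots> < \<infinity>" by simp
    finally show "(\<integral>\<^sup>+x. ennreal (norm ((norm (F x))\<^sup>2)) \<partial>M) < \<infinity>" .
  qed measurable
  show "(L2n M F)\<^sup>2 \<le> C" using assms(2,3) unfolding L2_nn_integral[OF L] by simp
qed

text \<open>A function of two variables that vanishes to first order on the diagonal is negligible against the
kernel as \<open>e\<close> tends to zero.\<close>

lemma gauss_kernel_commutator:
  fixes h :: "(real^2) \<times> (real^2) \<Rightarrow> complex"
  assumes e: "0 < e" and [measurable]: "h \<in> borel_measurable (lborel \<Otimes>\<^sub>M lborel)" "m \<in> borel_measurable (lborel \<Otimes>\<^sub>M lborel)"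
    and h: "\<And>x y. cmod (h (x,y)) \<le> norm (x - y) * m (x, y)" and m: "\<And>p. 0 \<le> m p"
    and C: "(\<integral>\<^sup>+p. ennreal (m p * gauss_kernel (2 * e) (fst p - snd p)) \<partial>(lborel \<Otimes>\<^sub>M lborel)) \<le> ennreal C" "0 \<le> C"
  shows "cmod (\<integral>p. h p * complex_of_real (gauss_kernel e (fst p - snd p)) \<partial>(lborel \<Otimes>\<^sub>M lborel)) \<le> 2 * sqrt e * C"
proof -
  have "ennreal (cmod (\<integral>p. h p * complex_of_real (gauss_kernel e (fst p - snd p)) \<partial>(lborel \<Otimes>\<^sub>M lborel)))
      \<le> (\<integral>\<^sup>+p. ennreal (cmod (h p * complex_of_real (gauss_kernel e (fst p - snd p)))) \<partial>(lborel \<Otimes>\<^sub>M lborel))"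
  proof (cases "integrable (lborel \<Otimes>\<^sub>M lborel) (\<lambda>p. h p * complex_of_real (gauss_kernel e (fst p - snd p)))")
    case True
    then show ?thesis by (rule integral_norm_bound_ennreal)
  qed (simp add: not_integrable_integral_eq)
  also have "\<dots> \<le> (\<integral>\<^sup>+p. ennreal (2 * sqrt e) * ennreal (m p * gauss_kernel (2 * e) (fst p - snd p)) \<partial>(lborel \<Otimes>\<^sub>M lborel))"
  proof (rule nn_integral_mono)
    fix p :: "(real^2) \<times> (real^2)"
    let ?z = "fst p - snd p"
    have "cmod (h p * complex_of_real (gauss_kernel e ?z)) = cmod (h (fst p, snd p)) * gauss_kernel e ?z"
      using gauss_kernel_nonneg[OF e, of ?z] by (simp add: norm_mult)
    also have "\<dots> \<le> norm ?z * m (fst p, snd p) * gauss_kernel e ?z"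
      by (intro mult_right_mono h gauss_kernel_nonneg e)
    also have "\<dots> = m p * (norm ?z * gauss_kernel e ?z)" by simp
    also have "\<dots> \<le> m p * (2 * sqrt e * gauss_kernel (2 * e) ?z)"
      by (intro mult_left_mono norm_mult_gauss_kernel e m)
    finally have "cmod (h p * complex_of_real (gauss_kernel e ?z)) \<le> (2 * sqrt e) * (m p * gauss_kernel (2 * e) ?z)" by (simp add: mult_ac)
    then show "ennreal (cmod (h p * complex_of_real (gauss_kernel e ?z))) \<le> ennreal (2 * sqrt e) * ennreal (m p * gauss_kernel (2 * e) ?z)"
      using m[of p] gauss_kernel_nonneg[of "2*e" ?z] e by (simp add: ennreal_leI flip: ennreal_mult)
  qed
  also have "\<dots> = ennreal (2 * sqrt e) * (\<integral>\<^sup>+p. ennreal (m p * gauss_kernel (2 * e) (fst p - snd p)) \<partial>(lborel \<Otimes>\<^sub>M lborel))"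
    by (rule nn_integral_cmult) measurable
  also have "\<dots> \<le> ennreal (2 * sqrt e) * ennreal C" by (intro mult_left_mono C) simp
  also have "\<dots> = ennreal (2 * sqrt e * C)" using e C by (simp add: ennreal_mult)
  finally show ?thesis using e C by (simp add: ennreal_le_iff)
qed

lemma gauss_kernel_pair_integrable:
  fixes u v :: "real^2 \<Rightarrow> complex"
  assumes e: "0 < e" and u: "in_L2 lborel u" and v: "in_L2 lborel v"
  shows "integrable (lborel \<Otimes>\<^sub>M lborel) (\<lambda>p. u (fst p) * cnj (v (snd p)) * complex_of_real (gauss_kernel e (fst p - snd p)))"
    and "cmod (\<integral>p. u (fst p) * cnj (v (snd p)) * complex_of_real (gauss_kernel e (fst p - snd p)) \<partial>(lborel \<Otimes>\<^sub>M lborel))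
      \<le> (L2n lborel u)\<^sup>2 + (L2n lborel v)\<^sup>2"
proof -
  have [measurable]: "u \<in> borel_measurable borel" "v \<in> borel_measurable borel"
    using in_L2_borel[OF u] in_L2_borel[OF v] by auto
  let ?f = "\<lambda>p. u (fst p) * cnj (v (snd p)) * complex_of_real (gauss_kernel e (fst p - snd p))"
  have "(\<integral>\<^sup>+p. ennreal (cmod (?f p)) \<partial>(lborel \<Otimes>\<^sub>M lborel))
      = (\<integral>\<^sup>+p. ennreal (cmod (u (fst p)) * cmod (v (snd p)) * gauss_kernel e (fst p - snd p)) \<partial>(lborel \<Otimes>\<^sub>M lborel))"
    using gauss_kernel_nonneg[OF e] by (simp add: norm_mult)
  also have "\<dots> \<le> (\<integral>\<^sup>+x. ennreal ((cmod (u x))\<^sup>2) \<partial>lborel) + (\<integral>\<^sup>+x. ennreal ((cmod (v x))\<^sup>2) \<partial>lborel)"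
    by (rule gauss_kernel_schur(3)[OF e]) auto
  also have "\<dots> = ennreal ((L2n lborel u)\<^sup>2 + (L2n lborel v)\<^sup>2)"
    by (simp add: L2_nn_integral u v ennreal_plus)
  finally have b: "(\<integral>\<^sup>+p. ennreal (cmod (?f p)) \<partial>(lborel \<Otimes>\<^sub>M lborel)) \<le> ennreal ((L2n lborel u)\<^sup>2 + (L2n lborel v)\<^sup>2)" .
  show I: "integrable (lborel \<Otimes>\<^sub>M lborel) ?f"
  proof (rule integrableI_bounded)
    show "(\<integral>\<^sup>+p. ennreal (cmod (?f p)) \<partial>(lborel \<Otimes>\<^sub>M lborel)) < \<infinity>"
      using b by (rule order.strict_trans1) simp
  qed measurable
  have "ennreal (cmod (integral\<^sup>L (lborel \<Otimes>\<^sub>M lborel) ?f)) \<le> ennreal ((L2n lborel u)\<^sup>2 + (L2n lborel v)\<^sup>2)"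
    using integral_norm_bound_ennreal[OF I] b by (rule order_trans)
  then show "cmod (integral\<^sup>L (lborel \<Otimes>\<^sub>M lborel) ?f) \<le> (L2n lborel u)\<^sup>2 + (L2n lborel v)\<^sup>2"
    by (subst (asm) ennreal_le_iff) auto
qed

lemma gauss_tendsto:
  fixes e :: "nat \<Rightarrow> real"
  assumes "e \<longlonglongrightarrow> 0" shows "(\<lambda>n. exp (- e n * c / 2)) \<longlonglongrightarrow> 1"
proof -
  have "(\<lambda>n. - e n * c / 2) \<longlonglongrightarrow> - 0 * c / 2"
    by (rule tendsto_divide[OF tendsto_mult[OF tendsto_minus[OF assms] tendsto_const] tendsto_const]) simp
  from tendsto_exp[OF this] show ?thesis by simp
qed

text \<open>For \<open>v = u\<close> the damped identity passes to the limit by Fatou's lemma. The constant is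
twice the sharp one of Plancherel's theorem, inherited from \<open>gauss_kernel_schur\<close>; only boundedness
matters for the extension to \<open>L\<^sub>2\<close>.\<close>

lemma FT_L2:
  assumes u: "integrable lborel u" "in_L2 lborel u"
  shows "in_L2 lborel (FT u)" and "(L2n lborel (FT u))\<^sup>2 \<le> 8 * pi\<^sup>2 * (L2n lborel u)\<^sup>2"
proof -
  have [measurable]: "u \<in> borel_measurable borel" using u by auto
  define e where "e n = 1 / real (Suc n)" for n
  have e0: "0 < e n" for n by (simp add: e_def)
  have elim: "e \<longlonglongrightarrow> 0" unfolding e_def by (rule LIMSEQ_Suc) (rule lim_1_over_n)
  define g where "g n w = (cmod (FT u w))\<^sup>2 * exp (- e n * (norm w)\<^sup>2 / 2)" for n and w :: "real^2"
  have [measurable]: "g n \<in> borel_measurable borel" for n unfolding g_def by measurable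
  have g0: "0 \<le> g n w" for n w by (simp add: g_def)
  have FTb: "cmod (FT u w) \<le> (\<integral>x. cmod (u x) \<partial>lborel)" for w
  proof -
    have "cmod (FT u w) \<le> (\<integral>x. cmod (u x * exp (- (\<i> * complex_of_real (w \<bullet> x)))) \<partial>lborel)"
      unfolding FT_def by (rule integral_norm_bound)
    then show ?thesis by (simp only: norm_mult norm_exp_i mult_1_right)
  qed
  have gI: "integrable lborel (g n)" for n
  proof (rule Bochner_Integration.integrable_bound)
    show "integrable lborel (\<lambda>w. (\<integral>x. cmod (u x) \<partial>lborel)\<^sup>2 * exp (- e n * (norm (w::real^2))\<^sup>2 / 2))"
      using exp_gauss_integrable[OF e0[of n]] unfolding complex_of_real_integrable_eq by (rule integrable_mult_right)
    show "AE w in lborel. norm (g n w) \<le> norm ((\<integral>x. cmod (u x) \<partial>lborel)\<^sup>2 * exp (- e n * (norm w)\<^sup>2 / 2))"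
      unfolding g_def by (intro AE_I2) (auto simp: abs_mult intro!: mult_right_mono power_mono FTb)
  qed measurable
  have gb: "(\<integral>\<^sup>+w. ennreal (g n w) \<partial>lborel) \<le> ennreal (8 * pi\<^sup>2 * (L2n lborel u)\<^sup>2)" for n
  proof -
    have "complex_of_real (\<integral>w. g n w \<partial>lborel) = (\<integral>w. FT u w * cnj (FT u w) * complex_of_real (exp (- e n * (norm w)\<^sup>2 / 2)) \<partial>lborel)"
      unfolding integral_complex_of_real[symmetric] g_def by (simp add: complex_norm_square[symmetric])
    also have "\<dots> = 4 * pi\<^sup>2 * (\<integral>p. u (fst p) * cnj (u (snd p)) * complex_of_real (gauss_kernel (e n) (fst p - snd p)) \<partial>(lborel \<Otimes>\<^sub>M lborel))"
      by (rule regularised_parseval[OF e0 u(1) u(1)])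
    finally have eq: "complex_of_real (\<integral>w. g n w \<partial>lborel) = 4 * pi\<^sup>2 * (\<integral>p. u (fst p) * cnj (u (snd p)) * complex_of_real (gauss_kernel (e n) (fst p - snd p)) \<partial>(lborel \<Otimes>\<^sub>M lborel))" .
    have "(\<integral>w. g n w \<partial>lborel) = cmod (complex_of_real (\<integral>w. g n w \<partial>lborel))"
      using g0 by (simp add: Bochner_Integration.integral_nonneg)
    also have "\<dots> \<le> 4 * pi\<^sup>2 * ((L2n lborel u)\<^sup>2 + (L2n lborel u)\<^sup>2)"
      unfolding eq norm_mult using gauss_kernel_pair_integrable(2)[OF e0 u(2) u(2), of n] by (simp add: norm_power mult_left_mono)
    finally have "(\<integral>w. g n w \<partial>lborel) \<le> 8 * pi\<^sup>2 * (L2n lborel u)\<^sup>2" by simp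
    then show ?thesis
      using g0 by (simp add: nn_integral_eq_integral[OF gI] ennreal_leI)
  qed
  have lim: "(\<lambda>n. g n w) \<longlonglongrightarrow> (cmod (FT u w))\<^sup>2" for w
  proof -
    have "(\<lambda>n. (cmod (FT u w))\<^sup>2 * exp (- e n * (norm w)\<^sup>2 / 2)) \<longlonglongrightarrow> (cmod (FT u w))\<^sup>2 * 1"
      by (rule tendsto_mult[OF tendsto_const gauss_tendsto[OF elim]])
    then show ?thesis by (simp add: g_def)
  qed
  have "(\<integral>\<^sup>+w. ennreal ((norm (FT u w))\<^sup>2) \<partial>lborel) = (\<integral>\<^sup>+w. liminf (\<lambda>n. ennreal (g n w)) \<partial>lborel)"
  proof (rule nn_integral_cong)
    fix w :: "real^2"
    have "(\<lambda>n. ennreal (g n w)) \<longlonglongrightarrow> ennreal ((norm (FT u w))\<^sup>2)" by (intro tendsto_ennrealI lim)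
    then show "ennreal ((norm (FT u w))\<^sup>2) = liminf (\<lambda>n. ennreal (g n w))" using lim_imp_Liminf by force
  qed
  also have "\<dots> \<le> liminf (\<lambda>n. \<integral>\<^sup>+w. ennreal (g n w) \<partial>lborel)" by (rule nn_integral_liminf) measurable
  also have "\<dots> \<le> ennreal (8 * pi\<^sup>2 * (L2n lborel u)\<^sup>2)"
    by (rule Liminf_le) (use gb in auto)
  finally have F: "(\<integral>\<^sup>+w. ennreal ((norm (FT u w))\<^sup>2) \<partial>lborel) \<le> ennreal (8 * pi\<^sup>2 * (L2n lborel u)\<^sup>2)" .
  have m: "FT u \<in> borel_measurable lborel" by simp
  show "in_L2 lborel (FT u)" "(L2n lborel (FT u))\<^sup>2 \<le> 8 * pi\<^sup>2 * (L2n lborel u)\<^sup>2"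
    using in_L2I_nn[OF m F] by auto
qed

lemma parseval_limit:
  assumes u: "integrable lborel u" "in_L2 lborel u" and v: "integrable lborel v" "in_L2 lborel v"
  shows "(\<lambda>n. 4 * pi\<^sup>2 * (\<integral>p. u (fst p) * cnj (v (snd p)) * complex_of_real (gauss_kernel (1 / real (Suc n)) (fst p - snd p)) \<partial>(lborel \<Otimes>\<^sub>M lborel)))
    \<longlonglongrightarrow> (\<integral>w. FT u w * cnj (FT v w) \<partial>lborel)"
proof -
  have [measurable]: "u \<in> borel_measurable borel" "v \<in> borel_measurable borel" using u v by auto
  define e where "e n = 1 / real (Suc n)" for n
  have e0: "0 < e n" for n by (simp add: e_def)
  have elim: "e \<longlonglongrightarrow> 0" unfolding e_def by (rule LIMSEQ_Suc) (rule lim_1_over_n)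
  have "(\<lambda>n. \<integral>w. FT u w * cnj (FT v w) * complex_of_real (exp (- e n * (norm w)\<^sup>2 / 2)) \<partial>lborel) \<longlonglongrightarrow> (\<integral>w. FT u w * cnj (FT v w) \<partial>lborel)"
  proof (rule integral_dominated_convergence)
    show "integrable lborel (\<lambda>w. cmod (FT u w * cnj (FT v w)))"
      by (intro integrable_norm L2_mult_integrable FT_L2 in_L2_cnj u v)
    show "AE w in lborel. (\<lambda>n. FT u w * cnj (FT v w) * complex_of_real (exp (- e n * (norm w)\<^sup>2 / 2))) \<longlonglongrightarrow> FT u w * cnj (FT v w)"
    proof (rule AE_I2)
      fix w :: "real^2"
      have "(\<lambda>n. FT u w * cnj (FT v w) * complex_of_real (exp (- e n * (norm w)\<^sup>2 / 2))) \<longlonglongrightarrow> FT u w * cnj (FT v w) * complex_of_real 1"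
        by (rule tendsto_mult[OF tendsto_const tendsto_of_real[OF gauss_tendsto[OF elim]]])
      then show "(\<lambda>n. FT u w * cnj (FT v w) * complex_of_real (exp (- e n * (norm w)\<^sup>2 / 2))) \<longlonglongrightarrow> FT u w * cnj (FT v w)" by simp
    qed
    show "AE w in lborel. cmod (FT u w * cnj (FT v w) * complex_of_real (exp (- e n * (norm w)\<^sup>2 / 2))) \<le> cmod (FT u w * cnj (FT v w))" for n
    proof (rule AE_I2)
      fix w :: "real^2"
      have "exp (- e n * (norm w)\<^sup>2 / 2) \<le> 1" using e0[of n] by simp
      then show "cmod (FT u w * cnj (FT v w) * complex_of_real (exp (- e n * (norm w)\<^sup>2 / 2))) \<le> cmod (FT u w * cnj (FT v w))"
        by (simp only: norm_mult[of "_ * _" "complex_of_real _"] norm_of_real) (simp add: mult_left_le)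
    qed
  qed measurable
  then show ?thesis unfolding regularised_parseval[OF e0 u(1) v(1)] unfolding e_def .
qed

text \<open>If two products of multipliers agree on the diagonal up to a Lipschitz error, replacing one by the other
changes the damped double integral by a multiple of \<open>sqrt e\<close>. The inner products of the transforms
coincide in the limit. This identity between multipliers serves for the null Lagrangian.\<close>

lemma parseval_commutator:
  fixes G :: "real^2 \<Rightarrow> complex" and p1 q1 p2 q2 :: "real^2 \<Rightarrow> real"
  assumes G: "in_L2 lborel G"
    and L1: "integrable lborel (\<lambda>x. p1 x * G x)" "integrable lborel (\<lambda>x. q1 x * G x)" "integrable lborel (\<lambda>x. p2 x * G x)" "integrable lborel (\<lambda>x. q2 x * G x)"
    and L2: "in_L2 lborel (\<lambda>x. p1 x * G x)" "in_L2 lborel (\<lambda>x. q1 x * G x)" "in_L2 lborel (\<lambda>x. p2 x * G x)" "in_L2 lborel (\<lambda>x. q2 x * G x)"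
    and C: "0 \<le> C" "\<And>x y. G x \<noteq> 0 \<Longrightarrow> G y \<noteq> 0 \<Longrightarrow> \<bar>p1 x * q1 y - p2 x * q2 y\<bar> \<le> C * norm (x - y)"
  shows "(\<integral>w. FT (\<lambda>x. p1 x * G x) w * cnj (FT (\<lambda>x. q1 x * G x) w) \<partial>lborel) = (\<integral>w. FT (\<lambda>x. p2 x * G x) w * cnj (FT (\<lambda>x. q2 x * G x) w) \<partial>lborel)"
proof -
  have [measurable]: "G \<in> borel_measurable borel" "(\<lambda>x. p1 x * G x) \<in> borel_measurable borel" "(\<lambda>x. q1 x * G x) \<in> borel_measurable borel" "(\<lambda>x. p2 x * G x) \<in> borel_measurable borel" "(\<lambda>x. q2 x * G x) \<in> borel_measurable borel"
    using in_L2_borel[OF G] L1 by auto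
  define e where "e n = 1 / real (Suc n)" for n
  have e0: "0 < e n" for n by (simp add: e_def)
  have elim: "e \<longlonglongrightarrow> 0" unfolding e_def by (rule LIMSEQ_Suc) (rule lim_1_over_n)
  let ?h1 = "\<lambda>p. p1 (fst p) * G (fst p) * cnj (q1 (snd p) * G (snd p))"
  let ?h2 = "\<lambda>p. p2 (fst p) * G (fst p) * cnj (q2 (snd p) * G (snd p))"
  let ?k = "\<lambda>n p. complex_of_real (gauss_kernel (e n) (fst p - snd p))"
  let ?N = "2 * (L2n lborel G)\<^sup>2"
  have b: "cmod (4 * pi\<^sup>2 * (\<integral>p. ?h1 p * ?k n p \<partial>(lborel \<Otimes>\<^sub>M lborel)) - 4 * pi\<^sup>2 * (\<integral>p. ?h2 p * ?k n p \<partial>(lborel \<Otimes>\<^sub>M lborel)))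
     \<le> 4 * pi\<^sup>2 * (2 * sqrt (e n) * (C * ?N))" for n
  proof -
    have E: "4 * pi\<^sup>2 * (\<integral>p. ?h1 p * ?k n p \<partial>(lborel \<Otimes>\<^sub>M lborel)) - 4 * pi\<^sup>2 * (\<integral>p. ?h2 p * ?k n p \<partial>(lborel \<Otimes>\<^sub>M lborel))
       = 4 * pi\<^sup>2 * (\<integral>p. (?h1 p - ?h2 p) * ?k n p \<partial>(lborel \<Otimes>\<^sub>M lborel))"
      unfolding left_diff_distrib
        Bochner_Integration.integral_diff[OF gauss_kernel_pair_integrable(1)[OF e0[of n] L2(1,2)] gauss_kernel_pair_integrable(1)[OF e0[of n] L2(3,4)]]
        right_diff_distrib ..
    have "cmod (4 * pi\<^sup>2 * (\<integral>p. ?h1 p * ?k n p \<partial>(lborel \<Otimes>\<^sub>M lborel)) - 4 * pi\<^sup>2 * (\<integral>p. ?h2 p * ?k n p \<partial>(lborel \<Otimes>\<^sub>M lborel))) = 4 * pi\<^sup>2 * cmod (\<integral>p. (?h1 p - ?h2 p) * ?k n p \<partial>(lborel \<Otimes>\<^sub>M lborel))"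
      unfolding E by (simp only: norm_mult norm_of_real norm_power norm_numeral) simp
    also have "\<dots> \<le> 4 * pi\<^sup>2 * (2 * sqrt (e n) * (C * ?N))"
    proof (rule mult_left_mono[OF gauss_kernel_commutator[where m="\<lambda>p. C * (cmod (G (fst p)) * cmod (G (snd p)))", OF e0]])
      fix x y :: "real^2"
      show "cmod (?h1 (x, y) - ?h2 (x, y)) \<le> norm (x - y) * (C * (cmod (G (fst (x,y))) * cmod (G (snd (x,y)))))"
      proof (cases "G x = 0 \<or> G y = 0")
        case False
        have "?h1 (x, y) - ?h2 (x, y) = complex_of_real (p1 x * q1 y - p2 x * q2 y) * (G x * cnj (G y))"
          by (simp add: algebra_simps)
        then have "cmod (?h1 (x, y) - ?h2 (x, y)) = \<bar>p1 x * q1 y - p2 x * q2 y\<bar> * (cmod (G x) * cmod (G y))"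
          by (simp only: norm_mult norm_of_real complex_mod_cnj)
        also have "\<dots> \<le> C * norm (x - y) * (cmod (G x) * cmod (G y))"
          using C(2)[of x y] False by (intro mult_right_mono) auto
        finally show ?thesis by (simp add: mult_ac)
      qed auto
    next
      have "(\<integral>\<^sup>+p. ennreal (C * (cmod (G (fst p)) * cmod (G (snd p))) * gauss_kernel (2 * e n) (fst p - snd p)) \<partial>(lborel \<Otimes>\<^sub>M lborel))
         = (\<integral>\<^sup>+p. ennreal C * ennreal (cmod (G (fst p)) * cmod (G (snd p)) * gauss_kernel (2 * e n) (fst p - snd p)) \<partial>(lborel \<Otimes>\<^sub>M lborel))"
        using C(1) gauss_kernel_nonneg[of "2 * e n"] e0[of n] by (simp add: mult.assoc flip: ennreal_mult)
      also have "\<dots> = ennreal C * (\<integral>\<^sup>+p. ennreal (cmod (G (fst p)) * cmod (G (snd p)) * gauss_kernel (2 * e n) (fst p - snd p)) \<partial>(lborel \<Otimes>\<^sub>M lborel))"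
        by (rule nn_integral_cmult) measurable
      also have "\<dots> \<le> ennreal C * ((\<integral>\<^sup>+x. ennreal ((cmod (G x))\<^sup>2) \<partial>lborel) + (\<integral>\<^sup>+x. ennreal ((cmod (G x))\<^sup>2) \<partial>lborel))"
        using e0[of n] by (intro mult_left_mono gauss_kernel_schur(3)) auto
      also have "\<dots> = ennreal (C * ?N)"
        using C(1) by (simp add: L2_nn_integral[OF G] ennreal_mult flip: ennreal_plus)
      finally show "(\<integral>\<^sup>+p. ennreal (C * (cmod (G (fst p)) * cmod (G (snd p))) * gauss_kernel (2 * e n) (fst p - snd p)) \<partial>(lborel \<Otimes>\<^sub>M lborel)) \<le> ennreal (C * ?N)" .
    next
      show "(\<lambda>p. ?h1 p - ?h2 p) \<in> borel_measurable (lborel \<Otimes>\<^sub>M lborel)"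
        by measurable
    qed (use C in auto)
    finally show ?thesis .
  qed
  have "(\<lambda>n. 4 * pi\<^sup>2 * (2 * sqrt (e n) * (C * ?N))) \<longlonglongrightarrow> 4 * pi\<^sup>2 * (2 * sqrt 0 * (C * ?N))"
    by (intro tendsto_mult tendsto_const tendsto_real_sqrt elim)
  then have "(\<lambda>n. 4 * pi\<^sup>2 * (2 * sqrt (e n) * (C * ?N))) \<longlonglongrightarrow> 0" by simp
  then have "(\<lambda>n. 4 * pi\<^sup>2 * (\<integral>p. ?h1 p * ?k n p \<partial>(lborel \<Otimes>\<^sub>M lborel)) - 4 * pi\<^sup>2 * (\<integral>p. ?h2 p * ?k n p \<partial>(lborel \<Otimes>\<^sub>M lborel))) \<longlonglongrightarrow> 0"
    by (rule Lim_null_comparison[rotated]) (use b in auto)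
  moreover have "(\<lambda>n. 4 * pi\<^sup>2 * (\<integral>p. ?h1 p * ?k n p \<partial>(lborel \<Otimes>\<^sub>M lborel)) - 4 * pi\<^sup>2 * (\<integral>p. ?h2 p * ?k n p \<partial>(lborel \<Otimes>\<^sub>M lborel)))
    \<longlonglongrightarrow> (\<integral>w. FT (\<lambda>x. p1 x * G x) w * cnj (FT (\<lambda>x. q1 x * G x) w) \<partial>lborel) - (\<integral>w. FT (\<lambda>x. p2 x * G x) w * cnj (FT (\<lambda>x. q2 x * G x) w) \<partial>lborel)"
    using tendsto_diff[OF parseval_limit[OF L1(1) L2(1) L1(2) L2(2)] parseval_limit[OF L1(3) L2(3) L1(4) L2(4)]]
    by (simp only: e_def)
  ultimately show ?thesis using LIMSEQ_unique by fastforce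
qed

text \<open>Plancherel's theorem in polarised form when one factor is Lipschitz: replacing \<open>v y\<close> by \<open>v x\<close> in the
damped double integral is a commutator, after which the kernel integrates to one.\<close>

lemma parseval_lipschitz:
  fixes f :: "real^2 \<Rightarrow> complex" and v :: "real^2 \<Rightarrow> real"
  assumes f: "integrable lborel f" "in_L2 lborel f"
    and v: "integrable lborel (\<lambda>x. complex_of_real (v x))" "in_L2 lborel (\<lambda>x. complex_of_real (v x))"
    and bd: "\<And>x. \<bar>v x\<bar> \<le> B"
    and C: "0 \<le> C" "\<And>x y. \<bar>v x - v y\<bar> \<le> C * norm (x - y)"
  shows "(\<integral>w. FT f w * cnj (FT (\<lambda>x. complex_of_real (v x)) w) \<partial>lborel) = 4 * pi\<^sup>2 * (\<integral>x. f x * complex_of_real (v x) \<partial>lborel)"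
proof -
  have [measurable]: "f \<in> borel_measurable borel" using f by auto
  have [measurable]: "v \<in> borel_measurable borel" using v(1) unfolding complex_of_real_integrable_eq by auto
  define e where "e n = 1 / real (Suc n)" for n
  have e0: "0 < e n" for n by (simp add: e_def)
  have elim: "e \<longlonglongrightarrow> 0" unfolding e_def by (rule LIMSEQ_Suc) (rule lim_1_over_n)
  let ?h1 = "\<lambda>p. f (fst p) * cnj (complex_of_real (v (snd p)))"
  let ?h2 = "\<lambda>p. f (fst p) * complex_of_real (v (fst p))"
  let ?k = "\<lambda>n p. complex_of_real (gauss_kernel (e n) (fst p - snd p))"
  define N where "N = (\<integral>x. cmod (f x) \<partial>lborel)"
  have N0: "0 \<le> N" by (simp add: N_def)
  have fN: "(\<integral>\<^sup>+x. ennreal (cmod (f x)) \<partial>lborel) = ennreal N"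
    unfolding N_def by (rule nn_integral_eq_integral) (use f in auto)
  have fv: "integrable lborel (\<lambda>x. f x * complex_of_real (v x))"
  proof (rule Bochner_Integration.integrable_bound)
    show "integrable lborel (\<lambda>x. B * cmod (f x))" using f by auto
    have "0 \<le> B" using bd[of 0] by linarith
    then show "AE x in lborel. cmod (f x * complex_of_real (v x)) \<le> norm (B * cmod (f x))"
      using bd by (intro AE_I2) (simp add: norm_mult abs_mult mult.commute mult_right_mono)
  qed measurable
  have h2: "integrable (lborel \<Otimes>\<^sub>M lborel) (\<lambda>p. ?h2 p * ?k n p)"
    "(\<integral>p. ?h2 p * ?k n p \<partial>(lborel \<Otimes>\<^sub>M lborel)) = (\<integral>x. f x * complex_of_real (v x) \<partial>lborel)" for n
  proof -
    have k1: "integrable lborel (\<lambda>y. gauss_kernel (e n) (x - y))" "(\<integral>y. gauss_kernel (e n) (x - y) \<partial>lborel) = 1" for x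
    proof -
      show i: "integrable lborel (\<lambda>y. gauss_kernel (e n) (x - y))"
        by (rule integrableI_bounded) (use gauss_kernel_nn_integral_shift[OF e0[of n], of x] gauss_kernel_nonneg[OF e0[of n]] in auto)
      show "(\<integral>y. gauss_kernel (e n) (x - y) \<partial>lborel) = 1"
        using gauss_kernel_nn_integral_shift(1)[OF e0[of n], of x] nn_integral_eq_integral[OF i] gauss_kernel_nonneg[OF e0[of n]]
        by simp
    qed
    show I: "integrable (lborel \<Otimes>\<^sub>M lborel) (\<lambda>p. ?h2 p * ?k n p)"
    proof (rule lborel_pair.Fubini_integrable)
      show "AE x in lborel. integrable lborel (\<lambda>y. ?h2 (x, y) * ?k n (x, y))"
        using k1(1) unfolding fst_conv snd_conv by (intro AE_I2 integrable_mult_right integrable_of_real)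
      have "(\<integral>y. cmod (?h2 (x, y) * ?k n (x, y)) \<partial>lborel) = cmod (f x * complex_of_real (v x))" for x
        using k1(2) gauss_kernel_nonneg[OF e0[of n]] by (simp add: norm_mult)
      then show "integrable lborel (\<lambda>x. \<integral>y. cmod (?h2 (x, y) * ?k n (x, y)) \<partial>lborel)"
        using fv by simp
    qed measurable
    have "(\<integral>y. ?h2 (x, y) * ?k n (x, y) \<partial>lborel) = f x * complex_of_real (v x)" for x
      using k1(2)[of x] by simp
    then show "(\<integral>p. ?h2 p * ?k n p \<partial>(lborel \<Otimes>\<^sub>M lborel)) = (\<integral>x. f x * complex_of_real (v x) \<partial>lborel)"
      using lborel_pair.integral_fst'[OF I] k1(2) by simp
  qed
  have b: "cmod (4 * pi\<^sup>2 * (\<integral>p. ?h1 p * ?k n p \<partial>(lborel \<Otimes>\<^sub>M lborel)) - 4 * pi\<^sup>2 * (\<integral>x. f x * complex_of_real (v x) \<partial>lborel))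
     \<le> 4 * pi\<^sup>2 * (2 * sqrt (e n) * (C * N))" for n
  proof -
    have E: "4 * pi\<^sup>2 * (\<integral>p. ?h1 p * ?k n p \<partial>(lborel \<Otimes>\<^sub>M lborel)) - 4 * pi\<^sup>2 * (\<integral>x. f x * complex_of_real (v x) \<partial>lborel)
       = 4 * pi\<^sup>2 * (\<integral>p. (?h1 p - ?h2 p) * ?k n p \<partial>(lborel \<Otimes>\<^sub>M lborel))"
      unfolding h2(2)[of n, symmetric] left_diff_distrib
        Bochner_Integration.integral_diff[OF gauss_kernel_pair_integrable(1)[OF e0[of n] f(2) v(2)] h2(1)[of n]]
        right_diff_distrib ..
    have "cmod (4 * pi\<^sup>2 * (\<integral>p. ?h1 p * ?k n p \<partial>(lborel \<Otimes>\<^sub>M lborel)) - 4 * pi\<^sup>2 * (\<integral>x. f x * complex_of_real (v x) \<partial>lborel)) = 4 * pi\<^sup>2 * cmod (\<integral>p. (?h1 p - ?h2 p) * ?k n p \<partial>(lborel \<Otimes>\<^sub>M lborel))"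
      unfolding E by (simp only: norm_mult norm_of_real norm_power norm_numeral) simp
    also have "\<dots> \<le> 4 * pi\<^sup>2 * (2 * sqrt (e n) * (C * N))"
    proof (rule mult_left_mono[OF gauss_kernel_commutator[where m="\<lambda>p. C * cmod (f (fst p))", OF e0]])
      fix x y :: "real^2"
      have "?h1 (x, y) - ?h2 (x, y) = f x * complex_of_real (v y - v x)"
        by (simp add: algebra_simps)
      then have "cmod (?h1 (x, y) - ?h2 (x, y)) = cmod (f x) * \<bar>v y - v x\<bar>"
        by (simp only: norm_mult norm_of_real)
      also have "\<dots> \<le> cmod (f x) * (C * norm (x - y))"
        using C(2)[of y x] by (intro mult_left_mono) (auto simp: norm_minus_commute)
      finally show "cmod (?h1 (x, y) - ?h2 (x, y)) \<le> norm (x - y) * (C * cmod (f (fst (x, y))))"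
        by (simp add: mult_ac)
    next
      have "(\<integral>\<^sup>+p. ennreal (C * cmod (f (fst p)) * gauss_kernel (2 * e n) (fst p - snd p)) \<partial>(lborel \<Otimes>\<^sub>M lborel))
         = (\<integral>\<^sup>+x. ennreal (C * cmod (f x)) \<partial>lborel)"
        using e0[of n] C(1) by (intro gauss_kernel_schur(1)) auto
      also have "\<dots> = ennreal (C * N)"
        using C(1) N0 by (simp add: ennreal_mult nn_integral_cmult fN)
      finally show "(\<integral>\<^sup>+p. ennreal (C * cmod (f (fst p)) * gauss_kernel (2 * e n) (fst p - snd p)) \<partial>(lborel \<Otimes>\<^sub>M lborel)) \<le> ennreal (C * N)" by simp
    next
      show "(\<lambda>p. ?h1 p - ?h2 p) \<in> borel_measurable (lborel \<Otimes>\<^sub>M lborel)"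
        by measurable
    qed (use C N0 in auto)
    finally show ?thesis .
  qed
  have "(\<lambda>n. 4 * pi\<^sup>2 * (2 * sqrt (e n) * (C * N))) \<longlonglongrightarrow> 4 * pi\<^sup>2 * (2 * sqrt 0 * (C * N))"
    by (intro tendsto_mult tendsto_const tendsto_real_sqrt elim)
  then have "(\<lambda>n. 4 * pi\<^sup>2 * (2 * sqrt (e n) * (C * N))) \<longlonglongrightarrow> 0" by simp
  then have "(\<lambda>n. 4 * pi\<^sup>2 * (\<integral>p. ?h1 p * ?k n p \<partial>(lborel \<Otimes>\<^sub>M lborel)) - 4 * pi\<^sup>2 * (\<integral>x. f x * complex_of_real (v x) \<partial>lborel)) \<longlonglongrightarrow> 0"
    by (rule Lim_null_comparison[rotated]) (use b in auto)
  then have "(\<lambda>n. 4 * pi\<^sup>2 * (\<integral>p. ?h1 p * ?k n p \<partial>(lborel \<Otimes>\<^sub>M lborel))) \<longlonglongrightarrow> 4 * pi\<^sup>2 * (\<integral>x. f x * complex_of_real (v x) \<partial>lborel)"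
    by (simp only: LIM_zero_iff)
  from LIMSEQ_unique[OF parseval_limit[OF f v] this[unfolded e_def]] show ?thesis .
qed

section \<open>The Fourier--Plancherel transform\<close>

lemma cball_borel_measurable [measurable]: "cball (a::real^2) R \<in> sets borel"
  by simp

lemma truncated_fourier_FT:
  "truncated_fourier R f = FT (\<lambda>x. indicator (cball 0 R) x *\<^sub>R complex_of_real (f x))"
  by (auto simp: truncated_fourier_def FT_def set_lebesgue_integral_def fun_eq_iff)

lemma square_integrable_in_L2: "square_integrable f \<Longrightarrow> in_L2 lborel f"
  by (simp add: square_integrable_def in_L2_def)

lemma in_L2_of_real: "in_L2 M f \<Longrightarrow> in_L2 M (\<lambda>x. complex_of_real (f x))"
  by (auto simp: in_L2_def)

lemma in_L2_indicator:
  assumes "in_L2 M F" "A \<in> sets M" shows "in_L2 M (\<lambda>x. indicator A x *\<^sub>R F x)"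
  by (rule in_L2_bound(1)[OF assms(1), where c=1])
     (use assms in \<open>auto simp: in_L2_def indicator_def\<close>)

lemma in_L2_local_integrable:
  fixes F :: "real^2 \<Rightarrow> 'b::{banach, second_countable_topology}"
  assumes "in_L2 lborel F" shows "integrable lborel (\<lambda>x. indicator (cball 0 R) x *\<^sub>R F x)"
proof -
  have [measurable]: "F \<in> borel_measurable borel" using assms by (rule in_L2_borel)
  have fin: "emeasure lborel (cball (0::real^2) R) < \<infinity>" by (rule emeasure_lborel_cball_finite)
  have "integrable lborel (\<lambda>x. indicator (cball 0 R) x + (norm (F x))\<^sup>2)"
    by (rule Bochner_Integration.integrable_add[OF integrable_real_indicator in_L2_integrable[OF assms]]) (use fin in auto)
  then show ?thesis
  proof (rule Bochner_Integration.integrable_bound)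
    show "AE x in lborel. norm (indicator (cball 0 R) x *\<^sub>R F x) \<le> norm (indicator (cball 0 R) x + (norm (F x))\<^sup>2)"
    proof (rule AE_I2)
      fix x :: "real^2"
      have "norm (F x) \<le> 1 + (norm (F x))\<^sup>2"
        using zero_le_power2[of "norm (F x) - 1/2"] zero_le_power2[of "norm (F x)"] unfolding power2_diff by (simp add: power2_eq_square)
      then show "norm (indicator (cball 0 R) x *\<^sub>R F x) \<le> norm (indicator (cball 0 R) x + (norm (F x))\<^sup>2)"
        by (auto simp: indicator_def)
    qed
  qed simp
qed

lemma emeasure_cball_less_top: "emeasure lborel (cball (0::real^2) R) < \<infinity>"
  by (rule emeasure_lborel_cball_finite)

lemma FT_diff:
  assumes "integrable lborel u" "integrable lborel v"
  shows "FT (\<lambda>x. u x - v x) w = FT u w - FT v w"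
  unfolding FT_def left_diff_distrib
  by (rule Bochner_Integration.integral_diff) (intro integrable_mult_char assms)+

text \<open>The truncations of \<open>f\<close> to growing balls form a Cauchy family in \<open>L\<^sub>2\<close>, hence so do their transforms. By
completeness the function selected in the definition of \<open>fourier_L2\<close> exists.\<close>

lemma fourier_L2_spec:
  assumes f: "square_integrable f"
  shows "in_L2 lborel (fourier_L2 f)"
    and "((\<lambda>R. \<integral>\<^sup>+\<omega>. ennreal ((cmod (fourier_L2 f \<omega> - truncated_fourier R f \<omega>))\<^sup>2) \<partial>lborel) \<longlongrightarrow> 0) at_top"
proof -
  note fL = square_integrable_in_L2[OF f]
  have [measurable]: "f \<in> borel_measurable borel" using f by (simp add: square_integrable_def)
  define u where "u R x = indicator (cball 0 R) x *\<^sub>R complex_of_real (f x)" for R and x :: "real^2"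
  have uL2: "in_L2 lborel (u R)" for R unfolding u_def by (intro in_L2_indicator in_L2_of_real fL) simp
  have uL1: "integrable lborel (u R)" for R unfolding u_def by (intro in_L2_local_integrable in_L2_of_real fL)
  have tf: "truncated_fourier R f = FT (u R)" for R unfolding truncated_fourier_FT u_def[abs_def] ..
  have fI: "integrable lborel (\<lambda>x. (f x)\<^sup>2)" using f by (simp add: square_integrable_def)
  define t where "t n = (\<integral>x. indicator (- cball 0 (real n)) x * (f x)\<^sup>2 \<partial>lborel)" for n
  have t0: "t \<longlonglongrightarrow> (\<integral>x. 0 \<partial>(lborel::(real^2) measure))"
    unfolding t_def
  proof (rule integral_dominated_convergence[OF _ _ fI])
    show "AE x in lborel. (\<lambda>n. indicator (- cball 0 (real n)) x * (f x)\<^sup>2) \<longlonglongrightarrow> 0"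
    proof (rule AE_I2)
      fix x :: "real^2"
      obtain N :: nat where N: "norm x \<le> real N" using real_arch_simple[of "norm x"] by auto
      have "\<forall>\<^sub>F n in sequentially. indicator (- cball 0 (real n)) x * (f x)\<^sup>2 = 0"
        using eventually_ge_at_top[of N] by eventually_elim (use N in \<open>auto simp: indicator_def\<close>)
      then show "(\<lambda>n. indicator (- cball 0 (real n)) x * (f x)\<^sup>2) \<longlonglongrightarrow> 0" by (rule tendsto_eventually)
    qed
    show "AE x in lborel. norm (indicator (- cball 0 (real n)) x * (f x)\<^sup>2) \<le> (f x)\<^sup>2" for n
      by (auto simp: indicator_def)
  qed auto
  have ex: "\<exists>g. in_L2 lborel g \<and> ((\<lambda>R. \<integral>\<^sup>+x. ennreal ((cmod (g x - FT (u R) x))\<^sup>2) \<partial>lborel) \<longlongrightarrow> 0) at_top"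
  proof (rule L2_complete)
    show "in_L2 lborel (FT (u R))" for R by (rule FT_L2(1)[OF uL1 uL2])
    fix e :: real assume "0 < e"
    define d where "d = e\<^sup>2 / (8 * pi\<^sup>2)"
    have "0 < d" using \<open>0 < e\<close> by (simp add: d_def)
    have "\<forall>\<^sub>F n in sequentially. t n < d" using t0 \<open>0 < d\<close> by (intro order_tendstoD) auto
    then obtain n where n: "t n < d" by (auto simp: eventually_sequentially)
    show "\<exists>R0. \<forall>R\<ge>R0. \<forall>S\<ge>R0. L2n lborel (\<lambda>x. FT (u R) x - FT (u S) x) \<le> e"
    proof (intro exI[of _ "real n"] allI impI)
      fix R S assume RS: "real n \<le> R" "real n \<le> S"
      have b: "(L2n lborel (\<lambda>x. u R x - u S x))\<^sup>2 \<le> t n"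
        unfolding L2n_sq t_def
      proof (rule integral_mono)
        show "integrable lborel (\<lambda>x. (cmod (u R x - u S x))\<^sup>2)" by (intro in_L2_integrable in_L2_diff uL2)
        show "integrable lborel (\<lambda>x. indicator (- cball 0 (real n)) x * (f x)\<^sup>2)"
          by (rule Bochner_Integration.integrable_bound[OF fI]) (auto simp: indicator_def)
        show "(cmod (u R x - u S x))\<^sup>2 \<le> indicator (- cball 0 (real n)) x * (f x)\<^sup>2" for x
          using RS by (auto simp: u_def indicator_def)
      qed
      have "(L2n lborel (\<lambda>x. FT (u R) x - FT (u S) x))\<^sup>2 = (L2n lborel (FT (\<lambda>x. u R x - u S x)))\<^sup>2"
        by (simp add: L2n_def FT_diff uL1)
      also have "\<dots> \<le> 8 * pi\<^sup>2 * (L2n lborel (\<lambda>x. u R x - u S x))\<^sup>2"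
        by (intro FT_L2 Bochner_Integration.integrable_diff uL1 in_L2_diff uL2)
      also have "\<dots> \<le> 8 * pi\<^sup>2 * d" using b n by (intro mult_left_mono) auto
      also have "\<dots> = e\<^sup>2" by (simp add: d_def)
      finally show "L2n lborel (\<lambda>x. FT (u R) x - FT (u S) x) \<le> e"
        by (rule power2_le_imp_le) (use \<open>0 < e\<close> in simp)
    qed
  qed
  then have "\<exists>g. g \<in> borel_measurable lborel \<and> integrable lborel (\<lambda>\<omega>. (cmod (g \<omega>))\<^sup>2) \<and>
     ((\<lambda>R. \<integral>\<^sup>+\<omega>. ennreal ((cmod (g \<omega> - truncated_fourier R f \<omega>))\<^sup>2) \<partial>lborel) \<longlongrightarrow> 0) at_top"
    unfolding tf in_L2_def by blast
  from someI_ex[OF this] show "in_L2 lborel (fourier_L2 f)"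
    "((\<lambda>R. \<integral>\<^sup>+\<omega>. ennreal ((cmod (fourier_L2 f \<omega> - truncated_fourier R f \<omega>))\<^sup>2) \<partial>lborel) \<longlongrightarrow> 0) at_top"
    unfolding fourier_L2_def[symmetric] in_L2_def by blast+
qed

text \<open>For radii beyond the support of \<open>v\<close> the truncated transforms already pair exactly, and the pairing is
continuous in \<open>L\<^sub>2\<close>.\<close>

lemma fourier_L2_pairing:
  assumes f: "square_integrable f"
    and v: "v \<in> borel_measurable borel" "\<And>x. \<bar>v x\<bar> \<le> B" "\<And>x. v x \<noteq> 0 \<Longrightarrow> norm x \<le> S"
    and C: "0 \<le> C" "\<And>x y. \<bar>v x - v y\<bar> \<le> C * norm (x - y)"
  shows "(\<integral>w. fourier_L2 f w * cnj (FT (\<lambda>x. complex_of_real (v x)) w) \<partial>lborel)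
    = 4 * pi\<^sup>2 * (\<integral>x. complex_of_real (f x) * complex_of_real (v x) \<partial>lborel)"
proof -
  note fL = square_integrable_in_L2[OF f]
  have [measurable]: "f \<in> borel_measurable borel" using f by (simp add: square_integrable_def)
  note [measurable] = v(1)
  have B0: "0 \<le> B" using v(2)[of 0] by linarith
  have vI: "integrable lborel (\<lambda>x. (complex_of_real (v x)))"
  proof (rule Bochner_Integration.integrable_bound)
    show "integrable lborel (\<lambda>x. B * indicator (cball 0 S) (x::real^2) :: real)"
      using emeasure_cball_less_top by (intro integrable_mult_right integrable_real_indicator) simp_all
    show "AE x in lborel. cmod (complex_of_real (v x)) \<le> norm (B * indicator (cball 0 S) (x::real^2))"
      using v(2,3) B0 by (intro AE_I2) (auto simp: indicator_def)
  qed measurable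
  have "integrable lborel (\<lambda>x. (cmod (complex_of_real (v x)))\<^sup>2)"
  proof (rule Bochner_Integration.integrable_bound)
    show "integrable lborel (\<lambda>x. B * cmod (complex_of_real (v x)))" by (intro integrable_mult_right integrable_norm vI)
    show "AE x in lborel. norm ((cmod (complex_of_real (v x)))\<^sup>2) \<le> norm (B * cmod (complex_of_real (v x)))"
    proof (rule AE_I2)
      fix x
      have "\<bar>v x\<bar> * \<bar>v x\<bar> \<le> B * \<bar>v x\<bar>" using v(2)[of x] by (intro mult_right_mono) auto
      then show "norm ((cmod (complex_of_real (v x)))\<^sup>2) \<le> norm (B * cmod (complex_of_real (v x)))"
        using B0 by (simp add: power2_eq_square abs_mult)
    qed
  qed measurable
  then have vL: "in_L2 lborel (\<lambda>x. complex_of_real (v x))" by (simp add: in_L2_def)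
  define V where "V = FT (\<lambda>x. complex_of_real (v x))"
  have VL: "in_L2 lborel (\<lambda>w. cnj (V w))" unfolding V_def by (intro in_L2_cnj FT_L2 vI vL)
  define u where "u R x = indicator (cball 0 R) x *\<^sub>R complex_of_real (f x)" for R and x :: "real^2"
  have uL2: "in_L2 lborel (u R)" for R unfolding u_def by (intro in_L2_indicator in_L2_of_real fL) simp
  have uL1: "integrable lborel (u R)" for R unfolding u_def by (intro in_L2_local_integrable in_L2_of_real fL)
  have tf: "truncated_fourier R f = FT (u R)" for R unfolding truncated_fourier_FT u_def[abs_def] ..
  define G where "G = fourier_L2 f"
  have GL: "in_L2 lborel G" unfolding G_def by (rule fourier_L2_spec(1)[OF f])
  let ?I = "\<integral>x. complex_of_real (f x) * complex_of_real (v x) \<partial>lborel"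
  have eq: "(\<integral>w. FT (u R) w * cnj (V w) \<partial>lborel) = 4 * pi\<^sup>2 * ?I" if "S \<le> R" for R
  proof -
    have "(\<integral>w. FT (u R) w * cnj (V w) \<partial>lborel) = 4 * pi\<^sup>2 * (\<integral>x. u R x * complex_of_real (v x) \<partial>lborel)"
      unfolding V_def by (rule parseval_lipschitz[OF uL1 uL2 vI vL v(2) C])
    also have "(\<integral>x. u R x * complex_of_real (v x) \<partial>lborel) = ?I"
    proof (intro Bochner_Integration.integral_cong refl)
      fix x
      show "u R x * complex_of_real (v x) = complex_of_real (f x) * complex_of_real (v x)"
        using v(3)[of x] that by (cases "v x = 0") (auto simp: u_def)
    qed
    finally show ?thesis .
  qed
  have d: "cmod ((\<integral>w. G w * cnj (V w) \<partial>lborel) - 4 * pi\<^sup>2 * ?I) \<le> L2n lborel (\<lambda>w. G w - FT (u R) w) * L2n lborel (\<lambda>w. cnj (V w))" if "S \<le> R" for R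
  proof -
    have "(\<integral>w. G w * cnj (V w) \<partial>lborel) - 4 * pi\<^sup>2 * ?I = (\<integral>w. (G w - FT (u R) w) * cnj (V w) \<partial>lborel)"
      unfolding eq[OF that, symmetric] left_diff_distrib
      by (rule Bochner_Integration.integral_diff[symmetric]) (intro L2_mult_integrable GL VL FT_L2 uL1 uL2)+
    then show ?thesis
      using L2_mult_integrable(2)[OF in_L2_diff[OF GL FT_L2(1)[OF uL1 uL2]] VL, of R] by simp
  qed
  have lim: "((\<lambda>R. L2n lborel (\<lambda>w. G w - FT (u R) w)) \<longlongrightarrow> 0) at_top"
  proof -
    have "((\<lambda>R. \<integral>\<^sup>+\<omega>. ennreal ((cmod (G \<omega> - FT (u R) \<omega>))\<^sup>2) \<partial>lborel) \<longlongrightarrow> ennreal 0) at_top"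
      using fourier_L2_spec(2)[OF f] by (simp add: tf G_def)
    then have "((\<lambda>R. ennreal ((L2n lborel (\<lambda>w. G w - FT (u R) w))\<^sup>2)) \<longlongrightarrow> ennreal 0) at_top"
      by (simp add: L2_nn_integral[OF in_L2_diff[OF GL FT_L2(1)[OF uL1 uL2]]])
    then have "((\<lambda>R. (L2n lborel (\<lambda>w. G w - FT (u R) w))\<^sup>2) \<longlongrightarrow> 0) at_top"
      by (rule tendsto_ennrealD) auto
    then have "((\<lambda>R. sqrt ((L2n lborel (\<lambda>w. G w - FT (u R) w))\<^sup>2)) \<longlongrightarrow> sqrt 0) at_top"
      by (rule tendsto_real_sqrt)
    then show ?thesis by simp
  qed
  have "((\<lambda>R. L2n lborel (\<lambda>w. G w - FT (u R) w) * L2n lborel (\<lambda>w. cnj (V w))) \<longlongrightarrow> 0 * L2n lborel (\<lambda>w. cnj (V w))) at_top"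
    by (rule tendsto_mult[OF lim tendsto_const])
  then have "cmod ((\<integral>w. G w * cnj (V w) \<partial>lborel) - 4 * pi\<^sup>2 * ?I) \<le> 0 * L2n lborel (\<lambda>w. cnj (V w))"
    by (rule tendsto_lowerbound[OF _ eventually_mono[OF eventually_ge_at_top[of S] d]]) auto
  then show ?thesis by (simp add: G_def V_def)
qed

text \<open>The closed sets generate the Borel sets and are stable under intersection.\<close>

lemma closed_set_integrals_zero_AE:
  fixes W :: "real^2 \<Rightarrow> complex"
  assumes W: "integrable lborel W" and z: "\<And>D. closed D \<Longrightarrow> (\<integral>x. indicator D x *\<^sub>R W x \<partial>lborel) = 0"
  shows "AE x in lborel. W x = 0"
proof (rule sigma_finite_measure.density_zero[OF sigma_finite_lborel W])
  have I: "integrable lborel (\<lambda>x. indicator A x *\<^sub>R W x)" if "A \<in> sets lborel" for A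
    by (rule integrable_mult_indicator[OF that W])
  have sb: "sets lborel = sigma_sets UNIV (Collect closed)"
    by (simp add: borel_eq_closed)
  fix A :: "(real^2) set" assume "A \<in> sets lborel"
  then have A: "A \<in> sigma_sets UNIV (Collect closed)" unfolding sb .
  have IS: "Int_stable (Collect closed :: (real^2) set set)" by (auto simp: Int_stable_def)
  have "(\<integral>x. indicator A x *\<^sub>R W x \<partial>lborel) = 0"
  proof (rule sigma_sets_induct_disjoint[OF IS _ A, where P="\<lambda>A. (\<integral>x. indicator A x *\<^sub>R W x \<partial>lborel) = 0"])
    fix A assume "A \<in> sigma_sets UNIV (Collect closed)" and 0: "(\<integral>x. indicator A x *\<^sub>R W x \<partial>lborel) = 0"
    then have s: "A \<in> sets lborel" unfolding sb by simp
    have "(\<integral>x. indicator (UNIV - A) x *\<^sub>R W x \<partial>lborel) = (\<integral>x. indicator UNIV x *\<^sub>R W x - indicator A x *\<^sub>R W x \<partial>lborel)"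
      by (intro Bochner_Integration.integral_cong) (auto simp: indicator_def)
    also have "\<dots> = (\<integral>x. indicator UNIV x *\<^sub>R W x \<partial>lborel) - (\<integral>x. indicator A x *\<^sub>R W x \<partial>lborel)"
      by (rule Bochner_Integration.integral_diff[OF I I[OF s]]) simp
    finally show "(\<integral>x. indicator (UNIV - A) x *\<^sub>R W x \<partial>lborel) = 0"
      using 0 z[OF closed_UNIV] by simp
  next
    fix A :: "nat \<Rightarrow> (real^2) set"
    assume d: "disjoint_family A" "range A \<subseteq> sigma_sets UNIV (Collect closed)" and 0: "\<And>i. (\<integral>x. indicator (A i) x *\<^sub>R W x \<partial>lborel) = 0"
    have s: "A i \<in> sets lborel" for i using d unfolding sb by auto
    have "set_lebesgue_integral lborel (\<Union>i. A i) W = (\<Sum>i. set_lebesgue_integral lborel (A i) W)"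
    proof (rule lebesgue_integral_countable_add[OF s])
      show "A i \<inter> A j = {}" if "i \<noteq> j" for i j using d(1) that by (auto simp: disjoint_family_on_def)
      have "(\<Union>i. A i) \<in> sets lborel" using s by blast
      then show "set_integrable lborel (\<Union>i. A i) W" unfolding set_integrable_def by (rule I)
    qed
    then show "(\<integral>x. indicator (\<Union>i. A i) x *\<^sub>R W x \<partial>lborel) = 0" by (simp add: set_lebesgue_integral_def 0)
  qed (use z in auto)
  then show "set_lebesgue_integral lborel A W = 0"
    unfolding set_lebesgue_integral_def .
qed

text \<open>Indicators of compact sets are pointwise limits of the Lipschitz functions \<open>max 0 (1 - m d(x, D))\<close>.\<close>

lemma lipschitz_tests_zero_AE:
  fixes W :: "real^2 \<Rightarrow> complex"
  assumes [measurable]: "W \<in> borel_measurable borel" and loc: "\<And>R. integrable lborel (\<lambda>x. indicator (cball 0 R) x *\<^sub>R W x)"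
    and z: "\<And>v C S. (v \<in> borel_measurable borel) \<Longrightarrow> (\<And>x. \<bar>v x\<bar> \<le> 1) \<Longrightarrow> (\<And>x. v x \<noteq> 0 \<Longrightarrow> norm x \<le> S) \<Longrightarrow> 0 \<le> C \<Longrightarrow>
      (\<And>x y. \<bar>v x - v y\<bar> \<le> C * norm (x - y)) \<Longrightarrow> (\<integral>x. W x * complex_of_real (v x) \<partial>lborel) = 0"
  shows "AE x in lborel. W x = 0"
proof -
  have "AE x in lborel. indicator (cball 0 (real n)) x *\<^sub>R W x = 0" for n
  proof (rule closed_set_integrals_zero_AE[OF loc])
    fix D0 :: "(real^2) set" assume "closed D0"
    define D where "D = D0 \<inter> cball 0 (real n)"
    have cD: "closed D" using \<open>closed D0\<close> by (auto simp: D_def)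
    have [measurable]: "D \<in> sets borel" using cD by simp
    have eq: "indicator D0 x *\<^sub>R indicator (cball 0 (real n)) x *\<^sub>R W x = indicator D x *\<^sub>R W x" for x
      unfolding D_def indicator_inter_arith by simp
    have "(\<integral>x. indicator D x *\<^sub>R W x \<partial>lborel) = 0"
    proof (cases "D = {}")
      case False
      define v where "v m x = max 0 (1 - real (Suc m) * infdist x D)" for m x
      have max: "\<bar>max 0 (1 - a) - max 0 (1 - b)\<bar> \<le> \<bar>b - a\<bar>" for a b :: real by (auto simp: max_def)
      have inf: "\<bar>infdist x D - infdist y D\<bar> \<le> norm (x - y)" for x y :: "real^2"
        using infdist_triangle_abs[of x D y] by (simp add: dist_norm)
      have [measurable]: "v m \<in> borel_measurable borel" for m
        unfolding v_def by (intro borel_measurable_continuous_onI continuous_intros)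
      have b: "\<bar>v m x\<bar> \<le> 1" for m x
        using infdist_nonneg[of x D] by (auto simp: v_def)
      have supp: "norm x \<le> real n + 2" if "v m x \<noteq> 0" for m x
      proof -
        have "real (Suc m) * infdist x D < 1" using that by (auto simp: v_def max_def split: if_splits)
        moreover have "1 * infdist x D \<le> real (Suc m) * infdist x D" by (intro mult_right_mono infdist_nonneg) simp
        ultimately have "infdist x D < 1" by simp
        moreover obtain a where "a \<in> D" "infdist x D = dist x a"
          by (rule infdist_attains_inf[OF cD False])
        ultimately have a: "a \<in> D" "dist x a < 1" by simp_all
        have "norm x \<le> norm a + dist x a" using norm_triangle_sub[of x a] by (simp add: dist_norm)
        moreover have "norm a \<le> real n" using a by (simp add: D_def)
        ultimately show ?thesis using a by linarith
      qed
      have lip: "\<bar>v m x - v m y\<bar> \<le> real (Suc m) * norm (x - y)" for m x y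
      proof -
        have "\<bar>v m x - v m y\<bar> \<le> \<bar>real (Suc m) * infdist y D - real (Suc m) * infdist x D\<bar>"
          unfolding v_def by (rule max)
        also have "\<dots> = real (Suc m) * \<bar>infdist y D - infdist x D\<bar>"
          unfolding right_diff_distrib[symmetric] abs_mult by simp
        also have "\<dots> \<le> real (Suc m) * norm (x - y)"
          using inf[of y x] by (intro mult_left_mono) (auto simp: norm_minus_commute)
        finally show ?thesis .
      qed
      have z': "(\<integral>x. W x * complex_of_real (v m x) \<partial>lborel) = 0" for m
        by (rule z[OF _ b supp _ lip]) auto
      have "(\<lambda>m. \<integral>x. W x * complex_of_real (v m x) \<partial>lborel) \<longlonglongrightarrow> (\<integral>x. indicator D x *\<^sub>R W x \<partial>lborel)"
      proof (rule integral_dominated_convergence)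
        show "integrable lborel (\<lambda>x. norm (indicator (cball 0 (real n + 2)) x *\<^sub>R W x))"
          by (intro integrable_norm loc)
        show "(\<lambda>x. indicator D x *\<^sub>R W x) \<in> borel_measurable lborel"
          by measurable
        show "AE x in lborel. (\<lambda>m. W x * complex_of_real (v m x)) \<longlonglongrightarrow> indicator D x *\<^sub>R W x"
        proof (rule AE_I2)
          fix x
          show "(\<lambda>m. W x * complex_of_real (v m x)) \<longlonglongrightarrow> indicator D x *\<^sub>R W x"
          proof (cases "x \<in> D")
            case True
            then have "v m x = 1" for m by (simp add: v_def)
            then show ?thesis using True by simp
          next
            case nD: False
            have pos: "0 < infdist x D"
              using nD cD False infdist_nonneg[of x D] in_closed_iff_infdist_zero[of D x] by (auto simp: less_le)
            obtain N :: nat where N: "1 / infdist x D < real N" using reals_Archimedean2 by blast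
            have "\<forall>\<^sub>F m in sequentially. W x * complex_of_real (v m x) = indicator D x *\<^sub>R W x"
              using eventually_ge_at_top[of N]
            proof eventually_elim
              case (elim m)
              have "1 < real N * infdist x D" using N pos by (simp add: field_simps)
              also have "\<dots> \<le> real (Suc m) * infdist x D" using elim pos by (intro mult_right_mono) auto
              finally have "v m x = 0" by (simp add: v_def)
              then show ?case using nD by simp
            qed
            then show ?thesis by (rule tendsto_eventually)
          qed
        qed
        show "AE x in lborel. norm (W x * complex_of_real (v m x)) \<le> norm (indicator (cball 0 (real n + 2)) x *\<^sub>R W x)" for m
        proof (rule AE_I2)
          fix x
          show "norm (W x * complex_of_real (v m x)) \<le> norm (indicator (cball 0 (real n + 2)) x *\<^sub>R W x)"
            using supp[of m x] b[of m x] by (cases "v m x = 0") (auto simp: norm_mult mult_left_le)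
        qed
      qed measurable
      then show ?thesis unfolding z' using LIMSEQ_unique tendsto_const by blast
    qed simp
    then show "(\<integral>x. indicator D0 x *\<^sub>R indicator (cball 0 (real n)) x *\<^sub>R W x \<partial>lborel) = 0"
      unfolding eq .
  qed
  then have "AE x in lborel. \<forall>n::nat. indicator (cball 0 (real n)) x *\<^sub>R W x = 0"
    unfolding AE_all_countable by blast
  then show ?thesis
  proof eventually_elim
    case (elim x)
    obtain N :: nat where N: "norm x \<le> real N" using real_arch_simple[of "norm x"] by auto
    show ?case using elim[rule_format, of N] N by simp
  qed
qed

section \<open>Band-limited functions as Fourier integrals\<close>

definition IFT :: "(real^2 \<Rightarrow> complex) \<Rightarrow> real^2 \<Rightarrow> complex" where
  "IFT G x = (\<integral>w. G w * exp (\<i> * complex_of_real (w \<bullet> x)) \<partial>lborel)"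

lemma IFT_FT: "IFT G x = FT G (- x)"
  by (simp add: IFT_def FT_def inner_commute)

lemma lborel_distr_uminus2: "distr lborel borel uminus = (lborel :: (real^2) measure)"
proof -
  have "(lborel :: (real^2) measure) = density (distr lborel borel (\<lambda>x. 0 + (-1) *\<^sub>R x)) (\<lambda>_. ennreal (\<bar>-1\<bar>^DIM(real^2)))"
    by (rule lborel_affine) simp
  then show ?thesis by (simp add: density_1)
qed

lemma integral_reflect:
  fixes F :: "real^2 \<Rightarrow> 'b::{banach, second_countable_topology}"
  assumes "F \<in> borel_measurable borel"
  shows "(\<integral>x. F (- x) \<partial>lborel) = (\<integral>x. F x \<partial>lborel)"
proof -
  have "(\<integral>x. F x \<partial>lborel) = (\<integral>x. F x \<partial>(distr lborel borel uminus))" by (simp only: lborel_distr_uminus2)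
  also have "\<dots> = (\<integral>x. F (- x) \<partial>lborel)" by (rule integral_distr) (use assms in auto)
  finally show ?thesis by simp
qed

lemma integrable_reflect:
  fixes F :: "real^2 \<Rightarrow> 'b::{banach, second_countable_topology}"
  assumes "integrable lborel F"
  shows "integrable lborel (\<lambda>x. F (- x))"
proof -
  have "integrable (distr lborel borel uminus) F" using assms by (simp only: lborel_distr_uminus2)
  then show ?thesis by (subst (asm) integrable_distr_eq) (use assms in auto)
qed

lemma in_L2_reflect:
  assumes "in_L2 lborel F" shows "in_L2 lborel (\<lambda>x::real^2. F (- x))"
proof -
  note [measurable] = in_L2_borel[OF assms]
  have "(\<lambda>x. F (- x)) \<in> borel_measurable lborel" by measurable
  then show ?thesis unfolding in_L2_def using integrable_reflect[OF in_L2_integrable[OF assms]] by simp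
qed

lemma IFT_measurable:
  assumes "G \<in> borel_measurable borel" shows "IFT G \<in> borel_measurable borel"
proof -
  have "(\<lambda>x. FT G (- x)) \<in> borel_measurable borel"
    using FT_measurable[OF assms] by measurable
  then show ?thesis by (simp add: IFT_FT[abs_def])
qed

lemma IFT_L2:
  assumes "integrable lborel G" "in_L2 lborel G" shows "in_L2 lborel (IFT G)"
  using in_L2_reflect[OF FT_L2(1)[OF assms]] by (simp add: IFT_FT[abs_def])

text \<open>Symmetrising the spectrum projects onto real functions.\<close>

lemma IFT_Re_symmetric:
  assumes G: "integrable lborel G"
  shows "IFT (\<lambda>w. (G w + cnj (G (- w))) / 2) x = complex_of_real (Re (IFT G x))"
proof -
  have [measurable]: "G \<in> borel_measurable borel" using G by auto
  let ?F = "\<lambda>w. cnj (G w) * exp (- (\<i> * complex_of_real (w \<bullet> x)))"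
  have I1: "integrable lborel (\<lambda>w. G w * exp (\<i> * complex_of_real (w \<bullet> x)))"
    using integrable_mult_char(2)[OF G, of x] by (simp add: inner_commute)
  have I2: "integrable lborel ?F"
    using integrable_mult_char(1)[of "\<lambda>w. cnj (G w)" x] G by (simp add: inner_commute)
  have "IFT (\<lambda>w. (G w + cnj (G (- w))) / 2) x = (\<integral>w. (G w * exp (\<i> * complex_of_real (w \<bullet> x)) + ?F (- w)) / 2 \<partial>lborel)"
    unfolding IFT_def by (intro Bochner_Integration.integral_cong refl) (simp add: algebra_simps)
  also have "\<dots> = (\<integral>w. G w * exp (\<i> * complex_of_real (w \<bullet> x)) + ?F (- w) \<partial>lborel) / 2"
    by (rule integral_divide_zero)
  also have "(\<integral>w. G w * exp (\<i> * complex_of_real (w \<bullet> x)) + ?F (- w) \<partial>lborel) = IFT G x + (\<integral>w. ?F (- w) \<partial>lborel)"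
    unfolding IFT_def by (rule Bochner_Integration.integral_add[OF I1 integrable_reflect[OF I2]])
  also have "(\<integral>w. ?F (- w) \<partial>lborel) = (\<integral>w. ?F w \<partial>lborel)"
    by (rule integral_reflect) measurable
  also have "(\<integral>w. ?F w \<partial>lborel) = cnj (IFT G x)"
    unfolding IFT_def Bochner_Integration.integral_cnj[symmetric] by (simp add: exp_cnj)
  finally show ?thesis by (simp add: complex_add_cnj)
qed

lemma compactly_supported_L2_integrable:
  fixes G :: "real^2 \<Rightarrow> complex"
  assumes G: "in_L2 lborel G" and B: "\<And>w. G w \<noteq> 0 \<Longrightarrow> norm w \<le> B"
  shows "integrable lborel G"
proof -
  have "(\<lambda>w. indicator (cball 0 B) w *\<^sub>R G w) = G"
  proof
    fix w show "indicator (cball 0 B) w *\<^sub>R G w = G w" using B[of w] by (cases "G w = 0") auto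
  qed
  then show ?thesis using in_L2_local_integrable[OF G, of B] by simp
qed

text \<open>The candidate spectrum is the Plancherel transform cut off to a ball containing its support and divided by
\<open>4 \<pi>\<^sup>2\<close>. Its Fourier integral has the same pairing as \<open>f\<close> with every Lipschitz test function, hence
equals \<open>f\<close> almost everywhere; since \<open>f\<close> is real, the spectrum may then be symmetrised.\<close>

lemma band_limited_representation:
  assumes f: "square_integrable f" and bl: "band_limited f"
  obtains G B where "in_L2 lborel G" "integrable lborel G" "0 \<le> B" "\<And>w. G w \<noteq> 0 \<Longrightarrow> norm w \<le> B"
    "\<And>w. G (- w) = cnj (G w)" "AE x in lborel. f x = Re (IFT G x)"
proof -
  note fL = square_integrable_in_L2[OF f]
  have [measurable]: "f \<in> borel_measurable borel" using f by (simp add: square_integrable_def)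
  obtain K where K: "compact K" "AE w in lborel. w \<notin> K \<longrightarrow> fourier_L2 f w = 0"
    using bl by (auto simp: band_limited_def)
  obtain B0 where B0: "\<And>w. w \<in> K \<Longrightarrow> norm w \<le> B0" using compact_imp_bounded[OF K(1)] by (auto simp: bounded_iff)
  define B where "B = max B0 0"
  have B: "0 \<le> B" "\<And>w. w \<in> K \<Longrightarrow> norm w \<le> B" using B0 by (force simp: B_def)+
  note FL = fourier_L2_spec(1)[OF f]
  \<comment> \<open>Normalisation of the inversion formula for the unnormalised transform in the plane.\<close>
  define c where "c = complex_of_real (1 / (4 * pi\<^sup>2))"
  define G where "G w = c * (indicator (cball 0 B) w *\<^sub>R fourier_L2 f w)" for w
  have GL: "in_L2 lborel G" unfolding G_def by (intro in_L2_cmult in_L2_indicator FL) simp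
  have GI: "integrable lborel G" unfolding G_def by (intro integrable_mult_right in_L2_local_integrable FL)
  have [measurable]: "G \<in> borel_measurable borel" using GI by auto
  have [measurable]: "IFT G \<in> borel_measurable borel" by (rule IFT_measurable) measurable
  have GB: "norm w \<le> B" if "G w \<noteq> 0" for w using that by (auto simp: G_def indicator_def split: if_splits)
  have GF: "AE w in lborel. G w = c * fourier_L2 f w"
    using K(2)
  proof eventually_elim
    case (elim w)
    then show ?case using B(2)[of w] by (auto simp: G_def indicator_def)
  qed
  define W where "W x = complex_of_real (f x) - IFT G x" for x
  have WL: "in_L2 lborel W" unfolding W_def by (intro in_L2_diff in_L2_of_real fL IFT_L2 GI GL)
  have W0: "AE x in lborel. W x = 0"
  proof (rule lipschitz_tests_zero_AE)
    show "W \<in> borel_measurable borel" by (rule in_L2_borel[OF WL])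
    show "integrable lborel (\<lambda>x. indicator (cball 0 R) x *\<^sub>R W x)" for R by (rule in_L2_local_integrable[OF WL])
    fix v :: "real^2 \<Rightarrow> real" and C S
    assume v[measurable]: "v \<in> borel_measurable borel" and v1: "\<And>x. \<bar>v x\<bar> \<le> 1" and vS: "\<And>x. v x \<noteq> 0 \<Longrightarrow> norm x \<le> S"
      and C: "0 \<le> C" "\<And>x y. \<bar>v x - v y\<bar> \<le> C * norm (x - y)"
    let ?v = "\<lambda>x. complex_of_real (v x)"
    have iS: "integrable lborel (indicator (cball (0::real^2) S) :: _ \<Rightarrow> real)"
      using emeasure_cball_less_top by (intro integrable_real_indicator) auto
    have vI: "integrable lborel ?v"
    proof (rule Bochner_Integration.integrable_bound[OF iS])
      show "AE x in lborel. cmod (?v x) \<le> norm (indicator (cball 0 S) (x::real^2) :: real)"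
        using v1 vS by (intro AE_I2) (auto simp: indicator_def)
    qed measurable
    have "integrable lborel (\<lambda>x. (cmod (?v x))\<^sup>2)"
    proof (rule Bochner_Integration.integrable_bound[OF iS])
      show "AE x in lborel. norm ((cmod (?v x))\<^sup>2) \<le> norm (indicator (cball 0 S) (x::real^2) :: real)"
      proof (rule AE_I2)
        fix x
        have "(v x)\<^sup>2 \<le> 1" using v1[of x] by (simp add: abs_square_le_1)
        then show "norm ((cmod (?v x))\<^sup>2) \<le> norm (indicator (cball 0 S) (x::real^2) :: real)"
          using vS[of x] by (cases "v x = 0") auto
      qed
    qed measurable
    then have vL: "in_L2 lborel ?v" by (simp add: in_L2_def)
    have "(\<integral>w. fourier_L2 f w * cnj (FT ?v w) \<partial>lborel) = 4 * pi\<^sup>2 * (\<integral>x. complex_of_real (f x) * ?v x \<partial>lborel)"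
      by (rule fourier_L2_pairing[OF f v v1 vS C])
    then have "(\<integral>x. complex_of_real (f x) * ?v x \<partial>lborel) = c * (\<integral>w. fourier_L2 f w * cnj (FT ?v w) \<partial>lborel)"
      by (simp add: c_def)
    also have "\<dots> = (\<integral>w. c * fourier_L2 f w * cnj (FT ?v w) \<partial>lborel)"
      unfolding mult.assoc by simp
    also have "\<dots> = (\<integral>w. G w * cnj (FT ?v w) \<partial>lborel)"
    proof (rule integral_cong_AE)
      show "AE w in lborel. c * fourier_L2 f w * cnj (FT ?v w) = G w * cnj (FT ?v w)"
        using GF by eventually_elim simp
    qed (use in_L2_borel[OF FL] in measurable)
    also have "\<dots> = (\<integral>w. \<integral>x. G w * (?v x * exp (\<i> * complex_of_real (w \<bullet> x))) \<partial>lborel \<partial>lborel)"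
    proof (rule Bochner_Integration.integral_cong[OF refl])
      fix w
      have "cnj (FT ?v w) = (\<integral>x. ?v x * exp (\<i> * complex_of_real (w \<bullet> x)) \<partial>lborel)"
        unfolding FT_def Bochner_Integration.integral_cnj[symmetric] by (simp add: exp_cnj)
      then show "G w * cnj (FT ?v w) = (\<integral>x. G w * (?v x * exp (\<i> * complex_of_real (w \<bullet> x))) \<partial>lborel)"
        by simp
    qed
    also have "\<dots> = (\<integral>x. \<integral>w. G w * (?v x * exp (\<i> * complex_of_real (w \<bullet> x))) \<partial>lborel \<partial>lborel)"
    proof (rule lborel_pair.Fubini_integral[symmetric])
      show "integrable (lborel \<Otimes>\<^sub>M lborel) (\<lambda>(w, x). G w * (?v x * exp (\<i> * complex_of_real (w \<bullet> x))))"
        unfolding case_prod_unfold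
        by (rule Bochner_Integration.integrable_bound[OF integrable_prod_mult(1)[OF GI vI]]) (auto simp: norm_mult)
    qed
    also have "\<dots> = (\<integral>x. IFT G x * ?v x \<partial>lborel)"
    proof (rule Bochner_Integration.integral_cong[OF refl])
      fix x
      have "(\<integral>w. G w * (?v x * exp (\<i> * complex_of_real (w \<bullet> x))) \<partial>lborel) = (\<integral>w. (G w * exp (\<i> * complex_of_real (w \<bullet> x))) * ?v x \<partial>lborel)"
        by (simp only: mult_ac)
      then show "(\<integral>w. G w * (?v x * exp (\<i> * complex_of_real (w \<bullet> x))) \<partial>lborel) = IFT G x * ?v x"
        unfolding IFT_def by simp
    qed
    finally have "(\<integral>x. complex_of_real (f x) * ?v x \<partial>lborel) = (\<integral>x. IFT G x * ?v x \<partial>lborel)" .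
    moreover have "(\<integral>x. W x * ?v x \<partial>lborel) = (\<integral>x. complex_of_real (f x) * ?v x \<partial>lborel) - (\<integral>x. IFT G x * ?v x \<partial>lborel)"
      unfolding W_def left_diff_distrib
      by (intro Bochner_Integration.integral_diff L2_mult_integrable in_L2_of_real fL IFT_L2 GI GL vL)
    ultimately show "(\<integral>x. W x * ?v x \<partial>lborel) = 0" by simp
  qed
  define G1 where "G1 w = (G w + cnj (G (- w))) / 2" for w
  have G1: "IFT G1 x = complex_of_real (Re (IFT G x))" for x
    unfolding G1_def[abs_def] by (rule IFT_Re_symmetric[OF GI])
  have G1L: "in_L2 lborel G1"
    using in_L2_cmult[OF in_L2_add[OF GL in_L2_cnj[OF in_L2_reflect[OF GL]]], of "1/2"] by (simp add: G1_def[abs_def])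
  have G1B: "norm w \<le> B" if "G1 w \<noteq> 0" for w
  proof -
    have "G w \<noteq> 0 \<or> G (- w) \<noteq> 0" using that by (auto simp: G1_def)
    then show ?thesis using GB[of w] GB[of "- w"] by auto
  qed
  show ?thesis
  proof (rule that[OF G1L compactly_supported_L2_integrable[OF G1L G1B] B(1) G1B])
    show "G1 (- w) = cnj (G1 w)" for w by (simp add: G1_def)
    show "AE x in lborel. f x = Re (IFT G1 x)"
      using W0
    proof eventually_elim
      case (elim x)
      then have "IFT G x = complex_of_real (f x)" by (simp add: W_def)
      then show ?case by (simp add: G1)
    qed
  qed
qed

section \<open>Derivatives of band-limited functions\<close>

definition spectrum_in :: "real \<Rightarrow> (real^2 \<Rightarrow> complex) \<Rightarrow> bool" where
  "spectrum_in B G \<longleftrightarrow> in_L2 lborel G \<and> (\<forall>w. G w \<noteq> 0 \<longrightarrow> norm w \<le> B)"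

lemma spectrum_in_integrable: "spectrum_in B G \<Longrightarrow> integrable lborel G"
  using compactly_supported_L2_integrable[of G B] by (auto simp: spectrum_in_def)

lemma spectrum_in_L2: "spectrum_in B G \<Longrightarrow> in_L2 lborel G"
  by (simp add: spectrum_in_def)

lemma spectrum_in_bound: "spectrum_in B G \<Longrightarrow> G w \<noteq> 0 \<Longrightarrow> norm w \<le> B"
  by (simp add: spectrum_in_def)

text \<open>Multiplication by a symbol acts on spectra supported in a ball; only the size of the symbol on that ball
matters.\<close>

lemma spectrum_in_mult_bound:
  assumes G: "spectrum_in B G" and p: "continuous_on UNIV p" and c: "\<And>w. norm w \<le> B \<Longrightarrow> cmod (p w) \<le> c" "0 \<le> c"
  shows "spectrum_in B (\<lambda>w. p w * G w)" and "L2n lborel (\<lambda>w. p w * G w) \<le> c * L2n lborel G"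
proof -
  note [measurable] = in_L2_borel[OF spectrum_in_L2[OF G]]
  have [measurable]: "p \<in> borel_measurable borel" using p by (rule borel_measurable_continuous_onI)
  have m: "(\<lambda>w. p w * G w) \<in> borel_measurable lborel" by measurable
  have b: "cmod (p w * G w) \<le> c * cmod (G w)" for w
    using c(1)[of w] spectrum_in_bound[OF G, of w] by (cases "G w = 0") (auto simp: norm_mult intro!: mult_right_mono)
  show "spectrum_in B (\<lambda>w. p w * G w)"
    using in_L2_bound(1)[OF spectrum_in_L2[OF G] m b] spectrum_in_bound[OF G] by (auto simp: spectrum_in_def)
  show "L2n lborel (\<lambda>w. p w * G w) \<le> c * L2n lborel G"
    using in_L2_bound(2)[OF spectrum_in_L2[OF G] m b] c(2) by simp
qed

lemma spectrum_in_mult: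
  assumes G: "spectrum_in B G" and p: "continuous_on UNIV p" shows "spectrum_in B (\<lambda>w. p w * G w)"
proof -
  have "compact (p ` cball 0 B)" by (intro compact_continuous_image continuous_on_subset[OF p]) auto
  then have "bounded (p ` cball 0 B)" by (rule compact_imp_bounded)
  then obtain c where "\<forall>y\<in>p ` cball 0 B. cmod y \<le> c" unfolding bounded_iff by blast
  then have c: "\<And>w. norm w \<le> B \<Longrightarrow> cmod (p w) \<le> c" by simp
  have "cmod (p w) \<le> max c 0" if "norm w \<le> B" for w using c[OF that] by simp
  then show ?thesis by (rule spectrum_in_mult_bound(1)[OF G p]) auto
qed

lemma IFT_add:
  assumes "spectrum_in B F" "spectrum_in B G" shows "IFT (\<lambda>w. F w + G w) x = IFT F x + IFT G x"
  unfolding IFT_def distrib_right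
  using integrable_mult_char(2)[OF spectrum_in_integrable[OF assms(1)], of x] integrable_mult_char(2)[OF spectrum_in_integrable[OF assms(2)], of x]
  by (intro Bochner_Integration.integral_add) (simp_all add: inner_commute)

lemma IFT_diff:
  assumes "spectrum_in B F" "spectrum_in B G" shows "IFT (\<lambda>w. F w - G w) x = IFT F x - IFT G x"
  unfolding IFT_def left_diff_distrib
  using integrable_mult_char(2)[OF spectrum_in_integrable[OF assms(1)], of x] integrable_mult_char(2)[OF spectrum_in_integrable[OF assms(2)], of x]
  by (intro Bochner_Integration.integral_diff) (simp_all add: inner_commute)

lemma IFT_mult_diff:
  assumes "spectrum_in B G" "continuous_on UNIV p" "continuous_on UNIV q"
  shows "IFT (\<lambda>w. (p w - q w) * G w) x = IFT (\<lambda>w. p w * G w) x - IFT (\<lambda>w. q w * G w) x"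
  unfolding IFT_diff[OF spectrum_in_mult[OF assms(1,2)] spectrum_in_mult[OF assms(1,3)], symmetric] left_diff_distrib ..

lemma IFT_mult_add:
  assumes "spectrum_in B G" "continuous_on UNIV p" "continuous_on UNIV q"
  shows "IFT (\<lambda>w. (p w + q w) * G w) x = IFT (\<lambda>w. p w * G w) x + IFT (\<lambda>w. q w * G w) x"
  unfolding IFT_add[OF spectrum_in_mult[OF assms(1,2)] spectrum_in_mult[OF assms(1,3)], symmetric] distrib_right ..

lemma IFT_cmult: "IFT (\<lambda>w. c * F w) x = c * IFT F x"
  by (simp add: IFT_def mult.assoc)

lemma IFT_shift: "IFT G (x + y) = IFT (\<lambda>w. exp (\<i> * complex_of_real (w \<bullet> y)) * G w) x"
  unfolding IFT_def
  by (intro Bochner_Integration.integral_cong refl) (simp add: inner_add_right distrib_left exp_add mult_ac)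

definition deriv_spectrum :: "2 \<Rightarrow> (real^2 \<Rightarrow> complex) \<Rightarrow> real^2 \<Rightarrow> complex" where
  "deriv_spectrum j G w = (\<i> * complex_of_real (w $ j)) * G w"

lemma spectrum_in_deriv: "spectrum_in B G \<Longrightarrow> spectrum_in B (deriv_spectrum j G)"
  unfolding deriv_spectrum_def[abs_def] by (intro spectrum_in_mult continuous_intros)

lemma cmod_IFT_le:
  assumes "integrable lborel F" shows "cmod (IFT F x) \<le> (\<integral>w. cmod (F w) \<partial>lborel)"
proof -
  have "cmod (IFT F x) \<le> (\<integral>w. cmod (F w * exp (\<i> * complex_of_real (w \<bullet> x))) \<partial>lborel)"
    unfolding IFT_def by (rule integral_norm_bound)
  then show ?thesis by (simp only: norm_mult norm_exp_i mult_1_right)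
qed

lemma iexp_taylor1: "cmod (exp (\<i> * complex_of_real t) - 1 - \<i> * complex_of_real t) \<le> t\<^sup>2 / 2"
proof -
  have "cmod (iexp t - (\<Sum>k\<le>1. (\<i> * complex_of_real t)^k / fact k)) \<le> \<bar>t\<bar>^(Suc 1) / fact (Suc 1)"
    by (rule iexp_approx1)
  then show ?thesis by (simp add: algebra_simps power2_eq_square)
qed

text \<open>The second-order remainder of the exponential is at most \<open>(w \<bullet> d)\<^sup>2 / 2\<close>, which is integrable against a
compactly supported spectrum.\<close>

lemma IFT_has_derivative:
  assumes G: "spectrum_in B G"
  shows "((\<lambda>x. Re (IFT G x)) has_derivative (\<lambda>d. d$1 * Re (IFT (deriv_spectrum 1 G) x) + d$2 * Re (IFT (deriv_spectrum 2 G) x))) (at x)"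
proof -
  let ?L = "\<lambda>d::real^2. d$1 * Re (IFT (deriv_spectrum 1 G) x) + d$2 * Re (IFT (deriv_spectrum 2 G) x)"
  note GI = spectrum_in_integrable[OF G]
  note [measurable] = in_L2_borel[OF spectrum_in_L2[OF G]]
  define N where "N = (\<integral>w. cmod (G w) \<partial>lborel)"
  have N0: "0 \<le> N" by (simp add: N_def)
  have b: "norm (Re (IFT G (x + d)) - Re (IFT G x) - ?L d) \<le> B\<^sup>2 * N * (norm d)\<^sup>2" for d
  proof -
    let ?r = "\<lambda>w. exp (\<i> * complex_of_real (w \<bullet> d)) - 1 - \<i> * complex_of_real (w \<bullet> d)"
    have bE: "spectrum_in B (\<lambda>w. exp (\<i> * complex_of_real (w \<bullet> d)) * G w)" by (intro spectrum_in_mult G continuous_intros)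
    have bL: "spectrum_in B (\<lambda>w. (\<i> * complex_of_real (w \<bullet> d)) * G w)" by (intro spectrum_in_mult G continuous_intros)
    have bR: "spectrum_in B (\<lambda>w. ?r w * G w)" by (intro spectrum_in_mult G continuous_intros)
    have bE1: "spectrum_in B (\<lambda>w. (exp (\<i> * complex_of_real (w \<bullet> d)) - 1) * G w)" by (intro spectrum_in_mult G continuous_intros)
    have bD: "spectrum_in B (\<lambda>w. complex_of_real (d$1) * deriv_spectrum 1 G w)" "spectrum_in B (\<lambda>w. complex_of_real (d$2) * deriv_spectrum 2 G w)"
      by (intro spectrum_in_mult spectrum_in_deriv G continuous_intros)+
    have "IFT (\<lambda>w. (\<i> * complex_of_real (w \<bullet> d)) * G w) x = IFT (\<lambda>w. complex_of_real (d$1) * deriv_spectrum 1 G w + complex_of_real (d$2) * deriv_spectrum 2 G w) x"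
      by (simp add: deriv_spectrum_def inner_vec2 algebra_simps)
    also have "\<dots> = complex_of_real (d$1) * IFT (deriv_spectrum 1 G) x + complex_of_real (d$2) * IFT (deriv_spectrum 2 G) x"
      unfolding IFT_add[OF bD] IFT_cmult ..
    finally have L: "?L d = Re (IFT (\<lambda>w. (\<i> * complex_of_real (w \<bullet> d)) * G w) x)" by simp
    have "IFT (\<lambda>w. ?r w * G w) x = IFT (\<lambda>w. (exp (\<i> * complex_of_real (w \<bullet> d)) - 1) * G w) x - IFT (\<lambda>w. (\<i> * complex_of_real (w \<bullet> d)) * G w) x"
      by (intro IFT_mult_diff[OF G] continuous_intros)
    also have "IFT (\<lambda>w. (exp (\<i> * complex_of_real (w \<bullet> d)) - 1) * G w) x = IFT G (x + d) - IFT G x"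
      unfolding IFT_shift using IFT_mult_diff[OF G, of "\<lambda>w. exp (\<i> * complex_of_real (w \<bullet> d))" "\<lambda>w. 1"]
      by (simp add: continuous_intros)
    finally have "Re (IFT G (x + d)) - Re (IFT G x) - ?L d = Re (IFT (\<lambda>w. ?r w * G w) x)"
      unfolding L by simp
    then have "norm (Re (IFT G (x + d)) - Re (IFT G x) - ?L d) \<le> cmod (IFT (\<lambda>w. ?r w * G w) x)"
      by (simp add: abs_Re_le_cmod)
    also have "\<dots> \<le> (\<integral>w. cmod (?r w * G w) \<partial>lborel)" by (rule cmod_IFT_le[OF spectrum_in_integrable[OF bR]])
    also have "\<dots> \<le> (\<integral>w. B\<^sup>2 * (norm d)\<^sup>2 * cmod (G w) \<partial>lborel)"
    proof (rule integral_mono)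
      show "integrable lborel (\<lambda>w. cmod (?r w * G w))" by (intro integrable_norm spectrum_in_integrable[OF bR])
      show "integrable lborel (\<lambda>w. B\<^sup>2 * (norm d)\<^sup>2 * cmod (G w))" by (intro integrable_mult_right integrable_norm GI)
      fix w
      show "cmod (?r w * G w) \<le> B\<^sup>2 * (norm d)\<^sup>2 * cmod (G w)"
      proof (cases "G w = 0")
        case False
        have "\<bar>w \<bullet> d\<bar> \<le> norm w * norm d" by (rule Cauchy_Schwarz_ineq2)
        also have "\<dots> \<le> B * norm d" using spectrum_in_bound[OF G False] by (intro mult_right_mono) auto
        finally have "(w \<bullet> d)\<^sup>2 \<le> B\<^sup>2 * (norm d)\<^sup>2" unfolding power_mult_distrib[symmetric] by (rule abs_le_square_iff[THEN iffD1, OF order_trans]) simp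
        moreover have "cmod (?r w) \<le> (w \<bullet> d)\<^sup>2 / 2" by (rule iexp_taylor1)
        ultimately have "cmod (?r w) \<le> B\<^sup>2 * (norm d)\<^sup>2" using zero_le_power2[of "w \<bullet> d"] by linarith
        then show ?thesis unfolding norm_mult by (intro mult_right_mono) auto
      qed simp
    qed
    also have "\<dots> = B\<^sup>2 * N * (norm d)\<^sup>2" by (simp add: N_def)
    finally show ?thesis .
  qed
  have "linear ?L" by (rule linearI) (simp_all add: algebra_simps)
  then have "bounded_linear ?L" by (simp add: linear_conv_bounded_linear)
  moreover have "((\<lambda>d. norm (Re (IFT G (x + d)) - Re (IFT G x) - ?L d) / norm d) \<longlongrightarrow> 0) (at 0)"
  proof (rule Lim_null_comparison)
    show "\<forall>\<^sub>F d in at 0. norm (norm (Re (IFT G (x + d)) - Re (IFT G x) - ?L d) / norm d) \<le> B\<^sup>2 * N * norm d"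
    proof (rule always_eventually, rule allI)
      fix d :: "real^2"
      show "norm (norm (Re (IFT G (x + d)) - Re (IFT G x) - ?L d) / norm d) \<le> B\<^sup>2 * N * norm d"
      proof (cases "d = 0")
        case False
        then show ?thesis using b[of d] by (simp add: divide_le_eq power2_eq_square mult_ac)
      qed simp
    qed
    have "((\<lambda>d::real^2. B\<^sup>2 * N * norm d) \<longlongrightarrow> B\<^sup>2 * N * norm (0::real^2)) (at 0)"
      by (intro tendsto_mult tendsto_const tendsto_norm tendsto_ident_at)
    then show "((\<lambda>d::real^2. B\<^sup>2 * N * norm d) \<longlongrightarrow> 0) (at 0)" by simp
  qed
  ultimately show ?thesis unfolding has_derivative_at by blast
qed

lemma IFT_partial_deriv:
  assumes G: "spectrum_in B G"
  shows "partial_deriv j (\<lambda>x. Re (IFT G x)) = (\<lambda>x. Re (IFT (deriv_spectrum j G) x))"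
proof
  fix x
  have "frechet_derivative (\<lambda>x. Re (IFT G x)) (at x) = (\<lambda>d. d$1 * Re (IFT (deriv_spectrum 1 G) x) + d$2 * Re (IFT (deriv_spectrum 2 G) x))"
    using frechet_derivative_at[OF IFT_has_derivative[OF G]] by simp
  then show "partial_deriv j (\<lambda>x. Re (IFT G x)) x = Re (IFT (deriv_spectrum j G) x)"
    using exhaust_2[of j] by (auto simp: partial_deriv_def axis_def)
qed

lemma IFT_differentiable: "spectrum_in B G \<Longrightarrow> (\<lambda>x. Re (IFT G x)) differentiable (at x)"
  using IFT_has_derivative differentiable_def by blast

lemma IFT_continuous: "spectrum_in B G \<Longrightarrow> continuous_on UNIV (\<lambda>x. Re (IFT G x))"
  by (rule differentiable_imp_continuous_on) (simp add: differentiable_on_def IFT_differentiable)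

lemma IFT_hessian:
  assumes G: "spectrum_in B G"
  shows "classical_hessian (\<lambda>x. Re (IFT G x)) x = (\<chi> i j. Re (IFT (deriv_spectrum i (deriv_spectrum j G)) x))"
  unfolding classical_hessian_def IFT_partial_deriv[OF G] IFT_partial_deriv[OF spectrum_in_deriv[OF G]] ..

lemma IFT_twice_continuously_differentiable:
  assumes G: "spectrum_in B G"
  shows "twice_continuously_differentiable (\<lambda>x. Re (IFT G x))"
  unfolding twice_continuously_differentiable_def IFT_partial_deriv[OF G]
proof (intro conjI allI)
  show "(\<lambda>x. Re (IFT G x)) differentiable (at x)" for x by (rule IFT_differentiable[OF G])
  show "(\<lambda>x. Re (IFT (deriv_spectrum j G) x)) differentiable (at x)" for j x by (rule IFT_differentiable[OF spectrum_in_deriv[OF G]])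
  have "classical_hessian (\<lambda>x. Re (IFT G x)) = (\<lambda>x. \<chi> i j. Re (IFT (deriv_spectrum i (deriv_spectrum j G)) x))"
    using IFT_hessian[OF G] by (rule ext)
  then show "continuous_on UNIV (classical_hessian (\<lambda>x. Re (IFT G x)))"
    by (simp only:) (intro continuous_on_vec_lambda IFT_continuous[OF spectrum_in_deriv[OF spectrum_in_deriv[OF G]]])
qed

lemma continuous_AE_eq:
  fixes g h :: "real^2 \<Rightarrow> real"
  assumes g: "continuous_on UNIV g" and h: "continuous_on UNIV h" and ae: "AE x in lborel. g x = h x"
  shows "g = h"
proof (rule ccontr)
  assume "g \<noteq> h"
  let ?S = "{x. g x \<noteq> h x}"
  have o: "open ?S" by (rule open_Collect_neq[OF g h])
  have "?S \<noteq> {}" using \<open>g \<noteq> h\<close> by auto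
  then have "\<not> negligible ?S" using o by (rule open_not_negligible[rotated])
  moreover have "?S \<in> null_sets lborel"
    by (subst AE_iff_null_sets) (use ae o in auto)
  then have "negligible ?S" by (auto simp: negligible_iff_null_sets intro: null_sets_completionI)
  ultimately show False by simp
qed

text \<open>Continuous functions that agree almost everywhere agree everywhere, so the representative chosen in the
definition is the Fourier integral.\<close>

lemma smooth_representative_eq:
  assumes G: "spectrum_in B G" and f: "AE x in lborel. f x = Re (IFT G x)"
  shows "smooth_representative f = (\<lambda>x. Re (IFT G x))"
proof -
  let ?g = "\<lambda>x. Re (IFT G x)"
  have "twice_continuously_differentiable ?g \<and> (AE x in lborel. ?g x = f x)"
    using IFT_twice_continuously_differentiable[OF G] f by (auto simp: eq_commute)
  then have s: "twice_continuously_differentiable (smooth_representative f) \<and> (AE x in lborel. smooth_representative f x = f x)"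
    unfolding smooth_representative_def by (intro someI_ex[of "\<lambda>g. twice_continuously_differentiable g \<and> (AE x in lborel. g x = f x)"] exI[of _ ?g])
  have "continuous_on UNIV (smooth_representative f)"
    using s by (intro differentiable_imp_continuous_on) (simp add: differentiable_on_def twice_continuously_differentiable_def)
  moreover have "AE x in lborel. smooth_representative f x = ?g x"
    using s f by (auto elim: eventually_elim2)
  ultimately show ?thesis using continuous_AE_eq IFT_continuous[OF G] by blast
qed

section \<open>Lattice cells\<close>

lemma matrix_inv_mult:
  fixes X :: "real^2^2"
  assumes "det X \<noteq> 0" shows "X ** matrix_inv X = mat 1" "matrix_inv X ** X = mat 1"
proof -
  have "\<exists>Y. X ** Y = mat 1 \<and> Y ** X = mat 1" using assms by (simp add: invertible_det_nz[symmetric] invertible_def)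
  from someI_ex[OF this] show "X ** matrix_inv X = mat 1" "matrix_inv X ** X = mat 1"
    by (simp_all add: matrix_inv_def)
qed

lemma lborel_linear:
  fixes X :: "real^2^2"
  assumes d: "det X \<noteq> 0"
  shows "lborel = density (distr lborel borel ((*v) X)) (\<lambda>_. ennreal \<bar>det X\<bar>)"
proof (rule lborel_eqI)
  have m[measurable]: "(*v) X \<in> borel_measurable lborel"
    by (simp add: borel_measurable_continuous_onI linear_continuous_on linear_conv_bounded_linear[symmetric])
  have XI: "X *v (matrix_inv X *v x) = x" "matrix_inv X *v (X *v x) = x" for x
    using matrix_inv_mult(1)[OF d] matrix_inv_mult(2)[OF d] by (simp_all add: matrix_vector_mul_assoc)
  fix l u :: "real^2" assume le: "\<And>b. b \<in> Basis \<Longrightarrow> l \<bullet> b \<le> u \<bullet> b"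
  let ?S = "(*v) X -` box l u"
  have S: "?S = (*v) (matrix_inv X) ` box l u"
    using XI by (auto simp: image_iff) metis
  have bS: "?S \<in> sets borel" using measurable_sets[OF m, of "box l u"] by simp
  have lin: "linear ((*v) (matrix_inv X))" by simp
  have dI: "det (matrix_inv X) = 1 / det X"
  proof -
    have "det (X ** matrix_inv X) = 1" using matrix_inv_mult(1)[OF d] by simp
    then show ?thesis using d by (simp add: det_mul field_simps)
  qed
  have lm: "?S \<in> lmeasurable" unfolding S by (rule measurable_linear_image[OF lin]) simp
  have "emeasure lborel ?S = emeasure lebesgue ?S" using bS by simp
  also have "\<dots> = ennreal (measure lebesgue ?S)" by (rule emeasure_eq_measure2[OF lm])
  also have "measure lebesgue ?S = \<bar>1 / det X\<bar> * measure lebesgue (box l u)"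
    unfolding S using measure_linear_image[OF lin, of "box l u"] by (simp add: matrix_of_matrix_vector_mul dI)
  also have "measure lebesgue (box l u) = measure lborel (box l u)" by simp
  finally have e: "emeasure lborel ?S = ennreal (\<bar>1 / det X\<bar> * measure lborel (box l u))" .
  have "emeasure (density (distr lborel borel ((*v) X)) (\<lambda>_. ennreal \<bar>det X\<bar>)) (box l u) = ennreal \<bar>det X\<bar> * emeasure lborel ?S"
    by (subst emeasure_density_const) (simp_all add: emeasure_distr[OF m])
  also have "\<dots> = ennreal (measure lborel (box l u))"
    unfolding e using d by (simp add: abs_mult flip: ennreal_mult)
  also have "\<dots> = emeasure lborel (box l u)"
    using emeasure_bounded_finite[OF bounded_box, of l u] by (intro emeasure_eq_measure2[symmetric]) (simp add: fmeasurable_def)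
  also have "\<dots> = (\<Prod>b\<in>Basis. (u - l) \<bullet> b)" using le by simp
  finally show "emeasure (density (distr lborel borel ((*v) X)) (\<lambda>_. ennreal \<bar>det X\<bar>)) (box l u) = (\<Prod>b\<in>Basis. (u - l) \<bullet> b)" .
qed simp

lemma matrix_vector_borel_measurable [measurable]: "(*v) (X :: real^2^2) \<in> borel_measurable borel"
  by (simp add: borel_measurable_continuous_onI linear_continuous_on linear_conv_bounded_linear[symmetric])

lemma nn_integral_linear:
  fixes X :: "real^2^2"
  assumes d: "det X \<noteq> 0" and [measurable]: "F \<in> borel_measurable borel"
  shows "(\<integral>\<^sup>+x. F x \<partial>lborel) = ennreal \<bar>det X\<bar> * (\<integral>\<^sup>+u. F (X *v u) \<partial>lborel)"
proof -
  have "(\<integral>\<^sup>+x. F x \<partial>lborel) = (\<integral>\<^sup>+x. F x \<partial>density (distr lborel borel ((*v) X)) (\<lambda>_. ennreal \<bar>det X\<bar>))"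
    by (subst lborel_linear[OF d]) simp
  also have "\<dots> = ennreal \<bar>det X\<bar> * (\<integral>\<^sup>+u. F (X *v u) \<partial>lborel)"
    by (simp add: nn_integral_density nn_integral_distr nn_integral_cmult)
  finally show ?thesis .
qed

lemma integral_linear:
  fixes X :: "real^2^2" and F :: "real^2 \<Rightarrow> 'b::{banach, second_countable_topology}"
  assumes d: "det X \<noteq> 0" and [measurable]: "F \<in> borel_measurable borel"
  shows "(\<integral>x. F x \<partial>lborel) = \<bar>det X\<bar> *\<^sub>R (\<integral>u. F (X *v u) \<partial>lborel)"
proof -
  have "(\<integral>x. F x \<partial>lborel) = (\<integral>x. F x \<partial>density (distr lborel borel ((*v) X)) (\<lambda>_. ennreal \<bar>det X\<bar>))"
    by (subst lborel_linear[OF d]) simp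
  also have "\<dots> = \<bar>det X\<bar> *\<^sub>R (\<integral>u. F (X *v u) \<partial>lborel)"
    by (simp add: integral_density integral_distr)
  finally show ?thesis .
qed

definition unit_cell :: "(real^2) set" where "unit_cell = {v. \<forall>i. 0 \<le> v$i \<and> v$i < 1}"

text \<open>The plane is split into pairs of a lattice point and a position in the unit cell, with counting measure on
the lattice and Lebesgue measure on the cell. The latter is a probability measure.\<close>

definition cellM :: "(real^2) measure" where "cellM = restrict_space lborel unit_cell"

definition latM :: "(int^2) measure" where "latM = count_space UNIV"

definition PM :: "((int^2) \<times> (real^2)) measure" where "PM = latM \<Otimes>\<^sub>M cellM"

definition vec_floor :: "real^2 \<Rightarrow> int^2" where "vec_floor u = (\<chi> i. \<lfloor>u$i\<rfloor>)"

lemma real_of_int_vec_nth [simp]: "real_of_int_vec k $ i = of_int (k $ i)"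
  by (simp add: real_of_int_vec_def)

lemma real_of_int_vec_add: "real_of_int_vec (k + l) = real_of_int_vec k + real_of_int_vec l"
  by (simp add: vec_eq_iff)

lemma diff_mem_unit_cell_iff: "u - real_of_int_vec k \<in> unit_cell \<longleftrightarrow> k = vec_floor u"
proof -
  have "0 \<le> u $ i - of_int (k $ i) \<and> u $ i - of_int (k $ i) < 1 \<longleftrightarrow> k $ i = \<lfloor>u $ i\<rfloor>" for i
    by (auto simp: eq_commute[of "k $ i"] floor_eq_iff)
  then show ?thesis by (simp add: unit_cell_def vec_floor_def vec_eq_iff)
qed

lemma vec2_nth_measurable [measurable]: "(\<lambda>x::real^2. x $ i) \<in> borel_measurable borel"
  by (intro borel_measurable_continuous_onI continuous_intros)

lemma unit_cell_borel [measurable]: "unit_cell \<in> sets borel"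
proof -
  have "unit_cell = {v \<in> space borel. 0 \<le> v$1 \<and> v$1 < 1 \<and> 0 \<le> v$2 \<and> v$2 < 1}"
    by (auto simp: unit_cell_def forall_2)
  also have "\<dots> \<in> sets borel" by measurable
  finally show ?thesis .
qed

lemma measurable_cellM [measurable (raw)]: "f \<in> borel_measurable borel \<Longrightarrow> f \<in> borel_measurable cellM"
  unfolding cellM_def by (rule measurable_restrict_space1) simp

lemma space_cellM [simp]: "space cellM = unit_cell"
  by (simp add: cellM_def)

lemma space_latM [simp]: "space latM = UNIV"
  by (simp add: latM_def)

lemma space_PM [simp]: "space PM = UNIV \<times> unit_cell"
  by (simp add: PM_def space_pair_measure)

lemma measurable_latM [measurable]: "f \<in> measurable latM M \<longleftrightarrow> f \<in> UNIV \<rightarrow> space M"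
  by (simp add: latM_def)

lemma measurable_PM:
  assumes "\<And>k. (\<lambda>v. f (k, v)) \<in> measurable cellM N"
  shows "f \<in> measurable PM N"
  unfolding PM_def latM_def by (rule measurable_pair_measure_countable1) (use assms in auto)

lemma nn_integral_cellM:
  assumes [measurable]: "F \<in> borel_measurable borel"
  shows "(\<integral>\<^sup>+v. F v \<partial>cellM) = (\<integral>\<^sup>+v. F v * indicator unit_cell v \<partial>lborel)"
  unfolding cellM_def by (rule nn_integral_restrict_space) simp

lemma emeasure_unit_cell: "emeasure lborel unit_cell = 1"
proof -
  have "unit_cell \<in> sets lborel" by simp
  have "emeasure lborel (box (0::real^2) 1) \<le> emeasure lborel unit_cell"
    by (rule emeasure_mono) (auto simp: unit_cell_def mem_box Basis_vec_def inner_axis less_imp_le)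
  moreover have "emeasure lborel unit_cell \<le> emeasure lborel (cbox (0::real^2) 1)"
    by (rule emeasure_mono) (auto simp: unit_cell_def mem_box Basis_vec_def inner_axis less_imp_le)
  moreover have o: "(1::real^2) \<bullet> b = 1" if "b \<in> Basis" for b
    using that by (auto simp: Basis_vec_def inner_axis)
  have "(\<Prod>b\<in>Basis. (1::real^2) \<bullet> b) = 1" by (rule prod.neutral) (use o in auto)
  then have "emeasure lborel (box (0::real^2) 1) = 1" "emeasure lborel (cbox (0::real^2) 1) = 1"
    by (auto simp: emeasure_lborel_box_eq emeasure_lborel_cbox_eq o)
  ultimately show ?thesis by (simp add: antisym)
qed

lemma prob_space_cellM: "prob_space cellM"
  by (rule prob_spaceI) (simp add: cellM_def emeasure_restrict_space emeasure_unit_cell)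

lemma sigma_finite_latM: "sigma_finite_measure latM"
  unfolding latM_def by (rule sigma_finite_measure_count_space_countable) simp

interpretation cellM: prob_space cellM by (rule prob_space_cellM)
interpretation latM: sigma_finite_measure latM by (rule sigma_finite_latM)
interpretation PM: pair_sigma_finite latM cellM ..

lemma nn_integral_PM:
  assumes "F \<in> borel_measurable PM"
  shows "(\<integral>\<^sup>+p. F p \<partial>PM) = (\<integral>\<^sup>+k. \<integral>\<^sup>+v. F (k, v) \<partial>cellM \<partial>latM)"
    and "(\<integral>\<^sup>+p. F p \<partial>PM) = (\<integral>\<^sup>+v. \<integral>\<^sup>+k. F (k, v) \<partial>latM \<partial>cellM)"
  using cellM.nn_integral_fst[of F latM] PM.nn_integral_snd[of F] assms by (simp_all add: PM_def)

lemma nn_integral_translate: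
  fixes f :: "real^2 \<Rightarrow> ennreal"
  assumes [measurable]: "f \<in> borel_measurable borel"
  shows "(\<integral>\<^sup>+y. f (a + y) \<partial>lborel) = (\<integral>\<^sup>+y. f y \<partial>lborel)"
proof -
  have "(\<integral>\<^sup>+y. f y \<partial>lborel) = (\<integral>\<^sup>+y. f y \<partial>(distr lborel borel ((+) a)))" by (simp only: lborel_distr_plus)
  also have "\<dots> = (\<integral>\<^sup>+y. f (a + y) \<partial>lborel)" by (rule nn_integral_distr) auto
  finally show ?thesis by simp
qed

text \<open>The translates of the unit cell by integer vectors tile the plane: every \<open>u\<close> lies in exactly the cell
indexed by its coordinatewise floor.\<close>

lemma nn_integral_cells:
  fixes F :: "real^2 \<Rightarrow> ennreal"
  assumes [measurable]: "F \<in> borel_measurable borel"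
  shows "(\<integral>\<^sup>+p. F (real_of_int_vec (fst p) + snd p) \<partial>PM) = (\<integral>\<^sup>+u. F u \<partial>lborel)"
proof -
  have m: "(\<lambda>p. F (real_of_int_vec (fst p) + snd p)) \<in> borel_measurable PM"
    by (rule measurable_PM) simp
  have "(\<integral>\<^sup>+p. F (real_of_int_vec (fst p) + snd p) \<partial>PM) = (\<integral>\<^sup>+k. \<integral>\<^sup>+v. F (real_of_int_vec k + v) \<partial>cellM \<partial>latM)"
    by (simp add: nn_integral_PM(1)[OF m])
  also have "\<dots> = (\<integral>\<^sup>+k. \<integral>\<^sup>+u. F u * indicator {vec_floor u} k \<partial>lborel \<partial>latM)"
  proof (rule nn_integral_cong)
    fix k :: "int^2"
    have "(\<integral>\<^sup>+v. F (real_of_int_vec k + v) \<partial>cellM) = (\<integral>\<^sup>+v. (\<lambda>u. F u * indicator unit_cell (u - real_of_int_vec k)) (real_of_int_vec k + v) \<partial>lborel)"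
      by (subst nn_integral_cellM) simp_all
    also have "\<dots> = (\<integral>\<^sup>+u. F u * indicator unit_cell (u - real_of_int_vec k) \<partial>lborel)"
      by (rule nn_integral_translate) measurable
    also have "\<dots> = (\<integral>\<^sup>+u. F u * indicator {vec_floor u} k \<partial>lborel)"
      by (intro nn_integral_cong arg_cong2[where f="(*)"] refl) (simp add: indicator_def diff_mem_unit_cell_iff)
    finally show "(\<integral>\<^sup>+v. F (real_of_int_vec k + v) \<partial>cellM) = (\<integral>\<^sup>+u. F u * indicator {vec_floor u} k \<partial>lborel)" .
  qed
  also have "\<dots> = (\<integral>\<^sup>+u. \<integral>\<^sup>+k. F u * indicator {vec_floor u} k \<partial>latM \<partial>lborel)"
  proof -
    interpret LL: pair_sigma_finite latM "lborel :: (real^2) measure" ..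
    show ?thesis
    proof (rule LL.Fubini'[symmetric])
      show "(\<lambda>(k, u). F u * indicator {vec_floor u} k) \<in> borel_measurable (latM \<Otimes>\<^sub>M lborel)"
        unfolding latM_def
      proof (rule measurable_pair_measure_countable1)
        fix k :: "int^2"
        have "(\<lambda>u. F u * indicator unit_cell (u - real_of_int_vec k)) \<in> borel_measurable lborel" by measurable
        moreover have "(indicator unit_cell (u - real_of_int_vec k) :: ennreal) = indicator {vec_floor u} k" for u
          by (simp add: indicator_def diff_mem_unit_cell_iff)
        ultimately show "(\<lambda>y. case (k, y) of (k, u) \<Rightarrow> F u * indicator {vec_floor u} k) \<in> borel_measurable lborel" by simp
      qed simp
    qed
  qed
  also have "\<dots> = (\<integral>\<^sup>+u. F u \<partial>lborel)"
  proof (rule nn_integral_cong)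
    fix u :: "real^2"
    have "(\<integral>\<^sup>+k. F u * indicator {vec_floor u} k \<partial>latM) = F u * emeasure latM {vec_floor u}"
      by (rule nn_integral_cmult_indicator) (simp add: latM_def)
    then show "(\<integral>\<^sup>+k. F u * indicator {vec_floor u} k \<partial>latM) = F u" by (simp add: latM_def)
  qed
  finally show ?thesis .
qed

lemma nn_integral_lattice:
  fixes X :: "real^2^2" and F :: "real^2 \<Rightarrow> ennreal"
  assumes d: "det X \<noteq> 0" and [measurable]: "F \<in> borel_measurable borel"
  shows "(\<integral>\<^sup>+x. F x \<partial>lborel) = ennreal \<bar>det X\<bar> * (\<integral>\<^sup>+p. F (X *v (real_of_int_vec (fst p) + snd p)) \<partial>PM)"
  by (subst nn_integral_linear[OF d]) (simp_all add: nn_integral_cells[of "\<lambda>u. F (X *v u)"])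

lemma L2n_nn: "F \<in> borel_measurable M \<Longrightarrow> L2n M F = sqrt (enn2real (\<integral>\<^sup>+x. ennreal ((norm (F x))\<^sup>2) \<partial>M))"
  unfolding L2n_def by (subst integral_eq_nn_integral) auto

lemma in_L2_iff_nn: "in_L2 M F \<longleftrightarrow> F \<in> borel_measurable M \<and> (\<integral>\<^sup>+x. ennreal ((norm (F x))\<^sup>2) \<partial>M) < \<infinity>"
  unfolding in_L2_def integrable_iff_bounded by (auto simp: measurable_compose[where N=borel])

lemma lattice_measurable:
  fixes F :: "real^2 \<Rightarrow> 'b::{real_normed_vector, second_countable_topology}"
  assumes [measurable]: "F \<in> borel_measurable borel"
  shows "(\<lambda>p. F (X *v (real_of_int_vec (fst p) + snd p))) \<in> borel_measurable PM"
  by (rule measurable_PM) simp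

text \<open>Functions on the plane are identified with functions of a lattice point and a position in the unit cell.
The \<open>L\<^sub>2\<close> norm changes by the square root of the cell area only.\<close>

lemma lattice_L2:
  fixes X :: "real^2^2" and F :: "real^2 \<Rightarrow> 'b::{real_normed_vector, second_countable_topology}"
  assumes d: "det X \<noteq> 0" and F[measurable]: "F \<in> borel_measurable borel"
  shows "in_L2 lborel F \<longleftrightarrow> in_L2 PM (\<lambda>p. F (X *v (real_of_int_vec (fst p) + snd p)))"
    and "L2n lborel F = sqrt \<bar>det X\<bar> * L2n PM (\<lambda>p. F (X *v (real_of_int_vec (fst p) + snd p)))"
proof -
  note m = lattice_measurable[OF F, of X]
  have eq: "(\<integral>\<^sup>+x. ennreal ((norm (F x))\<^sup>2) \<partial>lborel) = ennreal \<bar>det X\<bar> * (\<integral>\<^sup>+p. ennreal ((norm (F (X *v (real_of_int_vec (fst p) + snd p))))\<^sup>2) \<partial>PM)"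
    by (rule nn_integral_lattice[OF d]) measurable
  show "in_L2 lborel F \<longleftrightarrow> in_L2 PM (\<lambda>p. F (X *v (real_of_int_vec (fst p) + snd p)))"
    unfolding in_L2_iff_nn eq using m d by (auto simp: ennreal_mult_less_top)
  show "L2n lborel F = sqrt \<bar>det X\<bar> * L2n PM (\<lambda>p. F (X *v (real_of_int_vec (fst p) + snd p)))"
    using m by (simp add: L2n_nn eq enn2real_mult real_sqrt_mult)
qed

section \<open>Bessel's inequality on a lattice\<close>

text \<open>Conjugated characters of the circle, cut off to one period.\<close>

definition box_character :: "int \<Rightarrow> real \<Rightarrow> complex" where
  "box_character n t = indicator {-pi..pi} t *\<^sub>R exp (- (\<i> * complex_of_real (t * of_int n)))"

lemma box_character_integral:
  "integrable lborel (box_character n)" "(\<integral>t. box_character n t \<partial>lborel) = (if n = 0 then complex_of_real (2 * pi) else 0)"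
proof -
  have "has_bochner_integral lborel (box_character n) (if n = 0 then complex_of_real (2 * pi) else 0)"
  proof (cases "n = 0")
    case True
    have "has_bochner_integral lborel (\<lambda>t. indicator {-pi..pi} t *\<^sub>R (1::complex)) (complex_of_real pi - complex_of_real (- pi))"
      by (rule has_bochner_integral_FTC_Icc) (auto intro!: derivative_eq_intros)
    then show ?thesis using True by (simp add: box_character_def[abs_def])
  next
    case False
    let ?F = "\<lambda>t. exp (- (\<i> * complex_of_real (t * of_int n))) / (- (\<i> * of_int n))"
    have "has_bochner_integral lborel (\<lambda>t. indicator {-pi..pi} t *\<^sub>R exp (- (\<i> * complex_of_real (t * of_int n)))) (?F pi - ?F (- pi))"
    proof (rule has_bochner_integral_FTC_Icc)
      fix t :: real
      have 1: "((\<lambda>z. exp (- (\<i> * (z * of_int n))) / (- (\<i> * of_int n))) has_field_derivative exp (- (\<i> * (complex_of_real t * of_int n)))) (at (complex_of_real t) within of_real ` {-pi..pi})"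
        using False by (auto intro!: derivative_eq_intros simp: mult.left_commute[of \<i>])
      have 2: "(complex_of_real has_vector_derivative 1) (at t within {-pi..pi})"
        using has_vector_derivative_of_real[OF DERIV_ident, of "at t within {-pi..pi}"] by simp
      from field_vector_diff_chain_within[OF 2 1]
      show "(?F has_vector_derivative exp (- (\<i> * complex_of_real (t * of_int n)))) (at t within {-pi..pi})"
        by (simp add: o_def)
    qed (auto intro!: continuous_intros)
    moreover have "?F pi = ?F (- pi)"
    proof -
      have "exp (- (\<i> * complex_of_real (pi * of_int n))) = exp (- (\<i> * complex_of_real (- pi * of_int n)))"
      proof -
        have e: "exp (- (\<i> * complex_of_real x)) = cis (- x)" for x by (simp add: cis_conv_exp)
        have "sin (pi * real_of_int n) = 0" by (simp add: mult.commute)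
        then show ?thesis unfolding e by (simp add: complex_eq_iff)
      qed
      then show ?thesis by simp
    qed
    ultimately show ?thesis using False by (simp add: box_character_def[abs_def])
  qed
  then show "integrable lborel (box_character n)" "(\<integral>t. box_character n t \<partial>lborel) = (if n = 0 then complex_of_real (2 * pi) else 0)"
    by (auto simp: has_bochner_integral_iff)
qed

lemma nn_integral_latM_le:
  assumes f: "\<And>k. 0 \<le> f k" and C: "\<And>S. finite S \<Longrightarrow> (\<Sum>k\<in>S. f k) \<le> C"
  shows "(\<integral>\<^sup>+k. ennreal (f k) \<partial>latM) \<le> ennreal C"
proof -
  define S where "S n = {k :: int^2. to_nat k < n}" for n
  have fin: "finite (S n)" for n
    unfolding S_def by (rule finite_imageD[of to_nat]) (auto intro: finite_subset[of _ "{..<n}"] inj_on_subset[OF inj_to_nat])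
  have "(\<integral>\<^sup>+k. ennreal (f k) \<partial>latM) = (\<integral>\<^sup>+k. liminf (\<lambda>n. ennreal (f k) * indicator (S n) k) \<partial>latM)"
  proof (rule nn_integral_cong)
    fix k :: "int^2"
    have "\<forall>\<^sub>F n in sequentially. ennreal (f k) * indicator (S n) k = ennreal (f k)"
      using eventually_gt_at_top[of "to_nat k"] by eventually_elim (simp add: S_def)
    then have "(\<lambda>n. ennreal (f k) * indicator (S n) k) \<longlonglongrightarrow> ennreal (f k)" by (rule tendsto_eventually)
    then show "ennreal (f k) = liminf (\<lambda>n. ennreal (f k) * indicator (S n) k)" using lim_imp_Liminf by force
  qed
  also have "\<dots> \<le> liminf (\<lambda>n. \<integral>\<^sup>+k. ennreal (f k) * indicator (S n) k \<partial>latM)"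
    by (rule nn_integral_liminf) (simp add: latM_def)
  also have "\<dots> \<le> ennreal C"
  proof (rule Liminf_le)
    have "(\<integral>\<^sup>+k. ennreal (f k) * indicator (S n) k \<partial>latM) \<le> ennreal C" for n
    proof -
      have "(\<integral>\<^sup>+k. ennreal (f k) * indicator (S n) k \<partial>latM) = (\<Sum>k\<in>S n. ennreal (f k) * indicator (S n) k)"
        unfolding latM_def by (rule nn_integral_count_space') (use fin in auto)
      also have "\<dots> = ennreal (\<Sum>k\<in>S n. f k)" using f by (simp add: sum_ennreal)
      also have "\<dots> \<le> ennreal C" by (intro ennreal_leI C fin)
      finally show ?thesis .
    qed
    then show "\<forall>\<^sub>F n in sequentially. (\<integral>\<^sup>+k. ennreal (f k) * indicator (S n) k \<partial>latM) \<le> ennreal C" by simp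
  qed simp
  finally show ?thesis .
qed

text \<open>The frequency of \<open>u \<mapsto> exp (i w \<bullet> X u)\<close>.\<close>

definition xi :: "real^2^2 \<Rightarrow> real^2 \<Rightarrow> real^2" where "xi X w = transpose X *v w"

lemma xi_inner: "w \<bullet> (X *v u) = xi X w \<bullet> u"
  by (simp add: xi_def inner_vec2 matrix_vector_mult_def transpose_def sum_2 algebra_simps)

text \<open>If the pulled-back frequencies lie in one period, the samples are the coefficients of \<open>\<psi>\<close> with
respect to the characters \<open>exp (- i w \<bullet> X k)\<close> restricted to that period. These are orthogonal with squared
norm \<open>4 \<pi>\<^sup>2 / \<bar>det X\<bar>\<close>, and Bessel's inequality holds for every finite set of lattice points.\<close>

lemma bessel:
  fixes X :: "real^2^2"
  assumes d: "det X \<noteq> 0" and p: "spectrum_in B \<psi>" and s: "\<And>w i. \<psi> w \<noteq> 0 \<Longrightarrow> \<bar>xi X w $ i\<bar> \<le> pi"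
  shows "in_L2 latM (\<lambda>k. IFT \<psi> (X *v real_of_int_vec k))"
    and "(L2n latM (\<lambda>k. IFT \<psi> (X *v real_of_int_vec k)))\<^sup>2 \<le> 4 * pi\<^sup>2 / \<bar>det X\<bar> * (L2n lborel \<psi>)\<^sup>2"
proof -
  define c where "c k = IFT \<psi> (X *v real_of_int_vec k)" for k
  \<comment> \<open>The substitution that takes the dual lattice cell to the square of side length twice pi.\<close>
  define Y where "Y = matrix_inv (transpose X)"
  have dT: "det (transpose X) \<noteq> 0" using d by (simp add: det_transpose)
  have XY: "xi X (Y *v z) = z" for z
    using matrix_inv_mult(1)[OF dT] by (simp add: xi_def Y_def matrix_vector_mul_assoc)
  have "det (transpose X ** Y) = 1" using matrix_inv_mult(1)[OF dT] by (simp add: Y_def)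
  then have dY: "det Y = 1 / det X" using d by (simp add: det_mul det_transpose field_simps)
  then have dY0: "det Y \<noteq> 0" using d by simp
  have xiY: "xi X w $ i = (transpose X *v w) $ i" for w i by (simp add: xi_def)
  have [measurable]: "(\<lambda>w. xi X w) \<in> borel_measurable borel"
    unfolding xi_def by (rule matrix_vector_borel_measurable)
  define E where "E k w = box_character (k$1) (xi X w $ 1) * box_character (k$2) (xi X w $ 2)" for k :: "int^2" and w
  have [measurable]: "box_character n \<in> borel_measurable borel" for n using box_character_integral(1)[of n] by auto
  have [measurable]: "E k \<in> borel_measurable borel" for k unfolding E_def by measurable
  have EE: "E k (Y *v z) * cnj (E l (Y *v z)) = box_character (k$1 - l$1) (z$1) * box_character (k$2 - l$2) (z$2)" for k l z
  proof -
    have b: "box_character m t * cnj (box_character n t) = box_character (m - n) t" for m n t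
      by (simp add: box_character_def indicator_def exp_cnj exp_add[symmetric] exp_diff[symmetric] algebra_simps)
    have "E k (Y *v z) * cnj (E l (Y *v z)) = (box_character (k$1) (z$1) * cnj (box_character (l$1) (z$1))) * (box_character (k$2) (z$2) * cnj (box_character (l$2) (z$2)))"
      unfolding E_def XY by (simp only: complex_cnj_mult mult_ac)
    then show ?thesis unfolding b .
  qed
  note PI = has_bochner_integral_real2_prod[OF box_character_integral(1) box_character_integral(1)]
  have orth: "(\<integral>w. E k w * cnj (E l w) \<partial>lborel) = (if k = l then complex_of_real (4 * pi\<^sup>2 / \<bar>det X\<bar>) else 0)" for k l
  proof -
    have "(\<integral>w. E k w * cnj (E l w) \<partial>lborel) = \<bar>det Y\<bar> *\<^sub>R (\<integral>z. E k (Y *v z) * cnj (E l (Y *v z)) \<partial>lborel)"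
      by (rule integral_linear[OF dY0]) measurable
    also have "(\<integral>z. E k (Y *v z) * cnj (E l (Y *v z)) \<partial>lborel) = (if k = l then complex_of_real (4 * pi\<^sup>2) else 0)"
      unfolding EE PI(2) box_character_integral(2) by (auto simp: vec_eq_iff forall_2 power2_eq_square)
    finally show ?thesis by (simp add: dY scaleR_conv_of_real)
  qed
  have E1: "in_L2 lborel (E k)" for k
  proof -
    have "integrable lborel (\<lambda>z. E k (Y *v z) * cnj (E k (Y *v z)))" unfolding EE by (rule PI(1))
    then have i: "integrable lborel (\<lambda>z. (cmod (E k (Y *v z)))\<^sup>2)"
      unfolding complex_norm_square[symmetric] complex_of_real_integrable_eq .
    have "(\<integral>\<^sup>+w. ennreal ((cmod (E k w))\<^sup>2) \<partial>lborel) = ennreal \<bar>det Y\<bar> * (\<integral>\<^sup>+z. ennreal ((cmod (E k (Y *v z)))\<^sup>2) \<partial>lborel)"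
      by (rule nn_integral_linear[OF dY0]) measurable
    also have "\<dots> < \<infinity>" using i by (auto simp: integrable_iff_bounded ennreal_mult_less_top)
    finally show ?thesis unfolding in_L2_iff_nn by auto
  qed
  have sum: "(\<Sum>k\<in>S. (cmod (c k))\<^sup>2) \<le> 4 * pi\<^sup>2 / \<bar>det X\<bar> * (L2n lborel \<psi>)\<^sup>2" if S: "finite S" for S
  proof -
    define N where "N = (\<Sum>k\<in>S. (cmod (c k))\<^sup>2)"
    have N0: "0 \<le> N" by (simp add: N_def sum_nonneg)
    define F where "F w = (\<Sum>k\<in>S. c k * E k w)" for w
    have FL: "in_L2 lborel F" unfolding F_def by (intro in_L2_sum in_L2_cmult E1)
    have cL: "in_L2 lborel (\<lambda>w. cnj (E k w))" for k by (intro in_L2_cnj E1)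
    have "complex_of_real ((L2n lborel F)\<^sup>2) = (\<integral>w. F w * cnj (F w) \<partial>lborel)"
      unfolding L2n_sq integral_complex_of_real[symmetric] complex_norm_square ..
    also have "\<dots> = (\<integral>w. (\<Sum>k\<in>S. \<Sum>l\<in>S. c k * cnj (c l) * (E k w * cnj (E l w))) \<partial>lborel)"
      unfolding F_def cnj_sum sum_product by (intro Bochner_Integration.integral_cong sum.cong refl) simp
    also have "\<dots> = (\<Sum>k\<in>S. \<Sum>l\<in>S. c k * cnj (c l) * (\<integral>w. E k w * cnj (E l w) \<partial>lborel))"
      using L2_mult_integrable(1)[OF E1 cL] by (simp add: Bochner_Integration.integral_sum)
    also have "\<dots> = (\<Sum>k\<in>S. c k * cnj (c k) * complex_of_real (4 * pi\<^sup>2 / \<bar>det X\<bar>))"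
      unfolding orth by (intro sum.cong refl) (simp add: if_distrib sum.delta S cong: if_cong)
    also have "\<dots> = complex_of_real (N * (4 * pi\<^sup>2 / \<bar>det X\<bar>))"
      unfolding N_def of_real_mult of_real_sum complex_norm_square sum_distrib_right ..
    finally have NF: "(L2n lborel F)\<^sup>2 = N * (4 * pi\<^sup>2 / \<bar>det X\<bar>)" unfolding of_real_eq_iff .
    have "complex_of_real N = (\<Sum>k\<in>S. cnj (c k) * c k)"
      unfolding N_def of_real_sum complex_norm_square by (simp only: mult.commute)
    also have "\<dots> = (\<Sum>k\<in>S. cnj (c k) * (\<integral>w. \<psi> w * cnj (E k w) \<partial>lborel))"
    proof (intro sum.cong refl arg_cong2[where f="(*)"])
      fix k
      show "c k = (\<integral>w. \<psi> w * cnj (E k w) \<partial>lborel)"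
        unfolding c_def IFT_def
      proof (intro Bochner_Integration.integral_cong refl)
        fix w
        show "\<psi> w * exp (\<i> * complex_of_real (w \<bullet> (X *v real_of_int_vec k))) = \<psi> w * cnj (E k w)"
        proof (cases "\<psi> w = 0")
          case False
          then have "\<bar>xi X w $ 1\<bar> \<le> pi" "\<bar>xi X w $ 2\<bar> \<le> pi" using s by auto
          then have "xi X w $ 1 \<in> {-pi..pi}" "xi X w $ 2 \<in> {-pi..pi}" by auto
          then show ?thesis
            unfolding xi_inner inner_vec2[of "xi X w"] by (simp add: E_def box_character_def exp_cnj exp_add[symmetric] algebra_simps)
        qed simp
      qed
    qed
    also have "\<dots> = (\<integral>w. (\<Sum>k\<in>S. cnj (c k) * (\<psi> w * cnj (E k w))) \<partial>lborel)"
      using L2_mult_integrable(1)[OF spectrum_in_L2[OF p] cL] by (simp add: Bochner_Integration.integral_sum)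
    also have "\<dots> = (\<integral>w. \<psi> w * cnj (F w) \<partial>lborel)"
      unfolding F_def cnj_sum sum_distrib_left complex_cnj_mult by (simp only: mult.left_commute)
    finally have "cmod (complex_of_real N) \<le> L2n lborel \<psi> * L2n lborel (\<lambda>w. cnj (F w))"
      using L2_mult_integrable(2)[OF spectrum_in_L2[OF p] in_L2_cnj[OF FL]] by simp
    then have "N \<le> L2n lborel \<psi> * L2n lborel F" using N0 by (simp add: L2n_def)
    then have "N\<^sup>2 \<le> (L2n lborel \<psi> * L2n lborel F)\<^sup>2" using N0 by (rule power_mono)
    then have "N * N \<le> N * (4 * pi\<^sup>2 / \<bar>det X\<bar> * (L2n lborel \<psi>)\<^sup>2)"
      unfolding power_mult_distrib NF by (simp add: power2_eq_square mult_ac)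
    then show ?thesis unfolding N_def[symmetric] using N0 d
      by (cases "N = 0") (auto intro: mult_left_le_imp_le)
  qed
  have b: "(\<integral>\<^sup>+k. ennreal ((cmod (c k))\<^sup>2) \<partial>latM) \<le> ennreal (4 * pi\<^sup>2 / \<bar>det X\<bar> * (L2n lborel \<psi>)\<^sup>2)"
    by (rule nn_integral_latM_le[OF _ sum]) auto
  have m: "c \<in> borel_measurable latM" by (simp add: latM_def)
  show "in_L2 latM (\<lambda>k. IFT \<psi> (X *v real_of_int_vec k))"
    "(L2n latM (\<lambda>k. IFT \<psi> (X *v real_of_int_vec k)))\<^sup>2 \<le> 4 * pi\<^sup>2 / \<bar>det X\<bar> * (L2n lborel \<psi>)\<^sup>2"
    using in_L2I_nn[OF m b] unfolding c_def by auto
qed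

section \<open>Linear splines on a cell\<close>

lemma bij_add_int: "bij ((+) (j :: int^2))"
  by (rule o_bij[of "(+) (- j)"]) (auto simp: fun_eq_iff)

lemma latM_shift:
  fixes c :: "int^2 \<Rightarrow> real"
  shows "in_L2 latM c \<Longrightarrow> in_L2 latM (\<lambda>k. c (j + k))" "L2n latM (\<lambda>k. c (j + k)) = L2n latM c"
    "(\<integral>k. c (j + k) \<partial>latM) = (\<integral>k. c k \<partial>latM)"
proof -
  have nn: "(\<integral>\<^sup>+k. f (j + k) \<partial>latM) = (\<integral>\<^sup>+k. f k \<partial>latM)" for f :: "int^2 \<Rightarrow> ennreal"
    unfolding latM_def by (rule nn_integral_bij_count_space) (rule bij_add_int)
  have m: "g \<in> borel_measurable latM" for g :: "int^2 \<Rightarrow> real" by (simp add: latM_def)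
  show "in_L2 latM (\<lambda>k. c (j + k))" if "in_L2 latM c"
    using that m unfolding in_L2_iff_nn by (simp add: nn[of "\<lambda>k. ennreal ((c k)\<^sup>2)"])
  show "L2n latM (\<lambda>k. c (j + k)) = L2n latM c"
    by (simp add: L2n_nn m nn[of "\<lambda>k. ennreal ((c k)\<^sup>2)"])
  show "(\<integral>k. c (j + k) \<partial>latM) = (\<integral>k. c k \<partial>latM)"
    unfolding latM_def by (rule integral_bij_count_space) (rule bij_add_int)
qed

lemma in_L2_latM_iff: "in_L2 latM (c :: int^2 \<Rightarrow> real) \<longleftrightarrow> (\<lambda>k. (c k)\<^sup>2) summable_on UNIV"
proof -
  have "(\<lambda>k. (c k)\<^sup>2) summable_on UNIV \<longleftrightarrow> integrable latM (\<lambda>k. (c k)\<^sup>2)"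
    by (subst summable_on_iff_abs_summable_on_real) (simp only: abs_summable_equivalent abs_summable_on_def latM_def)
  then show ?thesis by (simp add: in_L2_def latM_def)
qed

text \<open>The integer translates of the box spline that do not vanish identically on the unit cell.\<close>

definition corners :: "(int^2) set" where
  "corners = {vector [0, 0], vector [1, 0], vector [0, 1], vector [1, 1]}"

definition hat :: "int^2 \<Rightarrow> real^2 \<Rightarrow> real" where "hat i v = box_spline (v - real_of_int_vec i)"

lemma finite_corners [simp]: "finite corners" by (simp add: corners_def)

lemma sum_corners: "(\<Sum>i\<in>corners. f i) = f (vector [0, 0]) + f (vector [1, 0]) + f (vector [0, 1]) + f (vector [1, 1])"
  by (simp add: corners_def vec_eq_iff forall_2 add.assoc)

lemma unit_cellD: "v \<in> unit_cell \<Longrightarrow> 0 \<le> v$1" "v \<in> unit_cell \<Longrightarrow> v$1 < 1" "v \<in> unit_cell \<Longrightarrow> 0 \<le> v$2" "v \<in> unit_cell \<Longrightarrow> v$2 < 1"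
  by (auto simp: unit_cell_def)

text \<open>The four shape functions of the cell: barycentric coordinates on the two triangles separated by the
diagonal \<open>v\<^sub>1 = v\<^sub>2\<close>.\<close>

lemma hat_cell:
  assumes "v \<in> unit_cell"
  shows "hat (vector [0, 0]) v = 1 - max (v$1) (v$2)" "hat (vector [1, 0]) v = max (v$1 - v$2) 0"
    "hat (vector [0, 1]) v = max (v$2 - v$1) 0" "hat (vector [1, 1]) v = min (v$1) (v$2)"
  using unit_cellD[OF assms] by (auto simp: hat_def box_spline_def max_def min_def)

lemma hat_outside:
  assumes "v \<in> unit_cell" "i \<notin> corners" shows "hat i v = 0"
proof (rule ccontr)
  assume "hat i v \<noteq> 0"
  then have "1 + min (v$1 - i$1) (min (v$2 - i$2) 0) - max (v$1 - i$1) (max (v$2 - i$2) 0) > 0"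
    by (auto simp: hat_def box_spline_def max_def split: if_splits)
  then have "\<bar>v$1 - i$1\<bar> < 1" "\<bar>v$2 - i$2\<bar> < 1" by (auto simp: max_def min_def split: if_splits)
  then have "i$1 = 0 \<or> i$1 = 1" "i$2 = 0 \<or> i$2 = 1" using unit_cellD[OF assms(1)] by linarith+
  then have "i \<in> corners" by (auto simp: corners_def vec_eq_iff forall_2)
  then show False using assms(2) by simp
qed

lemma hat_sums:
  assumes "v \<in> unit_cell"
  shows "(\<Sum>i\<in>corners. hat i v) = 1"
    "(\<Sum>i\<in>corners. hat i v * of_int (i$1)) = v$1" "(\<Sum>i\<in>corners. hat i v * of_int (i$2)) = v$2"
  using unit_cellD[OF assms] by (simp_all add: sum_corners hat_cell[OF assms] max_def min_def)

lemma hat_bounds: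
  assumes "v \<in> unit_cell" "i \<in> corners"
  shows "0 \<le> hat i v" "hat i v \<le> 1" "\<bar>hat i v\<bar> \<le> 1"
proof -
  have "0 \<le> hat i v \<and> hat i v \<le> 1"
    using unit_cellD[OF assms(1)] assms(2) by (auto simp: hat_cell[OF assms(1)] corners_def max_def min_def)
  then show "0 \<le> hat i v" "hat i v \<le> 1" "\<bar>hat i v\<bar> \<le> 1" by auto
qed

lemma hat_measurable [measurable]: "hat i \<in> borel_measurable borel"
  unfolding hat_def box_spline_def by (intro borel_measurable_continuous_onI continuous_intros)

text \<open>The spline with coefficients \<open>c\<close> on the cell with lower left corner \<open>k\<close>, in cell coordinates.\<close>

definition cpwl :: "(int^2 \<Rightarrow> real) \<Rightarrow> int^2 \<Rightarrow> real^2 \<Rightarrow> real" where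
  "cpwl c k v = (\<Sum>i\<in>corners. hat i v * c (i + k))"

lemma cpwl_value:
  fixes X :: "real^2^2"
  assumes d: "det X \<noteq> 0" and v: "v \<in> unit_cell"
  shows "(\<Sum>\<^sub>\<infinity>k\<in>UNIV. c k * box_spline (matrix_inv X *v (X *v (real_of_int_vec k0 + v)) - real_of_int_vec k)) = cpwl c k0 v"
proof -
  have e: "matrix_inv X *v (X *v u) = u" for u using matrix_inv_mult(2)[OF d] by (simp add: matrix_vector_mul_assoc)
  have h: "box_spline (matrix_inv X *v (X *v (real_of_int_vec k0 + v)) - real_of_int_vec k) = hat (k - k0) v" for k
    unfolding e hat_def by (rule arg_cong[where f=box_spline]) (simp add: vec_eq_iff)
  have "(\<Sum>\<^sub>\<infinity>k\<in>UNIV. c k * hat (k - k0) v) = (\<Sum>\<^sub>\<infinity>k\<in>(\<lambda>i. i + k0) ` corners. c k * hat (k - k0) v)"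
  proof (rule infsum_cong_neutral)
    fix k assume "k \<in> UNIV - (\<lambda>i. i + k0) ` corners"
    then have "k - k0 \<notin> corners" by (auto simp: image_iff)
    then show "c k * hat (k - k0) v = 0" using hat_outside[OF v] by simp
  qed auto
  also have "\<dots> = (\<Sum>k\<in>(\<lambda>i. i + k0) ` corners. c k * hat (k - k0) v)" by (rule infsum_finite) simp
  also have "\<dots> = cpwl c k0 v"
    unfolding cpwl_def by (subst sum.reindex) (auto simp: inj_on_def mult.commute)
  finally show ?thesis unfolding h .
qed

definition spline :: "real^2^2 \<Rightarrow> (int^2 \<Rightarrow> real) \<Rightarrow> real^2 \<Rightarrow> real" where
  "spline X c = (\<lambda>x. \<Sum>\<^sub>\<infinity>k\<in>UNIV. c k * box_spline (matrix_inv X *v x - real_of_int_vec k))"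

lemma cpwl_space_spline: "cpwl_space X = spline X ` {c. in_L2 latM c}"
  by (auto simp: cpwl_space_def spline_def in_L2_latM_iff)

lemma spline_cell: "det X \<noteq> 0 \<Longrightarrow> v \<in> unit_cell \<Longrightarrow> spline X c (X *v (real_of_int_vec k + v)) = cpwl c k v"
  unfolding spline_def by (rule cpwl_value)

lemma vec_floor_measurable: "vec_floor \<in> measurable borel (count_space UNIV)"
proof (subst measurable_count_space_eq_countable)
  show "countable (UNIV :: (int^2) set)" by simp
  show "vec_floor \<in> space borel \<rightarrow> UNIV \<and> (\<forall>a\<in>UNIV. vec_floor -` {a} \<inter> space borel \<in> sets borel)"
  proof (intro conjI ballI)
    fix a :: "int^2"
    have "vec_floor -` {a} \<inter> space borel = {u \<in> space borel. u - real_of_int_vec a \<in> unit_cell}"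
      by (auto simp: diff_mem_unit_cell_iff)
    also have "\<dots> \<in> sets borel" by measurable
    finally show "vec_floor -` {a} \<inter> space borel \<in> sets borel" .
  qed simp
qed

lemma spline_measurable [measurable]:
  assumes d: "det X \<noteq> 0" shows "spline X c \<in> borel_measurable borel"
proof -
  have XI: "X *v (matrix_inv X *v x) = x" for x
    using matrix_inv_mult(1)[OF d] by (simp add: matrix_vector_mul_assoc)
  have e: "spline X c = (\<lambda>x. cpwl c (vec_floor (matrix_inv X *v x)) (matrix_inv X *v x - real_of_int_vec (vec_floor (matrix_inv X *v x))))"
  proof
    fix x
    let ?u = "matrix_inv X *v x"
    have "?u - real_of_int_vec (vec_floor ?u) \<in> unit_cell" by (simp add: diff_mem_unit_cell_iff)
    from spline_cell[OF d this, of c "vec_floor ?u"]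
    show "spline X c x = cpwl c (vec_floor ?u) (?u - real_of_int_vec (vec_floor ?u))" by (simp add: XI)
  qed
  have "(\<lambda>x. (\<lambda>k x. cpwl c k (matrix_inv X *v x - real_of_int_vec k)) (vec_floor (matrix_inv X *v x)) x) \<in> borel_measurable borel"
  proof (rule measurable_compose_countable)
    show "(\<lambda>x. cpwl c k (matrix_inv X *v x - real_of_int_vec k)) \<in> borel_measurable borel" for k
      unfolding cpwl_def by measurable
    show "(\<lambda>x. vec_floor (matrix_inv X *v x)) \<in> measurable borel (count_space UNIV)"
      by (rule measurable_compose[OF matrix_vector_borel_measurable vec_floor_measurable])
  qed
  then show ?thesis unfolding e .
qed

lemma cpwl_measurable: "(\<lambda>p. cpwl c (fst p) (snd p)) \<in> borel_measurable PM"
  by (rule measurable_PM) (simp add: cpwl_def)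

lemma spline_PM:
  assumes "det X \<noteq> 0" "p \<in> space PM"
  shows "spline X c (X *v (real_of_int_vec (fst p) + snd p)) = cpwl c (fst p) (snd p)"
  using assms spline_cell by auto

lemma PM_tensor:
  fixes a :: "int^2 \<Rightarrow> real" and b :: "real^2 \<Rightarrow> real"
  assumes a: "integrable latM a" and b: "integrable cellM b"
  shows "integrable PM (\<lambda>p. a (fst p) * b (snd p))" "(\<integral>p. a (fst p) * b (snd p) \<partial>PM) = (\<integral>k. a k \<partial>latM) * (\<integral>v. b v \<partial>cellM)"
proof -
  have [measurable]: "a \<in> borel_measurable latM" "b \<in> borel_measurable cellM" using a b by auto
  show I: "integrable PM (\<lambda>p. a (fst p) * b (snd p))"
    unfolding PM_def
  proof (rule PM.Fubini_integrable)
    show "integrable latM (\<lambda>x. \<integral>y. norm (a (fst (x, y)) * b (snd (x, y))) \<partial>cellM)" using a by (simp add: abs_mult)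
    show "AE x in latM. integrable cellM (\<lambda>y. a (fst (x, y)) * b (snd (x, y)))" using b by simp
  qed measurable
  have "(\<integral>p. a (fst p) * b (snd p) \<partial>PM) = (\<integral>k. \<integral>v. a k * b v \<partial>cellM \<partial>latM)"
    using PM.integral_fst'[OF I[unfolded PM_def]] by (simp add: PM_def)
  then show "(\<integral>p. a (fst p) * b (snd p) \<partial>PM) = (\<integral>k. a k \<partial>latM) * (\<integral>v. b v \<partial>cellM)" by simp
qed

lemma cellM_bounded_integrable:
  fixes b :: "real^2 \<Rightarrow> real"
  assumes "b \<in> borel_measurable borel" "\<And>v. v \<in> unit_cell \<Longrightarrow> \<bar>b v\<bar> \<le> B"
  shows "integrable cellM b"
  by (rule cellM.integrable_const_bound[of _ B]) (use assms in \<open>auto intro: AE_I2 measurable_cellM\<close>)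

lemma in_L2_tensor:
  fixes a :: "int^2 \<Rightarrow> real" and b :: "real^2 \<Rightarrow> real"
  assumes a: "in_L2 latM a" and b: "b \<in> borel_measurable borel" "\<And>v. v \<in> unit_cell \<Longrightarrow> \<bar>b v\<bar> \<le> B"
  shows "in_L2 PM (\<lambda>p. a (fst p) * b (snd p))"
proof -
  note [measurable] = b(1)
  have "integrable cellM (\<lambda>v. (b v)\<^sup>2)"
  proof (rule cellM_bounded_integrable)
    show "\<bar>(b v)\<^sup>2\<bar> \<le> B\<^sup>2" if "v \<in> unit_cell" for v using power_mono[OF b(2)[OF that], of 2] by simp
  qed measurable
  from PM_tensor(1)[OF _ this, of "\<lambda>k. (a k)\<^sup>2"] show ?thesis
    using a by (auto simp: in_L2_def power_mult_distrib intro!: measurable_PM)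
qed

lemma cpwl_L2:
  assumes c: "in_L2 latM c" shows "in_L2 PM (\<lambda>p. cpwl c (fst p) (snd p))"
proof -
  have "in_L2 PM (\<lambda>p. c (i + fst p) * hat i (snd p))" if "i \<in> corners" for i
    by (rule in_L2_tensor[where B=1, OF latM_shift(1)[OF c]]) (use hat_bounds(3) that in auto)
  then show ?thesis unfolding cpwl_def by (intro in_L2_sum) (simp add: mult.commute)
qed

lemma ennreal_lin2:
  assumes "0 \<le> a" "0 \<le> b" "0 \<le> x" "0 \<le> y"
  shows "ennreal a * ennreal x + ennreal b * ennreal y = ennreal (a * x + b * y)"
  using assms by (simp only: ennreal_mult[symmetric] ennreal_plus[symmetric] mult_nonneg_nonneg)

text \<open>On the triangle \<open>v\<^sub>2 \<le> v\<^sub>1\<close> the spline is affine, so its value at the corner is extrapolated from the values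
at \<open>v\<close> and \<open>2 v\<close>. Integration over a small box of such points \<open>v\<close> bounds the coefficient by the norm on
a single cell.\<close>

lemma cpwl_coeff_bound:
  fixes c :: "int^2 \<Rightarrow> real"
  shows "ennreal ((c k)\<^sup>2) \<le> ennreal 136 * (\<integral>\<^sup>+v. ennreal ((cpwl c k v)\<^sup>2) \<partial>cellM)"
proof -
  \<comment> \<open>For v in this box both v and 2 v lie in the cell, below the diagonal.\<close>
  define P where "P = box (vector [1/4, 0] :: real^2) (vector [1/2, 1/4])"
  have P: "v \<in> P \<longleftrightarrow> 1/4 < v$1 \<and> v$1 < 1/2 \<and> 0 < v$2 \<and> v$2 < 1/4" for v
    by (auto simp: P_def mem_box Basis_vec_def inner_axis forall_2 UNIV_2)
  have [measurable]: "P \<in> sets borel" by (simp add: P_def)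
  have [measurable]: "cpwl c k \<in> borel_measurable borel" unfolding cpwl_def by measurable
  let ?I = "\<integral>\<^sup>+v. ennreal ((cpwl c k v)\<^sup>2) * indicator unit_cell v \<partial>lborel"
  have eP: "emeasure lborel P = ennreal (1/16)"
  proof -
    have B: "(Basis :: (real^2) set) = {axis 1 1, axis 2 1}" by (auto simp: Basis_vec_def UNIV_2)
    have ne: "axis 1 1 \<noteq> (axis 2 1 :: real^2)" by (simp add: axis_eq_axis)
    show ?thesis unfolding P_def by (subst emeasure_lborel_box) (auto simp: B ne inner_axis)
  qed
  have key: "(c k)\<^sup>2 \<le> 8 * (cpwl c k v)\<^sup>2 + 2 * (cpwl c k (2 *\<^sub>R v))\<^sup>2" if "v \<in> P" for v
  proof -
    have i: "v \<in> unit_cell" "2 *\<^sub>R v \<in> unit_cell" using that by (auto simp: P unit_cell_def forall_2)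
    have k0: "vector [0, 0] + k = k" "k + vector [0, 0] = k" by (simp_all add: vec_eq_iff forall_2)
    have "c k = 2 * cpwl c k v - cpwl c k (2 *\<^sub>R v)"
      using that by (simp add: cpwl_def sum_corners hat_cell[OF i(1)] hat_cell[OF i(2)] P k0 max_def min_def algebra_simps)
    then have "(c k)\<^sup>2 = (2 * cpwl c k v - cpwl c k (2 *\<^sub>R v))\<^sup>2" by simp
    also have "\<dots> \<le> 2 * (2 * cpwl c k v)\<^sup>2 + 2 * (cpwl c k (2 *\<^sub>R v))\<^sup>2"
      using zero_le_power2[of "2 * cpwl c k v + cpwl c k (2 *\<^sub>R v)"] by (simp add: power2_sum power2_diff)
    finally show ?thesis by (simp add: power_mult_distrib)
  qed
  have dm: "det (mat 2 :: real^2^2) \<noteq> 0" "det (mat 2 :: real^2^2) = 4" by (simp_all add: det_2 mat_def)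
  have mv: "(mat 2 :: real^2^2) *v v = 2 *\<^sub>R v" for v
    by (simp add: vec_eq_iff forall_2 matrix_vector_mult_def mat_def sum_2)
  have "ennreal ((c k)\<^sup>2) * ennreal (1/16) = (\<integral>\<^sup>+v. ennreal ((c k)\<^sup>2) * indicator P v \<partial>lborel)"
    by (simp add: eP nn_integral_cmult_indicator)
  also have "\<dots> \<le> (\<integral>\<^sup>+v. ennreal 8 * (ennreal ((cpwl c k v)\<^sup>2) * indicator unit_cell v) + ennreal 2 * (ennreal ((cpwl c k (2 *\<^sub>R v))\<^sup>2) * indicator unit_cell (2 *\<^sub>R v)) \<partial>lborel)"
  proof (rule nn_integral_mono)
    fix v
    show "ennreal ((c k)\<^sup>2) * indicator P v \<le> ennreal 8 * (ennreal ((cpwl c k v)\<^sup>2) * indicator unit_cell v) + ennreal 2 * (ennreal ((cpwl c k (2 *\<^sub>R v))\<^sup>2) * indicator unit_cell (2 *\<^sub>R v))"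
    proof (cases "v \<in> P")
      case True
      have i: "v \<in> unit_cell" "2 *\<^sub>R v \<in> unit_cell" using True by (auto simp: P unit_cell_def forall_2)
      have "ennreal ((c k)\<^sup>2) \<le> ennreal (8 * (cpwl c k v)\<^sup>2 + 2 * (cpwl c k (2 *\<^sub>R v))\<^sup>2)"
        by (rule ennreal_leI[OF key[OF True]])
      also have "\<dots> = ennreal 8 * ennreal ((cpwl c k v)\<^sup>2) + ennreal 2 * ennreal ((cpwl c k (2 *\<^sub>R v))\<^sup>2)"
        by (rule ennreal_lin2[symmetric]) auto
      finally show ?thesis using i True by (simp only: indicator_simps mult_1_right)
    qed simp
  qed
  also have "\<dots> = ennreal 8 * ?I + ennreal 2 * (\<integral>\<^sup>+v. ennreal ((cpwl c k (2 *\<^sub>R v))\<^sup>2) * indicator unit_cell (2 *\<^sub>R v) \<partial>lborel)"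
    by (subst nn_integral_add) (simp_all add: nn_integral_cmult)
  also have "\<dots> \<le> ennreal 8 * ?I + ennreal (1/2) * ?I"
  proof -
    have "?I = ennreal 4 * (\<integral>\<^sup>+v. ennreal ((cpwl c k (2 *\<^sub>R v))\<^sup>2) * indicator unit_cell (2 *\<^sub>R v) \<partial>lborel)"
      using nn_integral_linear[OF dm(1), of "\<lambda>v. ennreal ((cpwl c k v)\<^sup>2) * indicator unit_cell v"] by (simp add: mv dm(2))
    then have "ennreal (1/2) * ?I = (ennreal (1/2) * ennreal 4) * (\<integral>\<^sup>+v. ennreal ((cpwl c k (2 *\<^sub>R v))\<^sup>2) * indicator unit_cell (2 *\<^sub>R v) \<partial>lborel)"
      by (simp only: mult.assoc)
    also have "ennreal (1/2) * ennreal 4 = ennreal 2" by (subst ennreal_mult[symmetric]) simp_all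
    finally show ?thesis by simp
  qed
  also have "\<dots> = ennreal (17/2) * ?I"
    unfolding distrib_right[symmetric] by (subst ennreal_plus[symmetric]) simp_all
  \<comment> \<open>The box has area 1/16, and the substitution of 2 v for v gains a factor 1/4, so the two
    terms contribute 8 and 1/2; the final constant is 16 * (8 + 1/2).\<close>
  finally have a: "ennreal ((c k)\<^sup>2) * ennreal (1/16) \<le> ennreal (17/2) * ?I" .
  have "ennreal ((c k)\<^sup>2) = ennreal 16 * (ennreal ((c k)\<^sup>2) * ennreal (1/16))"
    by (subst ennreal_mult[symmetric], simp, simp, subst ennreal_mult[symmetric]) simp_all
  also have "\<dots> \<le> ennreal 16 * (ennreal (17/2) * ?I)" by (intro mult_left_mono a) simp
  also have "\<dots> = ennreal 136 * ?I" unfolding mult.assoc[symmetric] by (subst ennreal_mult[symmetric]) simp_all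
  also have "?I = (\<integral>\<^sup>+v. ennreal ((cpwl c k v)\<^sup>2) \<partial>cellM)" by (rule nn_integral_cellM[symmetric]) measurable
  finally show ?thesis .
qed

text \<open>The lower Riesz bound. It holds cell by cell, since every coefficient is controlled by one cell.\<close>

lemma cpwl_riesz:
  assumes V: "in_L2 PM (\<lambda>p. cpwl c (fst p) (snd p))"
  shows "in_L2 latM c" "(L2n latM c)\<^sup>2 \<le> 136 * (L2n PM (\<lambda>p. cpwl c (fst p) (snd p)))\<^sup>2"
proof -
  have m: "(\<lambda>p. ennreal ((cpwl c (fst p) (snd p))\<^sup>2)) \<in> borel_measurable PM"
    using cpwl_measurable[of c] by measurable
  have "(\<integral>\<^sup>+k. ennreal ((norm (c k))\<^sup>2) \<partial>latM) \<le> (\<integral>\<^sup>+k. ennreal 136 * (\<integral>\<^sup>+v. ennreal ((cpwl c k v)\<^sup>2) \<partial>cellM) \<partial>latM)"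
    unfolding real_norm_def power2_abs by (rule nn_integral_mono) (rule cpwl_coeff_bound)
  also have "\<dots> = ennreal 136 * (\<integral>\<^sup>+k. \<integral>\<^sup>+v. ennreal ((cpwl c k v)\<^sup>2) \<partial>cellM \<partial>latM)"
    by (rule nn_integral_cmult) (simp add: latM_def)
  also have "\<dots> = ennreal 136 * (\<integral>\<^sup>+p. ennreal ((norm (cpwl c (fst p) (snd p)))\<^sup>2) \<partial>PM)"
    using nn_integral_PM(1)[OF m] by simp
  also have "\<dots> = ennreal (136 * (L2n PM (\<lambda>p. cpwl c (fst p) (snd p)))\<^sup>2)"
    by (simp only: L2_nn_integral[OF V]) (simp add: ennreal_mult)
  finally have b: "(\<integral>\<^sup>+k. ennreal ((norm (c k))\<^sup>2) \<partial>latM) \<le> ennreal (136 * (L2n PM (\<lambda>p. cpwl c (fst p) (snd p)))\<^sup>2)" .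
  have "c \<in> borel_measurable latM" by (simp add: latM_def)
  from in_L2I_nn[OF this b] show "in_L2 latM c" "(L2n latM c)\<^sup>2 \<le> 136 * (L2n PM (\<lambda>p. cpwl c (fst p) (snd p)))\<^sup>2" by auto
qed

section \<open>The periodic part of the residual\<close>

text \<open>Half the second Bernoulli polynomial \<open>x\<^sup>2 - x + 1/6\<close>.\<close>

definition half_bernoulli :: "real \<Rightarrow> real" where "half_bernoulli x = (x\<^sup>2 - x + 1/6) / 2"

text \<open>The integral is split at \<open>a\<close>, where the absolute value changes sign.\<close>

lemma fold_integral:
  fixes p S :: "real \<Rightarrow> real"
  assumes S: "\<And>x. (S has_real_derivative p x) (at x)" and p: "continuous_on UNIV p" and a: "0 \<le> a" "a \<le> 1"
  shows "(\<integral>b. indicator {0..<1} b * p \<bar>a - b\<bar> \<partial>lborel) = S a + S (1 - a) - 2 * S 0"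
proof -
  have pc: "continuous_on A (\<lambda>x. p (f x))" if "continuous_on A f" for A and f :: "real \<Rightarrow> real"
    by (rule continuous_on_compose2[OF p that]) auto
  have 1: "has_bochner_integral lborel (\<lambda>b. indicator {0..a} b *\<^sub>R p (a - b)) (- S (a - a) - - S (a - 0))"
  proof (rule has_bochner_integral_FTC_Icc[OF a(1)])
    fix x :: real
    have g: "((\<lambda>b. a - b) has_real_derivative -1) (at x within {0..a})" by (auto intro!: derivative_eq_intros)
    have "((\<lambda>b. - S (a - b)) has_real_derivative p (a - x)) (at x within {0..a})"
      using DERIV_minus[OF DERIV_chain2[OF S g]] by simp
    then show "((\<lambda>b. - S (a - b)) has_vector_derivative p (a - x)) (at x within {0..a})"
      by (simp add: has_real_derivative_iff_has_vector_derivative)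
  qed (intro pc continuous_intros)
  have 2: "has_bochner_integral lborel (\<lambda>b. indicator {a..1} b *\<^sub>R p (b - a)) (S (1 - a) - S (a - a))"
  proof (rule has_bochner_integral_FTC_Icc[OF a(2)])
    fix x :: real
    have g: "((\<lambda>b. b - a) has_real_derivative 1) (at x within {a..1})" by (auto intro!: derivative_eq_intros)
    have "((\<lambda>b. S (b - a)) has_real_derivative p (x - a)) (at x within {a..1})"
      using DERIV_chain2[OF S g] by simp
    then show "((\<lambda>b. S (b - a)) has_vector_derivative p (x - a)) (at x within {a..1})"
      by (simp add: has_real_derivative_iff_has_vector_derivative)
  qed (intro pc continuous_intros)
  have [measurable]: "p \<in> borel_measurable borel" using p by (rule borel_measurable_continuous_onI)
  have "(\<integral>b. indicator {0..<1} b * p \<bar>a - b\<bar> \<partial>lborel) = (\<integral>b. indicator {0..a} b *\<^sub>R p (a - b) + indicator {a..1} b *\<^sub>R p (b - a) \<partial>lborel)"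
  proof (rule integral_cong_AE)
    show "AE b in lborel. indicator {0..<1} b * p \<bar>a - b\<bar> = indicator {0..a} b *\<^sub>R p (a - b) + indicator {a..1} b *\<^sub>R p (b - a)"
      using AE_lborel_singleton[of a] AE_lborel_singleton[of "1::real"]
    proof eventually_elim
      case (elim b)
      then show ?case using a by (auto simp: indicator_def)
    qed
  qed measurable
  also have "\<dots> = (- S (a - a) - - S (a - 0)) + (S (1 - a) - S (a - a))"
    using has_bochner_integral_add[OF 1 2] by (rule has_bochner_integral_integral_eq)
  finally show ?thesis by simp
qed

text \<open>The periodic extension of the Bernoulli polynomial is even, so \<open>b \<mapsto> half_bernoulli \<bar>a - b\<bar>\<close> is a periodic
translate of it over a full period, and the integrals do not depend on \<open>a\<close>.\<close>

lemma half_bernoulli_integral: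
  assumes "0 \<le> a" "a \<le> 1"
  shows "(\<integral>b. indicator {0..<1} b * half_bernoulli \<bar>a - b\<bar> \<partial>lborel) = 0"
    "(\<integral>b. indicator {0..<1} b * (half_bernoulli \<bar>a - b\<bar>)\<^sup>2 \<partial>lborel) = 1/720"
proof -
  have "(\<integral>b. indicator {0..<1} b * half_bernoulli \<bar>a - b\<bar> \<partial>lborel)
    = (\<lambda>x. x^3/6 - x^2/4 + x/12) a + (\<lambda>x. x^3/6 - x^2/4 + x/12) (1 - a) - 2 * (\<lambda>x. x^3/6 - x^2/4 + x/12) (0::real)"
    by (rule fold_integral[OF _ _ assms])
       (auto intro!: derivative_eq_intros continuous_intros simp: half_bernoulli_def[abs_def] field_simps power2_eq_square)
  also have "\<dots> = 0" by (simp add: field_simps power2_eq_square power3_eq_cube)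
  finally show "(\<integral>b. indicator {0..<1} b * half_bernoulli \<bar>a - b\<bar> \<partial>lborel) = 0" .
  let ?U = "\<lambda>x::real. (x^5/5 - x^4/2 + 4*x^3/9 - x^2/6 + x/36) / 4"
  have "(\<integral>b. indicator {0..<1} b * (\<lambda>x. (half_bernoulli x)\<^sup>2) \<bar>a - b\<bar> \<partial>lborel) = ?U a + ?U (1 - a) - 2 * ?U 0"
  proof (rule fold_integral[OF _ _ assms])
    fix x
    have "(?U has_real_derivative (5*x^4/5 - 4*x^3/2 + 4*(3*x^2)/9 - 2*x/6 + 1/36) / 4) (at x)"
      by (auto intro!: derivative_eq_intros)
    moreover have "(5*x^4/5 - 4*x^3/2 + 4*(3*x^2)/9 - 2*x/6 + 1/36) / 4 = (half_bernoulli x)\<^sup>2"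
      by (simp add: half_bernoulli_def field_simps power2_eq_square power3_eq_cube power4_eq_xxxx)
    ultimately show "(?U has_real_derivative (half_bernoulli x)\<^sup>2) (at x)" by (simp only:)
  qed (auto intro!: continuous_intros simp: half_bernoulli_def[abs_def])
  also have "\<dots> = 1/720"
  proof -
    have "(1 - a)^5 = 1 - 5*a + 10*a^2 - 10*a^3 + 5*a^4 - a^5" by (simp add: eval_nat_numeral algebra_simps)
    moreover have "(1 - a)^4 = 1 - 4*a + 6*a^2 - 4*a^3 + a^4" by (simp add: eval_nat_numeral algebra_simps)
    moreover have "(1 - a)^3 = 1 - 3*a + 3*a^2 - a^3" by (simp add: eval_nat_numeral algebra_simps)
    moreover have "(1 - a)^2 = 1 - 2*a + a^2" by (simp add: eval_nat_numeral algebra_simps)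
    ultimately show ?thesis by (simp add: field_simps)
  qed
  finally show "(\<integral>b. indicator {0..<1} b * (half_bernoulli \<bar>a - b\<bar>)\<^sup>2 \<partial>lborel) = 1/720" .
qed

lemma cellM_integral_const:
  fixes F :: "real^2 \<Rightarrow> real"
  assumes F[measurable]: "F \<in> borel_measurable borel" and B: "\<And>v. v \<in> unit_cell \<Longrightarrow> \<bar>F v\<bar> \<le> B"
  shows "(\<And>a. 0 \<le> a \<Longrightarrow> a < 1 \<Longrightarrow> (\<integral>b. indicator {0..<1} b * F (vector [a, b]) \<partial>lborel) = c) \<Longrightarrow> (\<integral>v. F v \<partial>cellM) = c"
    and "(\<And>b. 0 \<le> b \<Longrightarrow> b < 1 \<Longrightarrow> (\<integral>a. indicator {0..<1} a * F (vector [a, b]) \<partial>lborel) = c) \<Longrightarrow> (\<integral>v. F v \<partial>cellM) = c"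
proof -
  let ?H = "\<lambda>(a, b). indicator {0..<1} a * (indicator {0..<1} b * F (vector [a, b]))"
  have ind: "indicator unit_cell (vector [a, b] :: real^2) = (indicator {0..<1} a * indicator {0..<1} b :: real)" for a b
    by (auto simp: indicator_def unit_cell_def forall_2)
  have "integrable cellM F" by (rule cellM_bounded_integrable[OF F B])
  then have I0: "integrable lborel (\<lambda>v. indicator unit_cell v *\<^sub>R F v)"
    unfolding cellM_def by (subst (asm) integrable_restrict_space) auto
  have eqH: "(\<lambda>p. indicator unit_cell ((\<lambda>(a, b). vector [a, b]) p) *\<^sub>R F ((\<lambda>(a, b). vector [a, b]) p)) = ?H"
    by (auto simp: fun_eq_iff ind)
  have "integrable (distr (lborel \<Otimes>\<^sub>M lborel) borel (\<lambda>(a,b). vector [a, b])) (\<lambda>v. indicator unit_cell v *\<^sub>R F v)"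
    using I0 by (subst (asm) lborel_real2)
  then have "integrable (lborel \<Otimes>\<^sub>M lborel) (\<lambda>p. indicator unit_cell ((\<lambda>(a, b). vector [a, b]) p) *\<^sub>R F ((\<lambda>(a, b). vector [a, b]) p))"
    by (subst (asm) integrable_distr_eq) simp_all
  then have IH: "integrable (lborel \<Otimes>\<^sub>M lborel) ?H" unfolding eqH .
  have "(\<integral>v. F v \<partial>cellM) = (\<integral>v. indicator unit_cell v *\<^sub>R F v \<partial>lborel)"
    unfolding cellM_def by (subst integral_restrict_space) auto
  also have "\<dots> = (\<integral>p. indicator unit_cell ((\<lambda>(a, b). vector [a, b]) p) *\<^sub>R F ((\<lambda>(a, b). vector [a, b]) p) \<partial>(lborel \<Otimes>\<^sub>M lborel))"
    by (subst lborel_real2, rule integral_distr) measurable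
  also have "\<dots> = (\<integral>p. ?H p \<partial>(lborel \<Otimes>\<^sub>M lborel))" unfolding eqH ..
  finally have E: "(\<integral>v. F v \<partial>cellM) = (\<integral>p. ?H p \<partial>(lborel \<Otimes>\<^sub>M lborel))" .
  have i1: "(\<integral>a. indicator {0..<1} (a::real) * c \<partial>lborel) = c" by simp
  {
    assume c: "\<And>a. 0 \<le> a \<Longrightarrow> a < 1 \<Longrightarrow> (\<integral>b. indicator {0..<1} b * F (vector [a, b]) \<partial>lborel) = c"
    have "(\<integral>p. ?H p \<partial>(lborel \<Otimes>\<^sub>M lborel)) = (\<integral>a. \<integral>b. ?H (a, b) \<partial>lborel \<partial>lborel)"
      using lborel_pair.integral_fst'[OF IH] by simp
    also have "\<dots> = (\<integral>a. indicator {0..<1} (a::real) * c \<partial>lborel)"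
      by (rule Bochner_Integration.integral_cong[OF refl]) (use c in \<open>auto simp: indicator_def\<close>)
    finally show "(\<integral>v. F v \<partial>cellM) = c" unfolding E i1 .
  }
  {
    assume c: "\<And>b. 0 \<le> b \<Longrightarrow> b < 1 \<Longrightarrow> (\<integral>a. indicator {0..<1} a * F (vector [a, b]) \<partial>lborel) = c"
    have "(\<integral>p. ?H p \<partial>(lborel \<Otimes>\<^sub>M lborel)) = (\<integral>b. \<integral>a. ?H (a, b) \<partial>lborel \<partial>lborel)"
      using lborel_pair.integral_snd[of "\<lambda>a b. ?H (a, b)"] IH by simp
    also have "\<dots> = (\<integral>b. indicator {0..<1} (b::real) * c \<partial>lborel)"
    proof (rule Bochner_Integration.integral_cong[OF refl])
      fix b :: real
      have "(\<integral>a. ?H (a, b) \<partial>lborel) = indicator {0..<1} b * (\<integral>a. indicator {0..<1} a * F (vector [a, b]) \<partial>lborel)"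
        unfolding integral_mult_right_zero[symmetric] by (simp add: mult.left_commute)
      then show "(\<integral>a. ?H (a, b) \<partial>lborel) = indicator {0..<1} b * c"
        using c[of b] by (auto simp: indicator_def)
    qed
    finally show "(\<integral>v. F v \<partial>cellM) = c" unfolding E i1 .
  }
qed

text \<open>The three profiles of the residual over a cell. Each is constant along one of the three edge directions
of the triangulation.\<close>

definition cell_residual :: "nat \<Rightarrow> real^2 \<Rightarrow> real" where
  "cell_residual j v = (if j = 0 then half_bernoulli (v$1) else if j = 1 then half_bernoulli (v$2) else - half_bernoulli \<bar>v$1 - v$2\<bar>)"

lemma half_bernoulli_measurable [measurable]: "half_bernoulli \<in> borel_measurable borel"
  unfolding half_bernoulli_def by (intro borel_measurable_continuous_onI continuous_intros) auto

lemma cell_residual_measurable [measurable]: "cell_residual j \<in> borel_measurable borel"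
  unfolding cell_residual_def by measurable

lemma half_bernoulli_bound: "0 \<le> x \<Longrightarrow> x \<le> 1 \<Longrightarrow> \<bar>half_bernoulli x\<bar> \<le> 1"
proof -
  assume x: "0 \<le> x" "x \<le> 1"
  have "0 \<le> x * (1 - x)" using x by simp
  moreover have "x * (1 - x) \<le> 1 * 1" using x by (intro mult_mono) auto
  ultimately show ?thesis by (simp add: half_bernoulli_def power2_eq_square algebra_simps abs_le_iff)
qed

lemma cell_residual_bound: "v \<in> unit_cell \<Longrightarrow> \<bar>cell_residual j v\<bar> \<le> 1"
  using unit_cellD[of v] by (auto simp: cell_residual_def intro!: half_bernoulli_bound)

lemma cell_residual_mean: "(\<integral>v. cell_residual j v \<partial>cellM) = 0"
proof -
  consider "j = 0" | "j = 1" | "j \<noteq> 0" "j \<noteq> 1" by blast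
  then show ?thesis
  proof cases
    case 1
    have "(\<integral>a. indicator {0..<1} a * cell_residual j (vector [a, b]) \<partial>lborel) = 0" for b
    proof -
      have "(\<integral>a. indicator {0..<1} a * cell_residual j (vector [a, b]) \<partial>lborel) = (\<integral>a. indicator {0..<1} a * half_bernoulli \<bar>0 - a\<bar> \<partial>lborel)"
        using 1 by (intro Bochner_Integration.integral_cong refl) (auto simp: cell_residual_def indicator_def)
      then show ?thesis using half_bernoulli_integral(1)[of 0] by simp
    qed
    then show ?thesis by (intro cellM_integral_const(2)[OF cell_residual_measurable cell_residual_bound]) auto
  next
    case 2
    have "(\<integral>b. indicator {0..<1} b * cell_residual j (vector [a, b]) \<partial>lborel) = 0" for a
    proof -
      have "(\<integral>b. indicator {0..<1} b * cell_residual j (vector [a, b]) \<partial>lborel) = (\<integral>a. indicator {0..<1} a * half_bernoulli \<bar>0 - a\<bar> \<partial>lborel)"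
        using 2 by (intro Bochner_Integration.integral_cong refl) (auto simp: cell_residual_def indicator_def)
      then show ?thesis using half_bernoulli_integral(1)[of 0] by simp
    qed
    then show ?thesis by (intro cellM_integral_const(1)[OF cell_residual_measurable cell_residual_bound]) auto
  next
    case 3
    have "(\<integral>b. indicator {0..<1} b * cell_residual j (vector [a, b]) \<partial>lborel) = 0" if "0 \<le> a" "a < 1" for a
      using 3 half_bernoulli_integral(1)[of a] that by (simp add: cell_residual_def)
    then show ?thesis by (intro cellM_integral_const(1)[OF cell_residual_measurable cell_residual_bound]) auto
  qed
qed

text \<open>In each mixed product one of the coordinates occurs in a single factor only, and integration over that
coordinate gives zero by \<open>half_bernoulli_integral\<close>. The diagonal entries are the mean square of half the
Bernoulli polynomial.\<close>

lemma cell_residual_gram: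
  assumes "j < 3" "l < 3"
  shows "(\<integral>v. cell_residual j v * cell_residual l v \<partial>cellM) = (if j = l then 1/720 else 0)"
proof -
  have m: "(\<lambda>v. cell_residual j v * cell_residual l v) \<in> borel_measurable borel" for j l by measurable
  have b: "\<bar>cell_residual j v * cell_residual l v\<bar> \<le> 1" if "v \<in> unit_cell" for j l v
    using mult_mono[OF cell_residual_bound[OF that, of j] cell_residual_bound[OF that, of l]] by (simp add: abs_mult)
  note c1 = cellM_integral_const(1)[OF m b] and c2 = cellM_integral_const(2)[OF m b]
  have s0: "(\<integral>a. indicator {0..<1} a * half_bernoulli a \<partial>lborel) = 0" "(\<integral>a. indicator {0..<1} a * (half_bernoulli a)\<^sup>2 \<partial>lborel) = 1/720"
  proof -
    have "(\<integral>a. indicator {0..<1} a * half_bernoulli a \<partial>lborel) = (\<integral>a. indicator {0..<1} a * half_bernoulli \<bar>0 - a\<bar> \<partial>lborel)"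
      by (intro Bochner_Integration.integral_cong refl) (auto simp: indicator_def)
    then show "(\<integral>a. indicator {0..<1} a * half_bernoulli a \<partial>lborel) = 0" using half_bernoulli_integral(1)[of 0] by simp
    have "(\<integral>a. indicator {0..<1} a * (half_bernoulli a)\<^sup>2 \<partial>lborel) = (\<integral>a. indicator {0..<1} a * (half_bernoulli \<bar>0 - a\<bar>)\<^sup>2 \<partial>lborel)"
      by (intro Bochner_Integration.integral_cong refl) (auto simp: indicator_def)
    then show "(\<integral>a. indicator {0..<1} a * (half_bernoulli a)\<^sup>2 \<partial>lborel) = 1/720" using half_bernoulli_integral(2)[of 0] by simp
  qed
  have s1: "(\<integral>b. indicator {0..<1} b * half_bernoulli \<bar>b - a\<bar> \<partial>lborel) = 0" if "0 \<le> a" "a < 1" for a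
    using half_bernoulli_integral(1)[of a] that by (simp add: abs_minus_commute)
  have pull: "(\<integral>b. indicator {0..<1} b * (c * g b) \<partial>lborel) = c * (\<integral>b. indicator {0..<1} b * g b \<partial>lborel)" for c and g :: "real \<Rightarrow> real"
    unfolding integral_mult_right_zero[symmetric] by (simp add: mult.left_commute)
  have g00: "(\<integral>v. cell_residual 0 v * cell_residual 0 v \<partial>cellM) = 1/720"
    by (rule c2, assumption) (simp add: cell_residual_def s0 flip: power2_eq_square)
  have g11: "(\<integral>v. cell_residual 1 v * cell_residual 1 v \<partial>cellM) = 1/720"
    by (rule c1, assumption) (simp add: cell_residual_def s0 flip: power2_eq_square)
  have g22: "(\<integral>v. cell_residual 2 v * cell_residual 2 v \<partial>cellM) = 1/720"
    by (rule c1, assumption) (simp add: cell_residual_def half_bernoulli_integral flip: power2_eq_square)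
  have g01: "(\<integral>v. cell_residual 0 v * cell_residual 1 v \<partial>cellM) = 0"
    by (rule c1, assumption) (simp add: cell_residual_def pull s0)
  have g02: "(\<integral>v. cell_residual 0 v * cell_residual 2 v \<partial>cellM) = 0"
  proof (rule c1, assumption)
    fix a :: real assume "0 \<le> a" "a < 1"
    then show "(\<integral>b. indicator {0..<1} b * (cell_residual 0 (vector [a, b]) * cell_residual 2 (vector [a, b])) \<partial>lborel) = 0"
      using half_bernoulli_integral(1)[of a] by (simp add: cell_residual_def pull)
  qed
  have g12: "(\<integral>v. cell_residual 2 v * cell_residual 1 v \<partial>cellM) = 0"
  proof (rule c2, assumption)
    fix b :: real assume b: "0 \<le> b" "b < 1"
    have "(\<integral>a. indicator {0..<1} a * (cell_residual 2 (vector [a, b]) * cell_residual 1 (vector [a, b])) \<partial>lborel)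
      = (\<integral>a. indicator {0..<1} a * ((- half_bernoulli b) * half_bernoulli \<bar>a - b\<bar>) \<partial>lborel)"
      by (simp add: cell_residual_def mult.commute)
    then show "(\<integral>a. indicator {0..<1} a * (cell_residual 2 (vector [a, b]) * cell_residual 1 (vector [a, b])) \<partial>lborel) = 0"
      by (simp only: pull s1[OF b] mult_zero_right)
  qed
  have "j = 0 \<or> j = 1 \<or> j = 2" "l = 0 \<or> l = 1 \<or> l = 2" using assms by auto
  then show ?thesis using g00 g11 g22 g01 g02 g12 by (elim disjE) (simp_all add: mult.commute)
qed

section \<open>The best approximation\<close>

lemma L2_norm_L2n: "L2_norm f = L2n lborel f"
  by (simp add: L2_norm_def L2n_def)

lemma cpwl_linear:
  "cpwl (\<lambda>k. a k - b k) k v = cpwl a k v - cpwl b k v" "cpwl (\<lambda>k. (a k + b k) / 2) k v = (cpwl a k v + cpwl b k v) / 2"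
  by (simp_all add: cpwl_def sum_subtractf sum.distrib algebra_simps add_divide_distrib sum_divide_distrib)

lemma in_L2_latM_point:
  assumes "in_L2 latM (c :: int^2 \<Rightarrow> real)" shows "\<bar>c k\<bar> \<le> L2n latM c"
proof -
  have "ennreal ((c k)\<^sup>2) = (\<integral>\<^sup>+j. ennreal ((c k)\<^sup>2) * indicator {k} j \<partial>latM)"
    by (subst nn_integral_cmult_indicator) (simp_all add: latM_def)
  also have "\<dots> \<le> (\<integral>\<^sup>+j. ennreal ((norm (c j))\<^sup>2) \<partial>latM)"
    by (rule nn_integral_mono) (auto simp: indicator_def)
  also have "\<dots> = ennreal ((L2n latM c)\<^sup>2)" by (rule L2_nn_integral[OF assms])
  finally have "(c k)\<^sup>2 \<le> (L2n latM c)\<^sup>2" by simp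
  then show ?thesis by (simp add: abs_le_square_iff[symmetric])
qed

text \<open>The direct method. The parallelogram identity makes a minimising sequence of splines Cauchy in norm, the
Riesz bound makes its coefficients converge pointwise, and Fatou's lemma shows that the limit is a
minimiser with square-summable coefficients.\<close>

lemma cpwl_minimiser:
  assumes f: "in_L2 PM (f :: _ \<Rightarrow> real)"
  shows "\<exists>c. in_L2 latM c \<and> (\<forall>c'. in_L2 latM c' \<longrightarrow> L2n PM (\<lambda>p. f p - cpwl c (fst p) (snd p)) \<le> L2n PM (\<lambda>p. f p - cpwl c' (fst p) (snd p)))"
proof -
  have [measurable]: "f \<in> borel_measurable PM" by (rule in_L2_measurable[OF f])
  note [measurable] = cpwl_measurable
  define J where "J c = (L2n PM (\<lambda>p. f p - cpwl c (fst p) (snd p)))\<^sup>2" for c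
  define A where "A = J ` {c. in_L2 latM c}"
  define m where "m = Inf A"
  have A0: "A \<noteq> {}" unfolding A_def using in_L2_zero[of latM] by blast
  have bdd: "bdd_below A" unfolding A_def by (rule bdd_belowI[of _ 0]) (auto simp: J_def)
  have mle: "m \<le> J c" if "in_L2 latM c" for c
    unfolding m_def by (rule cInf_lower[OF _ bdd]) (use that in \<open>auto simp: A_def\<close>)
  have "\<exists>c. in_L2 latM c \<and> J c < m + 1 / real (Suc n)" for n
  proof -
    have "\<exists>x\<in>A. x < m + 1 / real (Suc n)" using cInf_less_iff[OF A0 bdd, of "m + 1 / real (Suc n)"] by (simp add: m_def)
    then show ?thesis by (auto simp: A_def)
  qed
  then obtain c where c: "\<And>n. in_L2 latM (c n)" "\<And>n. J (c n) < m + 1 / real (Suc n)" by metis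
  have dL: "in_L2 PM (\<lambda>p. f p - cpwl c' (fst p) (snd p))" if "in_L2 latM c'" for c'
    by (intro in_L2_diff f cpwl_L2 that)
  \<comment> \<open>Parallelogram identity for the residuals of two members of the minimising sequence,
    whose mean is again admissible.\<close>
  have par: "(L2n PM (\<lambda>p. cpwl (\<lambda>k. c i k - c j k) (fst p) (snd p)))\<^sup>2 \<le> 2 / real (Suc i) + 2 / real (Suc j)" for i j
  proof -
    let ?a = "\<lambda>p. f p - cpwl (c i) (fst p) (snd p)" and ?b = "\<lambda>p. f p - cpwl (c j) (fst p) (snd p)"
    let ?h = "\<lambda>k. (c i k + c j k) / 2"
    have hL: "in_L2 latM ?h" using in_L2_scaleR[OF in_L2_add[OF c(1)[of i] c(1)[of j]], of "1/2"] by simp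
    have dd: "in_L2 PM (\<lambda>p. cpwl (\<lambda>k. c i k - c j k) (fst p) (snd p))" by (intro cpwl_L2 in_L2_diff c)
    have "(L2n PM (\<lambda>p. cpwl (\<lambda>k. c i k - c j k) (fst p) (snd p)))\<^sup>2 + 4 * J ?h
      = (\<integral>p. (norm (cpwl (\<lambda>k. c i k - c j k) (fst p) (snd p)))\<^sup>2 + 4 * (norm (f p - cpwl ?h (fst p) (snd p)))\<^sup>2 \<partial>PM)"
      unfolding J_def L2n_sq using in_L2_integrable[OF dd] in_L2_integrable[OF dL[OF hL]] by simp
    also have "\<dots> = (\<integral>p. 2 * (norm (?a p))\<^sup>2 + 2 * (norm (?b p))\<^sup>2 \<partial>PM)"
      by (intro Bochner_Integration.integral_cong refl) (simp add: cpwl_linear power2_eq_square field_simps)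
    also have "\<dots> = 2 * J (c i) + 2 * J (c j)"
      unfolding J_def L2n_sq using in_L2_integrable[OF dL[OF c(1)]] by simp
    finally have "(L2n PM (\<lambda>p. cpwl (\<lambda>k. c i k - c j k) (fst p) (snd p)))\<^sup>2 + 4 * J ?h = 2 * J (c i) + 2 * J (c j)" .
    moreover have "2 / real (Suc n) = 2 * (1 / real (Suc n))" for n by simp
    ultimately show ?thesis using c(2)[of i] c(2)[of j] mle[OF hL] by linarith
  qed
  have pt: "(c i k - c j k)\<^sup>2 \<le> 136 * (2 / real (Suc i) + 2 / real (Suc j))" for i j k
  proof -
    have dc: "in_L2 latM (\<lambda>k. c i k - c j k)" by (intro in_L2_diff c)
    have "(c i k - c j k)\<^sup>2 \<le> (L2n latM (\<lambda>k. c i k - c j k))\<^sup>2"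
      using in_L2_latM_point[OF dc, of k] by (simp add: abs_le_square_iff[symmetric])
    also have "\<dots> \<le> 136 * (L2n PM (\<lambda>p. cpwl (\<lambda>k. c i k - c j k) (fst p) (snd p)))\<^sup>2"
      by (rule cpwl_riesz(2)[OF cpwl_L2[OF dc]])
    finally show ?thesis using par[of i j] by simp
  qed
  have "convergent (\<lambda>n. c n k)" for k
  proof (rule Cauchy_convergent, rule metric_CauchyI)
    fix e :: real assume "0 < e"
    \<comment> \<open>The number 544 is four times the Riesz constant 136.\<close>
    obtain N :: nat where N: "544 / e\<^sup>2 < real N" using reals_Archimedean2[of "544 / e\<^sup>2"] by blast
    show "\<exists>M. \<forall>i\<ge>M. \<forall>j\<ge>M. dist (c i k) (c j k) < e"
    proof (intro exI[of _ N] allI impI)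
      fix i j assume ij: "N \<le> i" "N \<le> j"
      have "0 \<le> 544 / e\<^sup>2" by simp
      from le_less_trans[OF this N] have N0: "0 < real N" .
      have "2 / real (Suc i) + 2 / real (Suc j) \<le> 2 / real N + 2 / real N"
        using ij N0 by (intro add_mono frac_le) auto
      then have "136 * (2 / real (Suc i) + 2 / real (Suc j)) \<le> 136 * (2 / real N + 2 / real N)"
        by (rule mult_left_mono) simp
      with pt[of i k j] have "(c i k - c j k)\<^sup>2 \<le> 136 * (2 / real N + 2 / real N)" by (rule order_trans)
      also have "\<dots> = 544 / real N" by simp
      also have "\<dots> < e\<^sup>2" using N N0 \<open>0 < e\<close> by (simp add: field_simps)
      finally have "\<bar>c i k - c j k\<bar>\<^sup>2 < e\<^sup>2" by simp
      then have "\<bar>c i k - c j k\<bar> < e" by (rule power2_less_imp_less) (use \<open>0 < e\<close> in simp)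
      then show "dist (c i k) (c j k) < e" by (simp add: dist_real_def)
    qed
  qed
  then obtain l where l: "\<And>k. (\<lambda>n. c n k) \<longlonglongrightarrow> l k" unfolding convergent_def by metis
  have cl: "(\<lambda>n. cpwl (c n) k v) \<longlonglongrightarrow> cpwl l k v" for k v
    unfolding cpwl_def by (intro tendsto_sum tendsto_mult tendsto_const l)
  have J0: "0 \<le> m" using A0 bdd unfolding m_def A_def by (intro cInf_greatest) (auto simp: J_def)
  have "(\<integral>\<^sup>+p. ennreal ((norm (f p - cpwl l (fst p) (snd p)))\<^sup>2) \<partial>PM) = (\<integral>\<^sup>+p. liminf (\<lambda>n. ennreal ((norm (f p - cpwl (c n) (fst p) (snd p)))\<^sup>2)) \<partial>PM)"
  proof (rule nn_integral_cong)
    fix p :: "(int^2) \<times> (real^2)"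
    have "(\<lambda>n. ennreal ((norm (f p - cpwl (c n) (fst p) (snd p)))\<^sup>2)) \<longlonglongrightarrow> ennreal ((norm (f p - cpwl l (fst p) (snd p)))\<^sup>2)"
      by (intro tendsto_ennrealI tendsto_power tendsto_norm tendsto_diff tendsto_const cl)
    then show "ennreal ((norm (f p - cpwl l (fst p) (snd p)))\<^sup>2) = liminf (\<lambda>n. ennreal ((norm (f p - cpwl (c n) (fst p) (snd p)))\<^sup>2))"
      using lim_imp_Liminf by force
  qed
  also have "\<dots> \<le> liminf (\<lambda>n. \<integral>\<^sup>+p. ennreal ((norm (f p - cpwl (c n) (fst p) (snd p)))\<^sup>2) \<partial>PM)"
    by (rule nn_integral_liminf) measurable
  also have "\<dots> = liminf (\<lambda>n. ennreal (J (c n)))" unfolding L2_nn_integral[OF dL[OF c(1)]] J_def ..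
  also have "\<dots> \<le> liminf (\<lambda>n. ennreal (m + 1 / real (Suc n)))"
    by (rule Liminf_mono) (intro always_eventually allI ennreal_leI less_imp_le c(2))
  also have "\<dots> = ennreal m"
  proof -
    have "(\<lambda>n. m + 1 / real (Suc n)) \<longlonglongrightarrow> m + 0"
      by (intro tendsto_add tendsto_const LIMSEQ_Suc[OF lim_1_over_n])
    then have "(\<lambda>n. ennreal (m + 1 / real (Suc n))) \<longlonglongrightarrow> ennreal m" by (intro tendsto_ennrealI) simp
    then show ?thesis using lim_imp_Liminf by force
  qed
  finally have fin: "(\<integral>\<^sup>+p. ennreal ((norm (f p - cpwl l (fst p) (snd p)))\<^sup>2) \<partial>PM) \<le> ennreal m" .
  have "(\<lambda>p. f p - cpwl l (fst p) (snd p)) \<in> borel_measurable PM" by measurable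
  note fl = in_L2I_nn[OF this fin J0]
  have "in_L2 PM (\<lambda>p. cpwl l (fst p) (snd p))" using in_L2_diff[OF f fl(1)] by simp
  then have lL: "in_L2 latM l" by (rule cpwl_riesz(1))
  have "L2n PM (\<lambda>p. f p - cpwl l (fst p) (snd p)) \<le> L2n PM (\<lambda>p. f p - cpwl c' (fst p) (snd p))" if "in_L2 latM c'" for c'
    by (rule power2_le_imp_le[OF order_trans[OF fl(2) mle[OF that, unfolded J_def]]]) simp
  then show ?thesis using lL by blast
qed

text \<open>Since a minimiser exists, the projection defined by \<open>arg_min\<close> is one, and the error is the minimal distance
written in cell coordinates.\<close>

lemma approx_error_char:
  fixes X :: "real^2^2"
  assumes d: "det X \<noteq> 0" and f: "square_integrable f" and g[measurable]: "g \<in> borel_measurable borel" and fg: "AE x in lborel. f x = g x"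
  defines "cell_values \<equiv> (\<lambda>p. g (X *v (real_of_int_vec (fst p) + snd p)))"
  shows "in_L2 PM cell_values" "\<exists>c. in_L2 latM c \<and> approx_error X f = sqrt \<bar>det X\<bar> * L2n PM (\<lambda>p. cell_values p - cpwl c (fst p) (snd p)) \<and>
    (\<forall>c'. in_L2 latM c' \<longrightarrow> approx_error X f \<le> sqrt \<bar>det X\<bar> * L2n PM (\<lambda>p. cell_values p - cpwl c' (fst p) (snd p)))"
proof -
  have [measurable]: "f \<in> borel_measurable borel" using f by (simp add: square_integrable_def)
  have fL: "in_L2 lborel f" by (rule square_integrable_in_L2[OF f])
  have "integrable lborel (\<lambda>x. (norm (g x))\<^sup>2)"
    by (rule integrable_cong_AE_imp[OF in_L2_integrable[OF fL]]) (use fg in \<open>auto elim: eventually_mono\<close>)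
  then have gL: "in_L2 lborel g" by (simp add: in_L2_def)
  then show gtL: "in_L2 PM cell_values" unfolding cell_values_def using lattice_L2(1)[OF d g] by simp
  have tr: "L2_norm (\<lambda>x. f x - spline X c x) = sqrt \<bar>det X\<bar> * L2n PM (\<lambda>p. cell_values p - cpwl c (fst p) (snd p))" for c
  proof -
    note [measurable] = spline_measurable[OF d, of c]
    have "L2_norm (\<lambda>x. f x - spline X c x) = L2n lborel (\<lambda>x. g x - spline X c x)"
      unfolding L2_norm_def L2n_def real_norm_def power2_abs
      by (intro arg_cong[where f=sqrt] integral_cong_AE) (use fg in \<open>auto elim: eventually_mono\<close>)
    also have "\<dots> = sqrt \<bar>det X\<bar> * L2n PM (\<lambda>p. g (X *v (real_of_int_vec (fst p) + snd p)) - spline X c (X *v (real_of_int_vec (fst p) + snd p)))"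
      by (rule lattice_L2(2)[OF d]) measurable
    also have "L2n PM (\<lambda>p. g (X *v (real_of_int_vec (fst p) + snd p)) - spline X c (X *v (real_of_int_vec (fst p) + snd p))) = L2n PM (\<lambda>p. cell_values p - cpwl c (fst p) (snd p))"
      unfolding L2n_def cell_values_def
      by (intro arg_cong[where f=sqrt] Bochner_Integration.integral_cong refl) (simp only: spline_PM[OF d])
    finally show ?thesis .
  qed
  obtain c0 where c0: "in_L2 latM c0" "\<And>c'. in_L2 latM c' \<Longrightarrow> L2n PM (\<lambda>p. cell_values p - cpwl c0 (fst p) (snd p)) \<le> L2n PM (\<lambda>p. cell_values p - cpwl c' (fst p) (snd p))"
    using cpwl_minimiser[OF gtL] by blast
  let ?F = "\<lambda>s. L2_norm (\<lambda>x. f x - s x)"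
  have M: "cpwl_projection X f \<in> cpwl_space X \<and> (\<forall>t\<in>cpwl_space X. ?F (cpwl_projection X f) \<le> ?F t)"
    unfolding cpwl_projection_def
  proof (rule arg_minI[where x="spline X c0"])
    show "spline X c0 \<in> cpwl_space X" using c0(1) by (auto simp: cpwl_space_spline)
    show "\<not> ?F y < ?F (spline X c0)" if "y \<in> cpwl_space X" for y
    proof -
      obtain c' where "in_L2 latM c'" "y = spline X c'" using \<open>y \<in> cpwl_space X\<close> by (auto simp: cpwl_space_spline)
      then show ?thesis using c0(2)[of c'] by (simp add: tr mult_left_mono not_less)
    qed
    show "x \<in> cpwl_space X \<and> (\<forall>t\<in>cpwl_space X. ?F x \<le> ?F t)" if "x \<in> cpwl_space X" "\<forall>y. y \<in> cpwl_space X \<longrightarrow> \<not> ?F y < ?F x" for x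
      using that by (auto simp: not_less)
  qed
  then have le: "\<And>t. t \<in> cpwl_space X \<Longrightarrow> ?F (cpwl_projection X f) \<le> ?F t" by blast
  from M obtain c where c: "in_L2 latM c" "cpwl_projection X f = spline X c" unfolding cpwl_space_spline by blast
  have e: "approx_error X f = sqrt \<bar>det X\<bar> * L2n PM (\<lambda>p. cell_values p - cpwl c (fst p) (snd p))"
    unfolding approx_error_def c(2) by (rule tr)
  moreover have "approx_error X f \<le> sqrt \<bar>det X\<bar> * L2n PM (\<lambda>p. cell_values p - cpwl c' (fst p) (snd p))" if "in_L2 latM c'" for c'
    using le[of "spline X c'"] that unfolding approx_error_def tr cpwl_space_spline by blast
  ultimately show "\<exists>c. in_L2 latM c \<and> approx_error X f = sqrt \<bar>det X\<bar> * L2n PM (\<lambda>p. cell_values p - cpwl c (fst p) (snd p)) \<and>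
    (\<forall>c'. in_L2 latM c' \<longrightarrow> approx_error X f \<le> sqrt \<bar>det X\<bar> * L2n PM (\<lambda>p. cell_values p - cpwl c' (fst p) (snd p)))"
    using c(1) by blast
qed

section \<open>A quasi-interpolant and its residual\<close>

lemma IFT_real:
  assumes m: "F \<in> borel_measurable borel" and s: "\<And>w. F (- w) = cnj (F w)" shows "Im (IFT F x) = 0"
proof -
  note [measurable] = m
  let ?g = "\<lambda>w. F w * exp (\<i> * complex_of_real (w \<bullet> x))"
  have "cnj (IFT F x) = (\<integral>w. cnj (?g w) \<partial>lborel)" unfolding IFT_def Bochner_Integration.integral_cnj ..
  also have "\<dots> = (\<integral>w. ?g (- w) \<partial>lborel)"
    by (rule Bochner_Integration.integral_cong[OF refl]) (simp add: s exp_cnj)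
  also have "\<dots> = IFT F x" unfolding IFT_def by (rule integral_reflect) measurable
  finally show ?thesis by (simp add: complex_eq_iff)
qed

text \<open>The cell has measure one, so a bound in \<open>\<ell>\<^sub>2\<close> for each fixed position in the cell is a bound on the whole
plane.\<close>

lemma PM_slices:
  fixes F :: "(int^2) \<times> (real^2) \<Rightarrow> real"
  assumes m: "F \<in> borel_measurable PM" and D: "0 \<le> D"
    and s: "\<And>v. v \<in> unit_cell \<Longrightarrow> in_L2 latM (\<lambda>k. F (k, v))" "\<And>v. v \<in> unit_cell \<Longrightarrow> L2n latM (\<lambda>k. F (k, v)) \<le> D"
  shows "in_L2 PM F" "L2n PM F \<le> D"
proof -
  note [measurable] = m
  have "(\<integral>\<^sup>+p. ennreal ((norm (F p))\<^sup>2) \<partial>PM) = (\<integral>\<^sup>+v. \<integral>\<^sup>+k. ennreal ((norm (F (k, v)))\<^sup>2) \<partial>latM \<partial>cellM)"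
    by (rule nn_integral_PM(2)) measurable
  also have "\<dots> \<le> (\<integral>\<^sup>+v. ennreal (D\<^sup>2) \<partial>cellM)"
  proof (rule nn_integral_mono)
    fix v assume "v \<in> space cellM"
    then have v: "v \<in> unit_cell" by simp
    show "(\<integral>\<^sup>+k. ennreal ((norm (F (k, v)))\<^sup>2) \<partial>latM) \<le> ennreal (D\<^sup>2)"
      unfolding L2_nn_integral[OF s(1)[OF v]] using s(2)[OF v] by (intro ennreal_leI power_mono) auto
  qed
  also have "\<dots> = ennreal (D\<^sup>2)" by (simp add: cellM.emeasure_space_1[simplified])
  finally have b: "(\<integral>\<^sup>+p. ennreal ((norm (F p))\<^sup>2) \<partial>PM) \<le> ennreal (D\<^sup>2)" .
  from in_L2I_nn[OF m b] show "in_L2 PM F" by simp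
  from in_L2I_nn[OF m b] have "(L2n PM F)\<^sup>2 \<le> D\<^sup>2" by simp
  then show "L2n PM F \<le> D" using D by (rule power2_le_imp_le)
qed

lemma L2_Pair:
  assumes "in_L2 M F" "in_L2 M H"
  shows "in_L2 M (\<lambda>x. (F x, H x))" "(L2n M (\<lambda>x. (F x, H x)))\<^sup>2 = (L2n M F)\<^sup>2 + (L2n M H)\<^sup>2"
proof -
  have [measurable]: "F \<in> borel_measurable M" "H \<in> borel_measurable M" using assms by (auto intro: in_L2_measurable)
  have n: "(norm (F x, H x))\<^sup>2 = (norm (F x))\<^sup>2 + (norm (H x))\<^sup>2" for x by (simp add: norm_Pair)
  show "in_L2 M (\<lambda>x. (F x, H x))"
    unfolding in_L2_def n using assms by (auto simp: in_L2_def intro!: borel_measurable_Pair)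
  show "(L2n M (\<lambda>x. (F x, H x)))\<^sup>2 = (L2n M F)\<^sup>2 + (L2n M H)\<^sup>2"
    unfolding L2n_sq n using assms by (simp add: in_L2_def)
qed

lemma iexp_taylor0: "cmod (exp (\<i> * complex_of_real t) - 1) \<le> \<bar>t\<bar>"
proof -
  have "cmod (iexp t - (\<Sum>k\<le>0. (\<i> * complex_of_real t)^k / fact k)) \<le> \<bar>t\<bar>^(Suc 0) / fact (Suc 0)"
    by (rule iexp_approx1)
  then show ?thesis by simp
qed

lemma iexp_taylor2: "cmod (exp (\<i> * complex_of_real t) - complex_of_real (1 - t\<^sup>2 / 2) - \<i> * complex_of_real t) \<le> \<bar>t\<bar>^3 / 6"
proof -
  have 1: "cmod (iexp t - (\<Sum>k\<le>2. (\<i> * complex_of_real t)^k / fact k)) \<le> \<bar>t\<bar>^(Suc 2) / fact (Suc 2)"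
    by (rule iexp_approx1)
  have 2: "(\<Sum>k\<le>2. (\<i> * complex_of_real t)^k / fact k) = complex_of_real (1 - t\<^sup>2 / 2) + \<i> * complex_of_real t"
    by (simp add: numeral_2_eq_2 power2_eq_square algebra_simps)
  have 3: "\<bar>t\<bar>^(Suc 2) / fact (Suc 2) = \<bar>t\<bar>^3 / 6" by (simp add: eval_nat_numeral)
  show ?thesis using 1 unfolding 2 3 diff_diff_eq .
qed

text \<open>The second-order Taylor polynomial of \<open>exp (i \<xi> \<bullet> v)\<close>, with \<open>\<xi> = (a, b)\<close>, minus its linear interpolant on
the cell. The real part consists of the three Bernoulli profiles and the constant \<open>(a\<^sup>2 + a b + b\<^sup>2) / 12\<close>,
which the correction of the spline coefficients removes. The imaginary part vanishes because linear
functions are reproduced.\<close>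

lemma cell_quadratic_identity:
  fixes a b :: real
  assumes v: "v \<in> unit_cell"
  shows "(1 - (a * v$1 + b * v$2)\<^sup>2 / 2)
     - (hat (vector [0, 0]) v * 1 + hat (vector [1, 0]) v * (1 - a\<^sup>2 / 2) + hat (vector [0, 1]) v * (1 - b\<^sup>2 / 2) + hat (vector [1, 1]) v * (1 - (a + b)\<^sup>2 / 2))
     + - (a\<^sup>2 + a * b + b\<^sup>2) / 12
     - (half_bernoulli (v$1) * - (a\<^sup>2 + a * b) + half_bernoulli (v$2) * - (b\<^sup>2 + a * b) + - half_bernoulli \<bar>v$1 - v$2\<bar> * - (a * b)) = 0"
    "(a * v$1 + b * v$2) - (hat (vector [0, 0]) v * 0 + hat (vector [1, 0]) v * a + hat (vector [0, 1]) v * b + hat (vector [1, 1]) v * (a + b)) = 0"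
proof -
  define x y where "x = v$1" and "y = v$2"
  consider "y \<le> x" | "x < y" by linarith
  then have "(1 - (a * x + b * y)\<^sup>2 / 2)
     - ((1 - max x y) * 1 + max (x - y) 0 * (1 - a\<^sup>2 / 2) + max (y - x) 0 * (1 - b\<^sup>2 / 2) + min x y * (1 - (a + b)\<^sup>2 / 2))
     + - (a\<^sup>2 + a * b + b\<^sup>2) / 12
     - (half_bernoulli x * - (a\<^sup>2 + a * b) + half_bernoulli y * - (b\<^sup>2 + a * b) + - half_bernoulli \<bar>x - y\<bar> * - (a * b)) = 0
    \<and> (a * x + b * y) - ((1 - max x y) * 0 + max (x - y) 0 * a + max (y - x) 0 * b + min x y * (a + b)) = 0"
  proof cases
    case 1
    then have e: "max x y = x" "max (x - y) 0 = x - y" "max (y - x) 0 = 0" "min x y = y" "\<bar>x - y\<bar> = x - y" by auto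
    show ?thesis unfolding e half_bernoulli_def power2_eq_square by (simp add: field_simps)
  next
    case 2
    then have e: "max x y = y" "max (x - y) 0 = 0" "max (y - x) 0 = y - x" "min x y = x" "\<bar>x - y\<bar> = y - x" by auto
    show ?thesis unfolding e half_bernoulli_def power2_eq_square by (simp add: field_simps)
  qed
  then show "(1 - (a * v$1 + b * v$2)\<^sup>2 / 2)
     - (hat (vector [0, 0]) v * 1 + hat (vector [1, 0]) v * (1 - a\<^sup>2 / 2) + hat (vector [0, 1]) v * (1 - b\<^sup>2 / 2) + hat (vector [1, 1]) v * (1 - (a + b)\<^sup>2 / 2))
     + - (a\<^sup>2 + a * b + b\<^sup>2) / 12
     - (half_bernoulli (v$1) * - (a\<^sup>2 + a * b) + half_bernoulli (v$2) * - (b\<^sup>2 + a * b) + - half_bernoulli \<bar>v$1 - v$2\<bar> * - (a * b)) = 0"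
    "(a * v$1 + b * v$2) - (hat (vector [0, 0]) v * 0 + hat (vector [1, 0]) v * a + hat (vector [0, 1]) v * b + hat (vector [1, 1]) v * (a + b)) = 0"
    unfolding hat_cell[OF v] x_def y_def by blast+
qed

text \<open>The setting of the local analysis: a real function with spectrum \<open>G\<close> in the ball of radius \<open>B\<close>, and a grid
fine enough that its frequencies in grid coordinates have size at most \<open>\<tau> \<le> \<pi>\<close>.\<close>

locale fine_grid =
  fixes X :: "real^2^2" and B \<tau> :: real and G :: "real^2 \<Rightarrow> complex"
  assumes det: "det X \<noteq> 0" and G: "spectrum_in B G" and sym: "\<And>w. G (- w) = cnj (G w)"
    and freq: "\<And>w. norm w \<le> B \<Longrightarrow> \<bar>xi X w $ 1\<bar> + \<bar>xi X w $ 2\<bar> \<le> \<tau>" and tau: "0 \<le> \<tau>" "\<tau> \<le> pi"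
begin

text \<open>Samples at the lattice points of the function with spectrum \<open>p G\<close>. Every sequence and every residual
below has this form for a suitable symbol \<open>p\<close>.\<close>

definition sampled :: "(real^2 \<Rightarrow> complex) \<Rightarrow> int^2 \<Rightarrow> real" where
  "sampled p k = Re (IFT (\<lambda>w. p w * G w) (X *v real_of_int_vec k))"

text \<open>The factor by which a bound on a symbol is turned into a bound on the samples.\<close>

definition K :: real where "K = 2 * pi / sqrt \<bar>det X\<bar> * L2n lborel G"

lemma K_nonneg: "0 \<le> K" unfolding K_def by (intro mult_nonneg_nonneg divide_nonneg_nonneg) auto

lemma sampled_bound:
  assumes p: "continuous_on UNIV p" and c: "\<And>w. norm w \<le> B \<Longrightarrow> cmod (p w) \<le> c" "0 \<le> c"
  shows "in_L2 latM (sampled p)" "L2n latM (sampled p) \<le> c * K"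
proof -
  note b = spectrum_in_mult_bound[OF G p c]
  have s: "\<bar>xi X w $ i\<bar> \<le> pi" if "p w * G w \<noteq> 0" for w i
  proof -
    have "norm w \<le> B" using spectrum_in_bound[OF G, of w] that by auto
    from freq[OF this] show ?thesis using tau exhaust_2[of i] by auto
  qed
  note be = bessel[OF det b(1) s]
  let ?c = "\<lambda>k. IFT (\<lambda>w. p w * G w) (X *v real_of_int_vec k)"
  have "L2n latM ?c \<le> 2 * pi / sqrt \<bar>det X\<bar> * L2n lborel (\<lambda>w. p w * G w)"
  proof (rule power2_le_imp_le)
    show "(L2n latM ?c)\<^sup>2 \<le> (2 * pi / sqrt \<bar>det X\<bar> * L2n lborel (\<lambda>w. p w * G w))\<^sup>2"
      using be(2) by (simp add: power_mult_distrib power_divide)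
  qed simp
  also have "\<dots> \<le> 2 * pi / sqrt \<bar>det X\<bar> * (c * L2n lborel G)" by (intro mult_left_mono b divide_nonneg_nonneg) auto
  finally have c1: "L2n latM ?c \<le> c * K" by (simp add: K_def mult_ac)
  have r: "norm (sampled p k) \<le> 1 * norm (?c k)" for k by (simp add: sampled_def abs_Re_le_cmod)
  have m: "sampled p \<in> borel_measurable latM" by (simp add: latM_def)
  show "in_L2 latM (sampled p)" by (rule in_L2_bound(1)[OF be(1) m r])
  have "L2n latM (sampled p) \<le> 1 * L2n latM ?c" by (rule in_L2_bound(2)[OF be(1) m r]) simp_all
  then show "L2n latM (sampled p) \<le> c * K" using c1 by simp
qed

lemma sampled_diff: "continuous_on UNIV p \<Longrightarrow> continuous_on UNIV q \<Longrightarrow> sampled (\<lambda>w. p w - q w) k = sampled p k - sampled q k"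
  by (simp add: sampled_def IFT_mult_diff[OF G])

lemma sampled_add: "continuous_on UNIV p \<Longrightarrow> continuous_on UNIV q \<Longrightarrow> sampled (\<lambda>w. p w + q w) k = sampled p k + sampled q k"
  by (simp add: sampled_def IFT_mult_add[OF G])

lemma sampled_cmult: "sampled (\<lambda>w. complex_of_real a * p w) k = a * sampled p k"
  unfolding sampled_def mult.assoc IFT_cmult by simp

lemma sampled_sum:
  assumes "finite I" "\<And>i. i \<in> I \<Longrightarrow> continuous_on UNIV (p i)"
  shows "sampled (\<lambda>w. \<Sum>i\<in>I. p i w) k = (\<Sum>i\<in>I. sampled (p i) k)"
  using assms
proof (induction I rule: finite_induct)
  case empty
  then show ?case by (simp add: sampled_def IFT_def)
next
  case (insert i I)
  then have "continuous_on UNIV (\<lambda>w. \<Sum>i\<in>I. p i w)" by (intro continuous_on_sum) auto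
  with insert show ?case by (simp add: sampled_add)
qed

definition shift_symbol :: "real^2 \<Rightarrow> real^2 \<Rightarrow> complex" where
  "shift_symbol v w = exp (\<i> * complex_of_real (xi X w \<bullet> v))"

lemma sampled_shift: "Re (IFT (\<lambda>w. p w * G w) (X *v (real_of_int_vec k + v))) = sampled (\<lambda>w. shift_symbol v w * p w) k"
  unfolding sampled_def matrix_vector_right_distrib IFT_shift xi_inner[symmetric] shift_symbol_def mult.assoc ..

lemma sampled_index_shift: "sampled p (i + k) = sampled (\<lambda>w. shift_symbol (real_of_int_vec i) w * p w) k"
  using sampled_shift[of p k "real_of_int_vec i"] by (simp add: sampled_def real_of_int_vec_add add.commute)

lemma xi_cont: "continuous_on UNIV (\<lambda>w. xi X w \<bullet> v)" "continuous_on UNIV (\<lambda>w. xi X w $ i)"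
proof -
  show a: "continuous_on UNIV (\<lambda>w. xi X w \<bullet> v)" for v
    unfolding xi_inner[symmetric] by (intro continuous_intros)
  show "continuous_on UNIV (\<lambda>w. xi X w $ i)"
    using a[of "axis i 1"] by (simp add: inner_axis)
qed

lemma shift_symbol_cont: "continuous_on UNIV (shift_symbol v)"
  unfolding shift_symbol_def by (intro continuous_intros xi_cont)

text \<open>The symbols of \<open>\<partial>\<^sub>1\<^sub>1 + \<partial>\<^sub>1\<^sub>2\<close>, \<open>\<partial>\<^sub>2\<^sub>2 + \<partial>\<^sub>1\<^sub>2\<close> and \<open>\<partial>\<^sub>1\<^sub>2\<close> in grid coordinates.\<close>

definition residual_symbol :: "nat \<Rightarrow> real^2 \<Rightarrow> real" where
  "residual_symbol j w = (let a = xi X w $ 1; b = xi X w $ 2 in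
     if j = 0 then - (a\<^sup>2 + a * b) else if j = 1 then - (b\<^sup>2 + a * b) else - (a * b))"

text \<open>The symbol of \<open>\<partial>\<^sub>1\<^sub>1 + \<partial>\<^sub>1\<^sub>2 + \<partial>\<^sub>2\<^sub>2\<close> in grid coordinates.\<close>

definition hessian_symbol :: "real^2 \<Rightarrow> real" where
  "hessian_symbol w = (let a = xi X w $ 1; b = xi X w $ 2 in - (a\<^sup>2 + a * b + b\<^sup>2))"

lemma residual_symbol_cont: "continuous_on UNIV (residual_symbol j)" "continuous_on UNIV hessian_symbol"
proof -
  have "j = 0 \<or> j = 1 \<or> (j \<noteq> 0 \<and> j \<noteq> 1)" by blast
  then show "continuous_on UNIV (residual_symbol j)"
    by (elim disjE conjE) (simp_all add: residual_symbol_def Let_def, (intro continuous_intros xi_cont)+)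
  show "continuous_on UNIV hessian_symbol" unfolding hessian_symbol_def Let_def by (intro continuous_intros xi_cont)
qed

lemma symbol_bounds:
  assumes "norm w \<le> B"
  shows "\<bar>residual_symbol j w\<bar> \<le> \<tau>\<^sup>2" "\<bar>hessian_symbol w\<bar> \<le> \<tau>\<^sup>2"
proof -
  let ?a = "xi X w $ 1" and ?b = "xi X w $ 2"
  have "(\<bar>?a\<bar> + \<bar>?b\<bar>)\<^sup>2 \<le> \<tau>\<^sup>2" using freq[OF assms] by (intro power_mono) auto
  then have t: "\<bar>?a\<bar>\<^sup>2 + \<bar>?b\<bar>\<^sup>2 + 2 * \<bar>?a * ?b\<bar> \<le> \<tau>\<^sup>2" by (simp add: power2_sum abs_mult)
  have n: "0 \<le> ?a\<^sup>2" "0 \<le> ?b\<^sup>2" "0 \<le> \<bar>?a * ?b\<bar>" by auto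
  have t': "?a\<^sup>2 + ?b\<^sup>2 + 2 * \<bar>?a * ?b\<bar> \<le> \<tau>\<^sup>2" using t by simp
  have "residual_symbol j w = - (?a\<^sup>2 + ?a * ?b) \<or> residual_symbol j w = - (?b\<^sup>2 + ?a * ?b) \<or> residual_symbol j w = - (?a * ?b)"
    by (simp add: residual_symbol_def Let_def)
  then show "\<bar>residual_symbol j w\<bar> \<le> \<tau>\<^sup>2"
  proof (elim disjE)
    assume "residual_symbol j w = - (?a\<^sup>2 + ?a * ?b)"
    then show ?thesis using t' n by linarith
  next
    assume "residual_symbol j w = - (?b\<^sup>2 + ?a * ?b)"
    then show ?thesis using t' n by linarith
  next
    assume "residual_symbol j w = - (?a * ?b)"
    then show ?thesis using t' n by linarith
  qed
  have "hessian_symbol w = - (?a\<^sup>2 + ?a * ?b + ?b\<^sup>2)" by (simp add: hessian_symbol_def Let_def)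
  then show "\<bar>hessian_symbol w\<bar> \<le> \<tau>\<^sup>2" using t' n by linarith
qed

lemma freq_inner:
  assumes w: "norm w \<le> B" and v: "\<And>i. 0 \<le> v $ i \<and> v $ i \<le> 1"
  shows "\<bar>xi X w \<bullet> v\<bar> \<le> \<tau>"
proof -
  have "\<bar>xi X w \<bullet> v\<bar> \<le> \<bar>xi X w $ 1\<bar> * v$1 + \<bar>xi X w $ 2\<bar> * v$2"
    unfolding inner_vec2 using v[of 1] v[of 2] by (metis abs_mult abs_of_nonneg abs_triangle_ineq)
  also have "\<dots> \<le> \<bar>xi X w $ 1\<bar> * 1 + \<bar>xi X w $ 2\<bar> * 1"
    using v[of 1] v[of 2] by (intro add_mono mult_left_mono) auto
  finally show ?thesis using freq[OF w] by simp
qed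

lemma cell_unit: "v \<in> unit_cell \<Longrightarrow> 0 \<le> v $ i \<and> v $ i \<le> 1"
  by (auto simp: unit_cell_def less_imp_le)

lemma corner_unit: "j \<in> corners \<Longrightarrow> 0 \<le> real_of_int_vec j $ i \<and> real_of_int_vec j $ i \<le> 1"
  using exhaust_2[of i] by (auto simp: corners_def)

text \<open>The correction by a twelfth of the second-order term makes the leading residual have mean zero over each
cell, as is necessary for near-orthogonality to the splines.\<close>

definition quasi_coeff :: "int^2 \<Rightarrow> real" where "quasi_coeff = sampled (\<lambda>w. complex_of_real (1 - hessian_symbol w / 12))"

definition leading_residual :: "(int^2) \<times> (real^2) \<Rightarrow> real" where
  "leading_residual p = (\<Sum>j<3. sampled (\<lambda>w. complex_of_real (residual_symbol j w)) (fst p) * cell_residual j (snd p))"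

definition cell_values :: "(int^2) \<times> (real^2) \<Rightarrow> real" where
  "cell_values p = Re (IFT G (X *v (real_of_int_vec (fst p) + snd p)))"

definition remainder_symbol :: "real^2 \<Rightarrow> real^2 \<Rightarrow> complex" where
  "remainder_symbol v w = shift_symbol v w - (\<Sum>i\<in>corners. complex_of_real (hat i v) * (shift_symbol (real_of_int_vec i) w * complex_of_real (1 - hessian_symbol w / 12)))
     - (\<Sum>j<3. complex_of_real (cell_residual j v) * complex_of_real (residual_symbol j w))"

lemma residual_sampled: "cell_values (k, v) - cpwl quasi_coeff k v - leading_residual (k, v) = sampled (remainder_symbol v) k"
proof -
  have c1: "continuous_on UNIV (\<lambda>w. complex_of_real (hat i v) * (shift_symbol (real_of_int_vec i) w * complex_of_real (1 - hessian_symbol w / 12)))" for i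
    by (intro continuous_intros shift_symbol_cont residual_symbol_cont) auto
  have c2: "continuous_on UNIV (\<lambda>w. complex_of_real (cell_residual j v) * complex_of_real (residual_symbol j w))" for j
    by (intro continuous_intros residual_symbol_cont)
  have g: "cell_values (k, v) = sampled (shift_symbol v) k"
    using sampled_shift[of "\<lambda>w. 1" k v] by (simp add: cell_values_def)
  have c: "cpwl quasi_coeff k v = sampled (\<lambda>w. \<Sum>i\<in>corners. complex_of_real (hat i v) * (shift_symbol (real_of_int_vec i) w * complex_of_real (1 - hessian_symbol w / 12))) k"
    by (subst sampled_sum[OF finite_corners c1]) (simp_all only: cpwl_def quasi_coeff_def sampled_index_shift sampled_cmult)
  have e: "leading_residual (k, v) = sampled (\<lambda>w. \<Sum>j<3. complex_of_real (cell_residual j v) * complex_of_real (residual_symbol j w)) k"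
    by (subst sampled_sum[OF finite_lessThan c2]) (simp_all only: leading_residual_def sampled_cmult fst_conv snd_conv mult.commute)
  show ?thesis unfolding g c e remainder_symbol_def
    by (subst sampled_diff, intro continuous_intros shift_symbol_cont c1, intro continuous_intros c2,
        subst sampled_diff, rule shift_symbol_cont, intro continuous_intros c1, rule refl)
qed

text \<open>Modulo terms of third order the exponentials are their quadratic Taylor polynomials, for which
\<open>cell_quadratic_identity\<close> says that nothing remains.\<close>

lemma remainder_symbol_bound:
  assumes v: "v \<in> unit_cell" and w: "norm w \<le> B"
  shows "cmod (remainder_symbol v w) \<le> \<tau>^3"
proof -
  let ?a = "xi X w $ 1" and ?b = "xi X w $ 2"
  \<comment> \<open>P is the quadratic Taylor polynomial of the exponential and R its remainder.\<close>
  define P where "P z = complex_of_real (1 - z\<^sup>2 / 2) + \<i> * complex_of_real z" for z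
  define R where "R z = exp (\<i> * complex_of_real z) - P z" for z
  define z where "z i = xi X w \<bullet> real_of_int_vec i" for i
  have R: "cmod (R t) \<le> \<tau>^3 / 6" if "\<bar>t\<bar> \<le> \<tau>" for t
  proof -
    have "cmod (R t) \<le> \<bar>t\<bar>^3 / 6" using iexp_taylor2[of t] by (simp add: R_def P_def algebra_simps)
    also have "\<dots> \<le> \<tau>^3 / 6" using that by (intro divide_right_mono power_mono) auto
    finally show ?thesis .
  qed
  have zi: "\<bar>z i\<bar> \<le> \<tau>" if "i \<in> corners" for i
    unfolding z_def by (rule freq_inner[OF w corner_unit[OF that]])
  have zv: "\<bar>xi X w \<bullet> v\<bar> \<le> \<tau>" by (rule freq_inner[OF w cell_unit[OF v]])
  have hs: "(\<Sum>i\<in>corners. complex_of_real (hat i v)) = 1"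
    using hat_sums(1)[OF v] by (metis of_real_1 of_real_sum)
  have poly: "P (xi X w \<bullet> v) - (\<Sum>i\<in>corners. complex_of_real (hat i v) * P (z i)) + complex_of_real (hessian_symbol w / 12)
      - (\<Sum>j<3. complex_of_real (cell_residual j v) * complex_of_real (residual_symbol j w)) = 0"
  proof -
    have s3: "(\<Sum>j<3. f j) = f 0 + f 1 + f (2::nat)" for f :: "nat \<Rightarrow> complex"
      by (simp add: eval_nat_numeral)
    have zz: "z (vector [0, 0]) = 0" "z (vector [1, 0]) = ?a" "z (vector [0, 1]) = ?b" "z (vector [1, 1]) = ?a + ?b"
      by (simp_all add: z_def inner_vec2)
    have r: "cell_residual 0 v = half_bernoulli (v$1)" "cell_residual 1 v = half_bernoulli (v$2)" "cell_residual 2 v = - half_bernoulli \<bar>v$1 - v$2\<bar>"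
      "residual_symbol 0 w = - (?a\<^sup>2 + ?a * ?b)" "residual_symbol 1 w = - (?b\<^sup>2 + ?a * ?b)" "residual_symbol 2 w = - (?a * ?b)" "hessian_symbol w = - (?a\<^sup>2 + ?a * ?b + ?b\<^sup>2)"
      by (simp_all add: cell_residual_def residual_symbol_def hessian_symbol_def Let_def)
    have PR: "complex_of_real h * P t = complex_of_real (h * (1 - t\<^sup>2 / 2)) + \<i> * complex_of_real (h * t)" for h t
      by (simp add: P_def algebra_simps)
    have P1: "P t = complex_of_real (1 - t\<^sup>2 / 2) + \<i> * complex_of_real t" for t by (simp add: P_def)
    note q = cell_quadratic_identity[OF v, of ?a ?b]
    have "P (xi X w \<bullet> v) - (\<Sum>i\<in>corners. complex_of_real (hat i v) * P (z i)) + complex_of_real (hessian_symbol w / 12)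
      - (\<Sum>j<3. complex_of_real (cell_residual j v) * complex_of_real (residual_symbol j w))
      = complex_of_real ((1 - (?a * v$1 + ?b * v$2)\<^sup>2 / 2)
     - (hat (vector [0, 0]) v * 1 + hat (vector [1, 0]) v * (1 - ?a\<^sup>2 / 2) + hat (vector [0, 1]) v * (1 - ?b\<^sup>2 / 2) + hat (vector [1, 1]) v * (1 - (?a + ?b)\<^sup>2 / 2))
     + - (?a\<^sup>2 + ?a * ?b + ?b\<^sup>2) / 12
     - (half_bernoulli (v$1) * - (?a\<^sup>2 + ?a * ?b) + half_bernoulli (v$2) * - (?b\<^sup>2 + ?a * ?b) + - half_bernoulli \<bar>v$1 - v$2\<bar> * - (?a * ?b)))
     + \<i> * complex_of_real ((?a * v$1 + ?b * v$2) - (hat (vector [0, 0]) v * 0 + hat (vector [1, 0]) v * ?a + hat (vector [0, 1]) v * ?b + hat (vector [1, 1]) v * (?a + ?b)))"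
      unfolding sum_corners s3 zz PR P1 r inner_vec2[of "xi X w"] of_real_add of_real_diff of_real_mult of_real_minus
      by (simp add: algebra_simps)
    then show ?thesis unfolding q by simp
  qed
  have chz: "shift_symbol (real_of_int_vec i) w = R (z i) + P (z i)" "shift_symbol v w = R (xi X w \<bullet> v) + P (xi X w \<bullet> v)" for i
    by (simp_all add: shift_symbol_def R_def z_def)
  have "(\<Sum>i\<in>corners. complex_of_real (hat i v) * (shift_symbol (real_of_int_vec i) w * complex_of_real (1 - hessian_symbol w / 12)))
    = (\<Sum>i\<in>corners. complex_of_real (hat i v) * R (z i)) + (\<Sum>i\<in>corners. complex_of_real (hat i v) * P (z i))
     - complex_of_real (hessian_symbol w / 12) * (\<Sum>i\<in>corners. complex_of_real (hat i v) * shift_symbol (real_of_int_vec i) w)"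
    unfolding sum_distrib_left sum.distrib[symmetric] sum_subtractf[symmetric]
    by (intro sum.cong refl) (simp add: chz algebra_simps)
  moreover have "(\<Sum>i\<in>corners. complex_of_real (hat i v) * shift_symbol (real_of_int_vec i) w)
    = (\<Sum>i\<in>corners. complex_of_real (hat i v) * (shift_symbol (real_of_int_vec i) w - 1)) + 1"
    using hs by (simp add: right_diff_distrib sum_subtractf)
  ultimately have "remainder_symbol v w = R (xi X w \<bullet> v) - (\<Sum>i\<in>corners. complex_of_real (hat i v) * R (z i))
     + complex_of_real (hessian_symbol w / 12) * (\<Sum>i\<in>corners. complex_of_real (hat i v) * (shift_symbol (real_of_int_vec i) w - 1))
     + (P (xi X w \<bullet> v) - (\<Sum>i\<in>corners. complex_of_real (hat i v) * P (z i)) + complex_of_real (hessian_symbol w / 12)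
      - (\<Sum>j<3. complex_of_real (cell_residual j v) * complex_of_real (residual_symbol j w)))"
    unfolding remainder_symbol_def chz(2) by (simp only:) (simp add: algebra_simps)
  then have remainder_symbol: "remainder_symbol v w = R (xi X w \<bullet> v) - (\<Sum>i\<in>corners. complex_of_real (hat i v) * R (z i))
     + complex_of_real (hessian_symbol w / 12) * (\<Sum>i\<in>corners. complex_of_real (hat i v) * (shift_symbol (real_of_int_vec i) w - 1))"
    unfolding poly by simp
  have av: "cmod (\<Sum>i\<in>corners. complex_of_real (hat i v) * y i) \<le> c" if "\<And>i. i \<in> corners \<Longrightarrow> cmod (y i) \<le> c" for y c
  proof -
    have "cmod (\<Sum>i\<in>corners. complex_of_real (hat i v) * y i) \<le> (\<Sum>i\<in>corners. cmod (complex_of_real (hat i v) * y i))" by (rule norm_sum)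
    also have "\<dots> \<le> (\<Sum>i\<in>corners. hat i v * c)"
      using hat_bounds[OF v] that by (intro sum_mono) (simp add: norm_mult mult_left_mono)
    also have "\<dots> = c" using hat_sums(1)[OF v] by (simp add: sum_distrib_right[symmetric])
    finally show ?thesis .
  qed
  have "cmod (\<Sum>i\<in>corners. complex_of_real (hat i v) * R (z i)) \<le> \<tau>^3 / 6" by (rule av) (intro R zi)
  moreover have "cmod (\<Sum>i\<in>corners. complex_of_real (hat i v) * (shift_symbol (real_of_int_vec i) w - 1)) \<le> \<tau>"
  proof (rule av)
    fix i assume "i \<in> corners"
    then show "cmod (shift_symbol (real_of_int_vec i) w - 1) \<le> \<tau>"
      using iexp_taylor0[of "z i"] zi[of i] by (simp add: shift_symbol_def z_def)
  qed
  moreover have "cmod (complex_of_real (hessian_symbol w / 12)) \<le> \<tau>\<^sup>2 / 12" using symbol_bounds(2)[OF w] by simp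
  ultimately have m: "cmod (complex_of_real (hessian_symbol w / 12) * (\<Sum>i\<in>corners. complex_of_real (hat i v) * (shift_symbol (real_of_int_vec i) w - 1))) \<le> \<tau>\<^sup>2 / 12 * \<tau>"
    "cmod (\<Sum>i\<in>corners. complex_of_real (hat i v) * R (z i)) \<le> \<tau>^3 / 6"
    unfolding norm_mult by (auto intro!: mult_mono)
  have "cmod (remainder_symbol v w) \<le> \<tau>^3 / 6 + \<tau>^3 / 6 + \<tau>\<^sup>2 / 12 * \<tau>"
    unfolding remainder_symbol using R[OF zv] m by (intro order_trans[OF norm_triangle_ineq] add_mono order_trans[OF norm_triangle_ineq4])
  also have "\<dots> \<le> \<tau>^3" using tau by (simp add: power2_eq_square power3_eq_cube)
  finally show ?thesis .
qed

end

section \<open>Norm and near-orthogonality of the leading residual\<close>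

lemma split_difference: "a * d = b * d + (a - b) * d" for a b d :: real
  by (simp add: algebra_simps)

context fine_grid
begin

lemma residual_symbol_bound: "norm w \<le> B \<Longrightarrow> cmod (complex_of_real (residual_symbol j w)) \<le> \<tau>\<^sup>2"
  using symbol_bounds(1) by simp

lemma sampled_residual_symbol_L2: "in_L2 latM (sampled (\<lambda>w. complex_of_real (residual_symbol j w)))"
  by (rule sampled_bound(1)[where c="\<tau>\<^sup>2"]) (auto intro!: continuous_intros residual_symbol_cont symbol_bounds(1))

lemma quasi_coeff_L2: "in_L2 latM quasi_coeff"
  unfolding quasi_coeff_def
proof (rule sampled_bound(1)[where c="1 + \<tau>\<^sup>2"])
  show "continuous_on UNIV (\<lambda>w. complex_of_real (1 - hessian_symbol w / 12))" by (intro continuous_intros residual_symbol_cont) auto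
  show "cmod (complex_of_real (1 - hessian_symbol w / 12)) \<le> 1 + \<tau>\<^sup>2" if "norm w \<le> B" for w
  proof -
    have "\<bar>1 - hessian_symbol w / 12\<bar> \<le> 1 + \<tau>\<^sup>2" using symbol_bounds(2)[OF that] by linarith
    then show ?thesis by (simp only: norm_of_real)
  qed
qed simp

lemma cell_values_measurable: "cell_values \<in> borel_measurable PM"
proof -
  have "(\<lambda>x. Re (IFT G x)) \<in> borel_measurable borel"
    by (rule borel_measurable_continuous_onI[OF IFT_continuous[OF G]])
  from lattice_measurable[OF this, of X] show ?thesis by (simp add: cell_values_def[abs_def])
qed

lemma leading_residual_L2: "in_L2 PM leading_residual"
  unfolding leading_residual_def[abs_def]
  by (intro in_L2_sum in_L2_tensor[where B=1] sampled_residual_symbol_L2 cell_residual_measurable cell_residual_bound)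

definition remainder :: "(int^2) \<times> (real^2) \<Rightarrow> real" where
  "remainder p = cell_values p - cpwl quasi_coeff (fst p) (snd p) - leading_residual p"

lemma remainder_bound: "in_L2 PM remainder" "L2n PM remainder \<le> \<tau>^3 * K"
proof -
  have m: "remainder \<in> borel_measurable PM"
    unfolding remainder_def[abs_def] by (intro borel_measurable_diff cell_values_measurable cpwl_measurable in_L2_measurable[OF leading_residual_L2])
  have c: "continuous_on UNIV (remainder_symbol v)" for v
    unfolding remainder_symbol_def by (intro continuous_intros shift_symbol_cont residual_symbol_cont) auto
  have e: "(\<lambda>k. remainder (k, v)) = sampled (remainder_symbol v)" for v
    by (rule ext) (simp add: remainder_def residual_sampled)
  have "0 \<le> \<tau>^3 * K" using tau K_nonneg by simp
  moreover have "in_L2 latM (\<lambda>k. remainder (k, v))" "L2n latM (\<lambda>k. remainder (k, v)) \<le> \<tau>^3 * K" if "v \<in> unit_cell" for v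
    unfolding e using remainder_symbol_bound[OF that] tau by (auto intro!: sampled_bound[OF c])
  ultimately show "in_L2 PM remainder" "L2n PM remainder \<le> \<tau>^3 * K"
    using PM_slices[OF m] by blast+
qed

lemma integral_latM_mult: 
  fixes a b :: "int^2 \<Rightarrow> real"
  assumes "in_L2 latM a" "in_L2 latM b" shows "integrable latM (\<lambda>k. a k * b k)"
  by (rule Cauchy_Schwarz_integral(1)[OF assms])

text \<open>The double sum over profiles collapses to its diagonal because the profiles are orthogonal.\<close>

lemma leading_residual_norm: "(L2n PM leading_residual)\<^sup>2 = (\<Sum>j<3. (L2n latM (sampled (\<lambda>w. complex_of_real (residual_symbol j w))))\<^sup>2) / 720"
proof -
  let ?s = "\<lambda>j. sampled (\<lambda>w. complex_of_real (residual_symbol j w))"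
  have bi: "integrable cellM (\<lambda>v. cell_residual j v * cell_residual l v)" for j l
  proof (rule cellM_bounded_integrable[where B=1])
    show "\<bar>cell_residual j v * cell_residual l v\<bar> \<le> 1" if "v \<in> unit_cell" for v
      using mult_mono[OF cell_residual_bound[OF that, of j] cell_residual_bound[OF that, of l]] by (simp add: abs_mult)
  qed measurable
  note T = PM_tensor[OF integral_latM_mult[OF sampled_residual_symbol_L2 sampled_residual_symbol_L2] bi]
  have "(L2n PM leading_residual)\<^sup>2 = (\<integral>p. (\<Sum>j<3. \<Sum>l<3. (?s j (fst p) * ?s l (fst p)) * (cell_residual j (snd p) * cell_residual l (snd p))) \<partial>PM)"
    unfolding L2n_sq leading_residual_def real_norm_def power2_abs unfolding power2_eq_square sum_product
    by (intro Bochner_Integration.integral_cong sum.cong refl) (simp only: mult_ac)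
  also have "\<dots> = (\<Sum>j<3. \<Sum>l<3. (\<integral>p. (?s j (fst p) * ?s l (fst p)) * (cell_residual j (snd p) * cell_residual l (snd p)) \<partial>PM))"
    using T(1) by (simp add: Bochner_Integration.integral_sum)
  also have "\<dots> = (\<Sum>j<3. \<Sum>l<3. (\<integral>k. ?s j k * ?s l k \<partial>latM) * (\<integral>v. cell_residual j v * cell_residual l v \<partial>cellM))"
    unfolding T(2) ..
  also have "\<dots> = (\<Sum>j<3. \<Sum>l<3. if j = l then (\<integral>k. ?s j k * ?s j k \<partial>latM) / 720 else 0)"
    by (intro sum.cong refl) (simp add: cell_residual_gram)
  also have "\<dots> = (\<Sum>j<3. (\<integral>k. ?s j k * ?s j k \<partial>latM) / 720)"
    by (simp add: sum.delta)
  also have "\<dots> = (\<Sum>j<3. (L2n latM (?s j))\<^sup>2 / 720)"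
    unfolding L2n_sq real_norm_def power2_abs unfolding power2_eq_square ..
  finally show ?thesis by (simp add: sum_divide_distrib)
qed

text \<open>Moving a shift from the spline coefficients to the samples shows that, up to differences of samples at
neighbouring lattice points, each corner contributes the same sum, weighted by the integral of a profile
against its shape function. These weights add up to the mean of the profile, which is zero.\<close>

lemma leading_residual_orth:
  assumes d: "in_L2 latM d"
  shows "\<bar>\<integral>p. leading_residual p * cpwl d (fst p) (snd p) \<partial>PM\<bar> \<le> 12 * (\<tau>^3 * K) * L2n latM d"
proof -
  let ?s = "\<lambda>j. sampled (\<lambda>w. complex_of_real (residual_symbol j w))"
  let ?t = "\<lambda>j i. sampled (\<lambda>w. (shift_symbol (real_of_int_vec (- i)) w - 1) * complex_of_real (residual_symbol j w))"
  define \<kappa> where "\<kappa> j i = (\<integral>v. cell_residual j v * hat i v \<partial>cellM)" for j i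
  have bb: "\<bar>cell_residual j v * hat i v\<bar> \<le> 1" if "v \<in> unit_cell" "i \<in> corners" for j i v
    using mult_mono[OF cell_residual_bound[OF that(1), of j] hat_bounds(3)[OF that]] by (simp add: abs_mult)
  have bi: "integrable cellM (\<lambda>v. cell_residual j v * hat i v)" if "i \<in> corners" for j i
    by (rule cellM_bounded_integrable[OF _ bb]) (use that in \<open>auto\<close>)
  have \<kappa>1: "\<bar>\<kappa> j i\<bar> \<le> 1" if "i \<in> corners" for j i
  proof -
    have "\<bar>\<kappa> j i\<bar> \<le> (\<integral>v. \<bar>cell_residual j v * hat i v\<bar> \<partial>cellM)" unfolding \<kappa>_def by (rule integral_abs_bound)
    also have "\<dots> \<le> (\<integral>v. 1 \<partial>cellM)" by (rule integral_mono) (use bi[OF that] bb that in auto)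
    finally show ?thesis by (simp add: cellM.prob_space[simplified])
  qed
  have \<kappa>0: "(\<Sum>i\<in>corners. \<kappa> j i) = 0" for j
  proof -
    have "(\<Sum>i\<in>corners. \<kappa> j i) = (\<integral>v. (\<Sum>i\<in>corners. cell_residual j v * hat i v) \<partial>cellM)"
      unfolding \<kappa>_def by (rule Bochner_Integration.integral_sum[symmetric]) (rule bi)
    also have "\<dots> = (\<integral>v. cell_residual j v \<partial>cellM)"
      by (rule Bochner_Integration.integral_cong[OF refl]) (simp add: sum_distrib_left[symmetric] hat_sums(1))
    finally show ?thesis by (simp add: cell_residual_mean)
  qed
  have tc: "continuous_on UNIV (\<lambda>w. (shift_symbol v w - 1) * complex_of_real (residual_symbol j w))" for v j
    by (intro continuous_intros shift_symbol_cont residual_symbol_cont)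
  have corner: "\<bar>xi X w \<bullet> real_of_int_vec (- i)\<bar> \<le> \<tau>" if "i \<in> corners" "norm w \<le> B" for i w
  proof -
    have "real_of_int_vec (- i) = - real_of_int_vec i" by (simp add: vec_eq_iff)
    then show ?thesis using freq_inner[OF that(2) corner_unit[OF that(1)]] by simp
  qed
  have tb: "in_L2 latM (?t j i)" "L2n latM (?t j i) \<le> \<tau>^3 * K" if "i \<in> corners" for j i
  proof -
    have "cmod ((shift_symbol (real_of_int_vec (- i)) w - 1) * complex_of_real (residual_symbol j w)) \<le> \<tau>^3" if w: "norm w \<le> B" for w
    proof -
      have "cmod (shift_symbol (real_of_int_vec (- i)) w - 1) \<le> \<tau>"
        unfolding shift_symbol_def by (rule order_trans[OF iexp_taylor0 corner[OF \<open>i \<in> corners\<close> w]])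
      then have "cmod ((shift_symbol (real_of_int_vec (- i)) w - 1) * complex_of_real (residual_symbol j w)) \<le> \<tau> * \<tau>\<^sup>2"
        unfolding norm_mult using residual_symbol_bound[OF w] tau by (intro mult_mono) auto
      then show ?thesis by (simp add: power2_eq_square power3_eq_cube)
    qed
    then show "in_L2 latM (?t j i)" "L2n latM (?t j i) \<le> \<tau>^3 * K"
      using tau by (auto intro!: sampled_bound[OF tc])
  qed
  have sd: "(\<integral>k. ?s j k * d (i + k) \<partial>latM) = (\<integral>k. ?s j k * d k \<partial>latM) + (\<integral>k. ?t j i k * d k \<partial>latM)" if "i \<in> corners" for j i
  proof -
    have "(\<integral>k. ?s j k * d (i + k) \<partial>latM) = (\<integral>k. ?s j (- i + k) * d k \<partial>latM)"
      using latM_shift(3)[of "\<lambda>k. ?s j k * d (i + k)" "- i"] by simp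
    also have "\<dots> = (\<integral>k. ?s j k * d k + ?t j i k * d k \<partial>latM)"
    proof (rule Bochner_Integration.integral_cong[OF refl])
      fix k
      have "?t j i k = sampled (\<lambda>w. shift_symbol (real_of_int_vec (- i)) w * complex_of_real (residual_symbol j w) - complex_of_real (residual_symbol j w)) k"
        by (simp add: left_diff_distrib)
      also have "\<dots> = ?s j (- i + k) - ?s j k"
        unfolding sampled_index_shift by (rule sampled_diff) (intro continuous_intros shift_symbol_cont residual_symbol_cont)+
      finally have e: "?t j i k = ?s j (- i + k) - ?s j k" .
      show "?s j (- i + k) * d k = ?s j k * d k + ?t j i k * d k" unfolding e by (rule split_difference)
    qed
    also have "\<dots> = (\<integral>k. ?s j k * d k \<partial>latM) + (\<integral>k. ?t j i k * d k \<partial>latM)"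
      by (intro Bochner_Integration.integral_add integral_latM_mult sampled_residual_symbol_L2 d tb that)
    finally show ?thesis .
  qed
  have si: "integrable latM (\<lambda>k. ?s j k * d (i + k))" for j i
    by (intro integral_latM_mult sampled_residual_symbol_L2 latM_shift(1) d)
  have "(\<integral>p. leading_residual p * cpwl d (fst p) (snd p) \<partial>PM)
    = (\<integral>p. (\<Sum>j<3. \<Sum>i\<in>corners. (?s j (fst p) * d (i + fst p)) * (cell_residual j (snd p) * hat i (snd p))) \<partial>PM)"
    unfolding leading_residual_def cpwl_def sum_product
    by (intro Bochner_Integration.integral_cong sum.cong refl) (simp only: mult_ac)
  also have "\<dots> = (\<Sum>j<3. \<Sum>i\<in>corners. (\<integral>p. (?s j (fst p) * d (i + fst p)) * (cell_residual j (snd p) * hat i (snd p)) \<partial>PM))"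
    using PM_tensor(1)[OF si bi] by (simp add: Bochner_Integration.integral_sum)
  also have "\<dots> = (\<Sum>j<3. \<Sum>i\<in>corners. ((\<integral>k. ?s j k * d k \<partial>latM) + (\<integral>k. ?t j i k * d k \<partial>latM)) * \<kappa> j i)"
    by (intro sum.cong refl) (simp add: PM_tensor(2)[OF si bi] sd \<kappa>_def)
  also have "\<dots> = (\<Sum>j<3. \<Sum>i\<in>corners. (\<integral>k. ?t j i k * d k \<partial>latM) * \<kappa> j i)"
    by (simp add: distrib_right sum.distrib sum_distrib_left[symmetric] \<kappa>0)
  finally have eq: "(\<integral>p. leading_residual p * cpwl d (fst p) (snd p) \<partial>PM) = (\<Sum>j<3. \<Sum>i\<in>corners. (\<integral>k. ?t j i k * d k \<partial>latM) * \<kappa> j i)" .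
  have "\<bar>\<Sum>j<3. \<Sum>i\<in>corners. (\<integral>k. ?t j i k * d k \<partial>latM) * \<kappa> j i\<bar> \<le> (\<Sum>j<(3::nat). \<Sum>i\<in>corners. (\<tau>^3 * K) * L2n latM d)"
  proof (intro order_trans[OF sum_abs] sum_mono)
    fix j :: nat and i assume i: "i \<in> corners"
    have "\<bar>\<integral>k. ?t j i k * d k \<partial>latM\<bar> \<le> L2n latM (?t j i) * L2n latM d"
      by (rule Cauchy_Schwarz_integral(2)[OF tb(1)[OF i] d])
    also have "\<dots> \<le> (\<tau>^3 * K) * L2n latM d" by (intro mult_right_mono tb i) simp
    finally have "\<bar>\<integral>k. ?t j i k * d k \<partial>latM\<bar> * \<bar>\<kappa> j i\<bar> \<le> ((\<tau>^3 * K) * L2n latM d) * 1"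
      using \<kappa>1[OF i] tau K_nonneg by (intro mult_mono) auto
    then show "\<bar>(\<integral>k. ?t j i k * d k \<partial>latM) * \<kappa> j i\<bar> \<le> (\<tau>^3 * K) * L2n latM d" by (simp add: abs_mult)
  qed
  also have "\<dots> = 12 * (\<tau>^3 * K) * L2n latM d" by (simp add: sum_corners eval_nat_numeral del: sum_constant)
  finally show ?thesis unfolding eq .
qed

text \<open>The three second-order expressions with values frozen at the lattice point of the cell. Triples carry the
Euclidean norm, so one \<open>L\<^sub>2\<close> norm collects the sum of squares and obeys the triangle inequality.\<close>

definition frozen_fields :: "(int^2) \<times> (real^2) \<Rightarrow> real \<times> real \<times> real" where
  "frozen_fields p = (let s = \<lambda>j. sampled (\<lambda>w. complex_of_real (residual_symbol j w)) (fst p) in (s 0, s 1, s 2))"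

definition residual_field :: "nat \<Rightarrow> (int^2) \<times> (real^2) \<Rightarrow> real" where
  "residual_field j p = Re (IFT (\<lambda>w. complex_of_real (residual_symbol j w) * G w) (X *v (real_of_int_vec (fst p) + snd p)))"

definition moving_fields :: "(int^2) \<times> (real^2) \<Rightarrow> real \<times> real \<times> real" where
  "moving_fields p = (residual_field 0 p, residual_field 1 p, residual_field 2 p)"

lemma spectrum_in_residual_symbol: "spectrum_in B (\<lambda>w. complex_of_real (residual_symbol j w) * G w)" "spectrum_in B (\<lambda>w. complex_of_real (hessian_symbol w) * G w)"
  by (intro spectrum_in_mult G continuous_intros residual_symbol_cont)+

lemma frozen_field_PM: "in_L2 PM (\<lambda>p. sampled (\<lambda>w. complex_of_real (residual_symbol j w)) (fst p))"
  "L2n PM (\<lambda>p. sampled (\<lambda>w. complex_of_real (residual_symbol j w)) (fst p)) = L2n latM (sampled (\<lambda>w. complex_of_real (residual_symbol j w)))"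
proof -
  let ?s = "sampled (\<lambda>w. complex_of_real (residual_symbol j w))"
  show "in_L2 PM (\<lambda>p. ?s (fst p))" using in_L2_tensor[OF sampled_residual_symbol_L2, of "\<lambda>v. 1" 1 j] by simp
  have "integrable latM (\<lambda>k. (?s k)\<^sup>2)" using in_L2_integrable[OF sampled_residual_symbol_L2[of j]] by simp
  from PM_tensor(2)[OF this, of "\<lambda>v. 1"] show "L2n PM (\<lambda>p. ?s (fst p)) = L2n latM ?s"
    by (simp add: L2n_def cellM.prob_space[simplified])
qed

text \<open>Moving from the lattice point to a point of its cell multiplies the symbol by \<open>1 - exp (i \<xi> \<bullet> v)\<close>, one more
power of \<open>\<tau>\<close>.\<close>

lemma residual_field_diff: "in_L2 PM (\<lambda>p. sampled (\<lambda>w. complex_of_real (residual_symbol j w)) (fst p) - residual_field j p)"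
  "L2n PM (\<lambda>p. sampled (\<lambda>w. complex_of_real (residual_symbol j w)) (fst p) - residual_field j p) \<le> \<tau>^3 * K"
proof -
  let ?F = "\<lambda>p. sampled (\<lambda>w. complex_of_real (residual_symbol j w)) (fst p) - residual_field j p"
  have "(\<lambda>x. Re (IFT (\<lambda>w. complex_of_real (residual_symbol j w) * G w) x)) \<in> borel_measurable borel"
    by (rule borel_measurable_continuous_onI[OF IFT_continuous[OF spectrum_in_residual_symbol(1)]])
  from lattice_measurable[OF this, of X] have g: "residual_field j \<in> borel_measurable PM" by (simp add: residual_field_def[abs_def])
  have m: "?F \<in> borel_measurable PM" by (intro borel_measurable_diff g in_L2_measurable[OF frozen_field_PM(1)])
  have tc: "continuous_on UNIV (\<lambda>w. (1 - shift_symbol v w) * complex_of_real (residual_symbol j w))" for v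
    by (intro continuous_intros shift_symbol_cont residual_symbol_cont)
  have e: "(\<lambda>k. ?F (k, v)) = sampled (\<lambda>w. (1 - shift_symbol v w) * complex_of_real (residual_symbol j w))" for v
  proof
    fix k
    have "sampled (\<lambda>w. (1 - shift_symbol v w) * complex_of_real (residual_symbol j w)) k = sampled (\<lambda>w. complex_of_real (residual_symbol j w) - shift_symbol v w * complex_of_real (residual_symbol j w)) k"
      by (simp add: left_diff_distrib)
    also have "\<dots> = sampled (\<lambda>w. complex_of_real (residual_symbol j w)) k - sampled (\<lambda>w. shift_symbol v w * complex_of_real (residual_symbol j w)) k"
      by (rule sampled_diff) (intro continuous_intros shift_symbol_cont residual_symbol_cont)+
    finally show "?F (k, v) = sampled (\<lambda>w. (1 - shift_symbol v w) * complex_of_real (residual_symbol j w)) k"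
      by (simp add: residual_field_def sampled_shift)
  qed
  have b: "cmod ((1 - shift_symbol v w) * complex_of_real (residual_symbol j w)) \<le> \<tau>^3" if v: "v \<in> unit_cell" and w: "norm w \<le> B" for v w
  proof -
    have "cmod (1 - shift_symbol v w) \<le> \<tau>"
      unfolding shift_symbol_def norm_minus_commute[of 1] by (rule order_trans[OF iexp_taylor0 freq_inner[OF w cell_unit[OF v]]])
    then have "cmod ((1 - shift_symbol v w) * complex_of_real (residual_symbol j w)) \<le> \<tau> * \<tau>\<^sup>2"
      unfolding norm_mult using residual_symbol_bound[OF w] tau by (intro mult_mono) auto
    then show ?thesis by (simp add: power2_eq_square power3_eq_cube)
  qed
  have "0 \<le> \<tau>^3 * K" using tau K_nonneg by simp
  moreover have "in_L2 latM (\<lambda>k. ?F (k, v))" "L2n latM (\<lambda>k. ?F (k, v)) \<le> \<tau>^3 * K" if "v \<in> unit_cell" for v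
    unfolding e using b[OF that] tau by (auto intro!: sampled_bound[OF tc])
  ultimately show "in_L2 PM ?F" "L2n PM ?F \<le> \<tau>^3 * K"
    using PM_slices[OF m] by blast+
qed

lemma residual_field_L2: "in_L2 PM (residual_field j)"
  using in_L2_diff[OF frozen_field_PM(1)[of j] residual_field_diff(1)[of j]] by simp

lemma frozen_moving_compare: "\<bar>L2n PM frozen_fields - L2n PM moving_fields\<bar> \<le> 3 * (\<tau>^3 * K)"
proof -
  let ?s = "\<lambda>j p. sampled (\<lambda>w. complex_of_real (residual_symbol j w)) (fst p)"
  have D0: "0 \<le> \<tau>^3 * K" using tau K_nonneg by simp
  have L: "in_L2 PM frozen_fields" "in_L2 PM moving_fields"
    unfolding frozen_fields_def[abs_def] moving_fields_def[abs_def] Let_def by (intro L2_Pair frozen_field_PM residual_field_L2)+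
  have "\<bar>L2n PM frozen_fields - L2n PM moving_fields\<bar> \<le> L2n PM (\<lambda>p. frozen_fields p - moving_fields p)" by (rule L2n_triangle_rev[OF L])
  also have "(\<lambda>p. frozen_fields p - moving_fields p) = (\<lambda>p. (?s 0 p - residual_field 0 p, ?s 1 p - residual_field 1 p, ?s 2 p - residual_field 2 p))"
    by (simp add: frozen_fields_def moving_fields_def Let_def fun_eq_iff)
  also have "L2n PM \<dots> \<le> 3 * (\<tau>^3 * K)"
  proof (rule power2_le_imp_le)
    have "(L2n PM (\<lambda>p. (?s 0 p - residual_field 0 p, ?s 1 p - residual_field 1 p, ?s 2 p - residual_field 2 p)))\<^sup>2
      = (L2n PM (\<lambda>p. ?s 0 p - residual_field 0 p))\<^sup>2 + ((L2n PM (\<lambda>p. ?s 1 p - residual_field 1 p))\<^sup>2 + (L2n PM (\<lambda>p. ?s 2 p - residual_field 2 p))\<^sup>2)"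
      by (simp add: L2_Pair residual_field_diff(1))
    also have "\<dots> \<le> (\<tau>^3 * K)\<^sup>2 + ((\<tau>^3 * K)\<^sup>2 + (\<tau>^3 * K)\<^sup>2)"
      by (intro add_mono power_mono residual_field_diff(2)) auto
    also have "\<dots> \<le> (3 * (\<tau>^3 * K))\<^sup>2" using zero_le_power2[of "\<tau>^3 * K"] by (simp only: power_mult_distrib) simp
    finally show "(L2n PM (\<lambda>p. (?s 0 p - residual_field 0 p, ?s 1 p - residual_field 1 p, ?s 2 p - residual_field 2 p)))\<^sup>2 \<le> (3 * (\<tau>^3 * K))\<^sup>2" .
  qed (use D0 in simp)
  finally show ?thesis .
qed

lemma leading_residual_frozen: "L2n PM leading_residual = L2n PM frozen_fields / sqrt 720"
proof -
  let ?s = "\<lambda>j. sampled (\<lambda>w. complex_of_real (residual_symbol j w))"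
  have "(L2n PM frozen_fields)\<^sup>2 = (L2n latM (?s 0))\<^sup>2 + ((L2n latM (?s 1))\<^sup>2 + (L2n latM (?s 2))\<^sup>2)"
    unfolding frozen_fields_def[abs_def] Let_def by (simp add: L2_Pair frozen_field_PM)
  also have "\<dots> = (\<Sum>j<3. (L2n latM (?s j))\<^sup>2)" by (simp add: eval_nat_numeral)
  finally have "(L2n PM leading_residual)\<^sup>2 = (L2n PM frozen_fields / sqrt 720)\<^sup>2" by (simp add: leading_residual_norm power_divide)
  then show ?thesis by (rule power2_eq_imp_eq) simp_all
qed

lemma lattice_residual_field: "L2n lborel (\<lambda>x. Re (IFT (\<lambda>w. complex_of_real (residual_symbol j w) * G w) x)) = sqrt \<bar>det X\<bar> * L2n PM (residual_field j)"
  unfolding residual_field_def[abs_def]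
  by (rule lattice_L2(2)[OF det]) (rule borel_measurable_continuous_onI[OF IFT_continuous[OF spectrum_in_residual_symbol(1)]])

end

section \<open>The null Lagrangian\<close>

lemma FT_IFT_integral:
  assumes [measurable]: "u \<in> borel_measurable borel" "v \<in> borel_measurable borel"
  shows "(\<integral>w. FT u w * cnj (FT v w) \<partial>lborel) = (\<integral>x. IFT u x * cnj (IFT v x) \<partial>lborel)"
proof -
  have "(\<lambda>w. FT u w * cnj (FT v w)) \<in> borel_measurable borel" by measurable
  from integral_reflect[OF this] show ?thesis by (simp add: IFT_FT)
qed

lemma in_L2_Re: "in_L2 M F \<Longrightarrow> in_L2 M (\<lambda>x. Re (F x))"
  by (rule in_L2_bound(1)[where c=1]) (auto simp: in_L2_def abs_Re_le_cmod)

context fine_grid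
begin

lemma xi_minus: "xi X (- w) $ i = - xi X w $ i"
proof -
  have "xi X w $ i = w \<bullet> (X *v axis i 1)" for w
    unfolding xi_inner by (simp add: inner_axis)
  then show ?thesis by simp
qed

text \<open>Both integrals are inner products of transforms. Their multipliers \<open>a(x)\<^sup>2 b(y)\<^sup>2\<close> and \<open>a(x) b(x) a(y) b(y)\<close>
agree for \<open>x = y\<close> and differ by a Lipschitz error, so \<open>parseval_commutator\<close> applies. Here \<open>a\<close> and \<open>b\<close> are the
two frequency coordinates, linear and hence Lipschitz.\<close>

lemma null_lagrangian:
  defines "A \<equiv> \<lambda>x. Re (IFT (\<lambda>w. complex_of_real ((xi X w $ 1)\<^sup>2) * G w) x)"
    and "D \<equiv> \<lambda>x. Re (IFT (\<lambda>w. complex_of_real ((xi X w $ 2)\<^sup>2) * G w) x)"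
    and "M \<equiv> \<lambda>x. Re (IFT (\<lambda>w. complex_of_real (xi X w $ 1 * xi X w $ 2) * G w) x)"
  shows "in_L2 lborel A" "in_L2 lborel D" "in_L2 lborel M" "(\<integral>x. A x * D x \<partial>lborel) = (\<integral>x. M x * M x \<partial>lborel)"
proof -
  let ?a = "\<lambda>w. (xi X w $ 1)\<^sup>2" and ?b = "\<lambda>w. (xi X w $ 2)\<^sup>2" and ?m = "\<lambda>w. xi X w $ 1 * xi X w $ 2"
  have bl: "spectrum_in B (\<lambda>w. complex_of_real (?a w) * G w)" "spectrum_in B (\<lambda>w. complex_of_real (?b w) * G w)" "spectrum_in B (\<lambda>w. complex_of_real (?m w) * G w)"
    by (intro spectrum_in_mult G continuous_intros xi_cont)+
  have L: "in_L2 lborel (\<lambda>x. Re (IFT F x))" if "spectrum_in B F" for F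
    by (rule in_L2_Re[OF IFT_L2[OF spectrum_in_integrable[OF that] spectrum_in_L2[OF that]]])
  show "in_L2 lborel A" "in_L2 lborel D" "in_L2 lborel M" unfolding A_def D_def M_def by (intro L bl)+
  define C where "C = norm (X *v axis 1 1) + norm (X *v axis 2 1)"
  have C0: "0 \<le> C" by (simp add: C_def)
  have lip: "\<bar>xi X x $ i - xi X y $ i\<bar> \<le> C * norm (x - y)" for x y i
  proof -
    have "xi X w $ i = w \<bullet> (X *v axis i 1)" for w unfolding xi_inner by (simp add: inner_axis)
    then have "\<bar>xi X x $ i - xi X y $ i\<bar> = \<bar>(x - y) \<bullet> (X *v axis i 1)\<bar>" by (simp add: inner_diff_left)
    also have "\<dots> \<le> norm (x - y) * norm (X *v axis i 1)" by (rule Cauchy_Schwarz_ineq2)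
    also have "\<dots> \<le> norm (x - y) * C"
      by (rule mult_left_mono) (use exhaust_2[of i] in \<open>auto simp: C_def\<close>)
    finally show ?thesis by (simp add: mult.commute)
  qed
  have bnd: "\<bar>xi X w $ i\<bar> \<le> \<tau>" if "G w \<noteq> 0" for w i
    using freq[OF spectrum_in_bound[OF G that]] exhaust_2[of i] by auto
  have "(\<integral>w. FT (\<lambda>x. complex_of_real (?a x) * G x) w * cnj (FT (\<lambda>x. complex_of_real (?b x) * G x) w) \<partial>lborel)
      = (\<integral>w. FT (\<lambda>x. complex_of_real (?m x) * G x) w * cnj (FT (\<lambda>x. complex_of_real (?m x) * G x) w) \<partial>lborel)"
  proof (rule parseval_commutator[where C="2 * \<tau>^3 * C"])
    fix x y assume g: "G x \<noteq> 0" "G y \<noteq> 0"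
    let ?p = "xi X x $ 1" and ?q = "xi X x $ 2" and ?r = "xi X y $ 1" and ?s = "xi X y $ 2"
    have e: "?p\<^sup>2 * ?s\<^sup>2 - ?p * ?q * (?r * ?s) = (?p * ?s) * (?q * (?p - ?r) - ?p * (?q - ?s))"
      by (simp add: power2_eq_square algebra_simps)
    have 1: "\<bar>?p * ?s\<bar> \<le> \<tau> * \<tau>" unfolding abs_mult using bnd g tau by (intro mult_mono) auto
    have 2: "\<bar>?q * (?p - ?r)\<bar> \<le> \<tau> * (C * norm (x - y))" unfolding abs_mult using bnd g lip tau by (intro mult_mono) auto
    have 3: "\<bar>?p * (?q - ?s)\<bar> \<le> \<tau> * (C * norm (x - y))" unfolding abs_mult using bnd g lip tau by (intro mult_mono) auto
    have "\<bar>?q * (?p - ?r) - ?p * (?q - ?s)\<bar> \<le> 2 * (\<tau> * (C * norm (x - y)))" using 2 3 by linarith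
    then have "\<bar>?p * ?s\<bar> * \<bar>?q * (?p - ?r) - ?p * (?q - ?s)\<bar> \<le> (\<tau> * \<tau>) * (2 * (\<tau> * (C * norm (x - y))))"
      using 1 tau by (intro mult_mono) auto
    then show "\<bar>?p\<^sup>2 * ?s\<^sup>2 - ?p * ?q * (?r * ?s)\<bar> \<le> 2 * \<tau>^3 * C * norm (x - y)"
      unfolding e abs_mult by (simp add: power3_eq_cube mult_ac)
  qed (use spectrum_in_L2[OF G] spectrum_in_integrable[OF bl(1)] spectrum_in_integrable[OF bl(2)] spectrum_in_integrable[OF bl(3)] spectrum_in_L2[OF bl(1)] spectrum_in_L2[OF bl(2)] spectrum_in_L2[OF bl(3)] tau C0 in auto)
  then have I: "(\<integral>x. IFT (\<lambda>w. complex_of_real (?a w) * G w) x * cnj (IFT (\<lambda>w. complex_of_real (?b w) * G w) x) \<partial>lborel)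
      = (\<integral>x. IFT (\<lambda>w. complex_of_real (?m w) * G w) x * cnj (IFT (\<lambda>w. complex_of_real (?m w) * G w) x) \<partial>lborel)"
    unfolding FT_IFT_integral[OF in_L2_borel[OF spectrum_in_L2[OF bl(1)]] in_L2_borel[OF spectrum_in_L2[OF bl(2)]]]
      FT_IFT_integral[OF in_L2_borel[OF spectrum_in_L2[OF bl(3)]] in_L2_borel[OF spectrum_in_L2[OF bl(3)]]] .
  have re: "IFT (\<lambda>w. complex_of_real (p w) * G w) x = complex_of_real (Re (IFT (\<lambda>w. complex_of_real (p w) * G w) x))"
    if "spectrum_in B (\<lambda>w. complex_of_real (p w) * G w)" "\<And>w. p (- w) = p w" for p x
    using IFT_real[OF in_L2_borel[OF spectrum_in_L2[OF that(1)]], of x] that(2) sym by (simp add: complex_eq_iff)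
  have ra: "IFT (\<lambda>w. complex_of_real (?a w) * G w) x = complex_of_real (A x)" for x
    unfolding A_def by (rule re[OF bl(1)]) (simp add: xi_minus)
  have rb: "IFT (\<lambda>w. complex_of_real (?b w) * G w) x = complex_of_real (D x)" for x
    unfolding D_def by (rule re[OF bl(2)]) (simp add: xi_minus)
  have rm: "IFT (\<lambda>w. complex_of_real (?m w) * G w) x = complex_of_real (M x)" for x
    unfolding M_def by (rule re[OF bl(3)]) (simp add: xi_minus)
  from I show "(\<integral>x. A x * D x \<partial>lborel) = (\<integral>x. M x * M x \<partial>lborel)"
    unfolding ra rb rm complex_cnj_complex_of_real of_real_mult[symmetric] integral_complex_of_real of_real_eq_iff .
qed

text \<open>Since \<open>(A + M)\<^sup>2 + (D + M)\<^sup>2 + M\<^sup>2 = (A + M + D)\<^sup>2 + 2 (M\<^sup>2 - A D)\<close>, the difference integrates to zero by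
\<open>null_lagrangian\<close>.\<close>

lemma quadratic_form_norms:
  "(\<Sum>j<3. (L2n lborel (\<lambda>x. Re (IFT (\<lambda>w. complex_of_real (residual_symbol j w) * G w) x)))\<^sup>2)
   = (L2n lborel (\<lambda>x. Re (IFT (\<lambda>w. complex_of_real (hessian_symbol w) * G w) x)))\<^sup>2"
proof -
  define A where "A x = Re (IFT (\<lambda>w. complex_of_real ((xi X w $ 1)\<^sup>2) * G w) x)" for x
  define D where "D x = Re (IFT (\<lambda>w. complex_of_real ((xi X w $ 2)\<^sup>2) * G w) x)" for x
  define M where "M x = Re (IFT (\<lambda>w. complex_of_real (xi X w $ 1 * xi X w $ 2) * G w) x)" for x
  note frozen_fields = null_lagrangian[folded A_def D_def M_def]
  have A: "in_L2 lborel A" and D: "in_L2 lborel D" and M: "in_L2 lborel M" and eq: "(\<integral>x. A x * D x \<partial>lborel) = (\<integral>x. M x * M x \<partial>lborel)"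
    using frozen_fields by (simp_all add: A_def[abs_def] D_def[abs_def] M_def[abs_def])
  have bl: "spectrum_in B (\<lambda>w. complex_of_real ((xi X w $ 1)\<^sup>2) * G w)" "spectrum_in B (\<lambda>w. complex_of_real ((xi X w $ 2)\<^sup>2) * G w)" "spectrum_in B (\<lambda>w. complex_of_real (xi X w $ 1 * xi X w $ 2) * G w)"
    by (intro spectrum_in_mult G continuous_intros xi_cont)+
  have neg: "IFT (\<lambda>w. - F w) x = - IFT F x" for F x using IFT_cmult[of "-1" F x] by simp
  have n0: "Re (IFT (\<lambda>w. complex_of_real (residual_symbol 0 w) * G w) x) = - (A x + M x)" for x
  proof -
    have e: "complex_of_real (residual_symbol 0 w) * G w = - (complex_of_real ((xi X w $ 1)\<^sup>2) * G w + complex_of_real (xi X w $ 1 * xi X w $ 2) * G w)" for w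
      by (simp add: residual_symbol_def Let_def algebra_simps)
    show ?thesis unfolding e neg IFT_add[OF bl(1,3)] by (simp add: A_def M_def)
  qed
  have n1: "Re (IFT (\<lambda>w. complex_of_real (residual_symbol 1 w) * G w) x) = - (D x + M x)" for x
  proof -
    have e: "complex_of_real (residual_symbol 1 w) * G w = - (complex_of_real ((xi X w $ 2)\<^sup>2) * G w + complex_of_real (xi X w $ 1 * xi X w $ 2) * G w)" for w
      by (simp add: residual_symbol_def Let_def algebra_simps)
    show ?thesis unfolding e neg IFT_add[OF bl(2,3)] by (simp add: D_def M_def)
  qed
  have n2: "Re (IFT (\<lambda>w. complex_of_real (residual_symbol 2 w) * G w) x) = - M x" for x
  proof -
    have e: "complex_of_real (residual_symbol 2 w) * G w = - (complex_of_real (xi X w $ 1 * xi X w $ 2) * G w)" for w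
      by (simp add: residual_symbol_def Let_def algebra_simps)
    show ?thesis unfolding e neg by (simp add: M_def)
  qed
  have q: "Re (IFT (\<lambda>w. complex_of_real (hessian_symbol w) * G w) x) = - (A x + M x + D x)" for x
  proof -
    have b12: "spectrum_in B (\<lambda>w. complex_of_real ((xi X w $ 1)\<^sup>2) * G w + complex_of_real (xi X w $ 1 * xi X w $ 2) * G w)"
      unfolding distrib_right[symmetric] by (intro spectrum_in_mult G continuous_intros xi_cont)
    have e: "complex_of_real (hessian_symbol w) * G w = - ((complex_of_real ((xi X w $ 1)\<^sup>2) * G w + complex_of_real (xi X w $ 1 * xi X w $ 2) * G w) + complex_of_real ((xi X w $ 2)\<^sup>2) * G w)" for w
      by (simp add: hessian_symbol_def Let_def algebra_simps)
    show ?thesis unfolding e neg IFT_add[OF b12 bl(2)] IFT_add[OF bl(1,3)] by (simp add: A_def M_def D_def)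
  qed
  have i: "integrable lborel (\<lambda>x. A x * A x)" "integrable lborel (\<lambda>x. D x * D x)" "integrable lborel (\<lambda>x. M x * M x)"
    "integrable lborel (\<lambda>x. A x * D x)" "integrable lborel (\<lambda>x. A x * M x)" "integrable lborel (\<lambda>x. D x * M x)"
    by (intro Cauchy_Schwarz_integral(1) A D M)+
  have s3: "(\<Sum>j<3. f j) = f 0 + f 1 + f (2::nat)" for f :: "nat \<Rightarrow> real" by (simp add: eval_nat_numeral)
  have "(\<Sum>j<3. (L2n lborel (\<lambda>x. Re (IFT (\<lambda>w. complex_of_real (residual_symbol j w) * G w) x)))\<^sup>2)
    = (\<integral>x. (A x + M x)\<^sup>2 \<partial>lborel) + (\<integral>x. (D x + M x)\<^sup>2 \<partial>lborel) + (\<integral>x. (M x)\<^sup>2 \<partial>lborel)"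
    unfolding s3 n0 n1 n2 L2n_sq real_norm_def power2_abs power2_minus ..
  also have "\<dots> = (\<integral>x. (A x + M x + D x)\<^sup>2 \<partial>lborel) + 2 * ((\<integral>x. M x * M x \<partial>lborel) - (\<integral>x. A x * D x \<partial>lborel))"
  proof -
    have "(A x + M x)\<^sup>2 = A x * A x + 2 * (A x * M x) + M x * M x" "(D x + M x)\<^sup>2 = D x * D x + 2 * (D x * M x) + M x * M x" "(M x)\<^sup>2 = M x * M x"
      "(A x + M x + D x)\<^sup>2 = A x * A x + M x * M x + D x * D x + 2 * (A x * M x) + 2 * (A x * D x) + 2 * (D x * M x)" for x
      by (simp_all add: power2_eq_square algebra_simps)
    then show ?thesis using i by simp
  qed
  also have "\<dots> = (\<integral>x. (A x + M x + D x)\<^sup>2 \<partial>lborel)" using eq by simp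
  also have "\<dots> = (L2n lborel (\<lambda>x. Re (IFT (\<lambda>w. complex_of_real (hessian_symbol w) * G w) x)))\<^sup>2"
  proof -
    have "(A x + M x + D x)\<^sup>2 = (norm (- (A x + M x + D x)))\<^sup>2" for x
      by (simp only: real_norm_def power2_abs power2_minus)
    then show ?thesis unfolding q L2n_sq by (simp only:)
  qed
  finally show ?thesis .
qed

lemma moving_fields_norm: "sqrt \<bar>det X\<bar> * L2n PM moving_fields = L2n lborel (\<lambda>x. Re (IFT (\<lambda>w. complex_of_real (hessian_symbol w) * G w) x))"
proof (rule power2_eq_imp_eq)
  have s3: "(\<Sum>j<3. f j) = f 0 + (f 1 + f (2::nat))" for f :: "nat \<Rightarrow> real" by (simp add: eval_nat_numeral)
  have "(L2n PM moving_fields)\<^sup>2 = (L2n PM (residual_field 0))\<^sup>2 + ((L2n PM (residual_field 1))\<^sup>2 + (L2n PM (residual_field 2))\<^sup>2)"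
    unfolding moving_fields_def[abs_def] by (simp add: L2_Pair residual_field_L2)
  then have "(sqrt \<bar>det X\<bar> * L2n PM moving_fields)\<^sup>2 = (\<Sum>j<3. (sqrt \<bar>det X\<bar> * L2n PM (residual_field j))\<^sup>2)"
    unfolding s3 by (simp add: power_mult_distrib algebra_simps)
  then show "(sqrt \<bar>det X\<bar> * L2n PM moving_fields)\<^sup>2 = (L2n lborel (\<lambda>x. Re (IFT (\<lambda>w. complex_of_real (hessian_symbol w) * G w) x)))\<^sup>2"
    by (simp only: lattice_residual_field[symmetric] quadratic_form_norms)
qed simp_all

text \<open>With \<open>r\<close> the residual of the quasi-interpolant and \<open>V\<close> the spline by which the best approximation differs
from it, the squared error is \<open>\<parallel>r\<parallel>\<^sup>2 - 2 \<langle>r, V\<rangle> + \<parallel>V\<parallel>\<^sup>2\<close>. Near-orthogonality bounds \<open>\<langle>r, V\<rangle>\<close> by a multiple of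
\<open>\<tau>\<^sup>3 \<parallel>V\<parallel>\<close>, so the error is at least \<open>\<parallel>r\<parallel> - O(\<tau>\<^sup>3)\<close>; by minimality it is at most \<open>\<parallel>r\<parallel>\<close>.\<close>

lemma error_estimate:
  assumes c0: "in_L2 latM c0" and E: "E = sqrt \<bar>det X\<bar> * L2n PM (\<lambda>p. cell_values p - cpwl c0 (fst p) (snd p))"
    and min: "\<And>c'. in_L2 latM c' \<Longrightarrow> E \<le> sqrt \<bar>det X\<bar> * L2n PM (\<lambda>p. cell_values p - cpwl c' (fst p) (snd p))"
  shows "\<bar>E - L2n lborel (\<lambda>x. Re (IFT (\<lambda>w. complex_of_real (hessian_symbol w) * G w) x)) / sqrt 720\<bar> \<le> 300 * pi * \<tau>^3 * L2n lborel G"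
proof -
  define D where "D = \<tau>^3 * K"
  have D0: "0 \<le> D" using tau K_nonneg by (simp add: D_def)
  let ?r = "\<lambda>p. cell_values p - cpwl quasi_coeff (fst p) (snd p)"
  define R where "R = L2n PM ?r"
  have r: "?r = (\<lambda>p. leading_residual p + remainder p)" by (simp add: remainder_def fun_eq_iff)
  have rL: "in_L2 PM ?r" unfolding r by (intro in_L2_add leading_residual_L2 remainder_bound)
  let ?d = "\<lambda>k. c0 k - quasi_coeff k"
  have dL: "in_L2 latM ?d" by (intro in_L2_diff c0 quasi_coeff_L2)
  let ?V = "\<lambda>p. cpwl ?d (fst p) (snd p)"
  have VL: "in_L2 PM ?V" by (rule cpwl_L2[OF dL])
  define V where "V = L2n PM ?V"
  have V0: "0 \<le> V" and R0: "0 \<le> R" by (simp_all add: V_def R_def)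
  \<comment> \<open>The Riesz constant 136 is at most the square of 12.\<close>
  have dV: "L2n latM ?d \<le> 12 * V"
  proof (rule power2_le_imp_le)
    have "(L2n latM ?d)\<^sup>2 \<le> 136 * V\<^sup>2" unfolding V_def by (rule cpwl_riesz(2)[OF VL])
    also have "136 * V\<^sup>2 \<le> 12\<^sup>2 * V\<^sup>2" by (intro mult_right_mono) auto
    also have "12\<^sup>2 * V\<^sup>2 = (12 * V)\<^sup>2" by (rule power_mult_distrib[symmetric])
    finally show "(L2n latM ?d)\<^sup>2 \<le> (12 * V)\<^sup>2" .
  qed (use V0 in simp)
  \<comment> \<open>The leading residual contributes 12 * 12 = 144 and the remainder 1.\<close>
  have rV: "(\<integral>p. ?r p * ?V p \<partial>PM) \<le> 145 * D * V"
  proof -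
    have "(\<integral>p. ?r p * ?V p \<partial>PM) = (\<integral>p. leading_residual p * ?V p + remainder p * ?V p \<partial>PM)"
      by (rule Bochner_Integration.integral_cong[OF refl]) (simp add: remainder_def algebra_simps)
    also have "\<dots> = (\<integral>p. leading_residual p * ?V p \<partial>PM) + (\<integral>p. remainder p * ?V p \<partial>PM)"
      by (intro Bochner_Integration.integral_add Cauchy_Schwarz_integral(1) leading_residual_L2 remainder_bound VL)
    finally have "(\<integral>p. ?r p * ?V p \<partial>PM) = (\<integral>p. leading_residual p * ?V p \<partial>PM) + (\<integral>p. remainder p * ?V p \<partial>PM)" .
    moreover have "(\<integral>p. leading_residual p * ?V p \<partial>PM) \<le> 144 * D * V"
    proof -
      have "12 * D * L2n latM ?d \<le> 12 * D * (12 * V)" using D0 by (intro mult_left_mono dV) simp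
      moreover have "\<bar>\<integral>p. leading_residual p * ?V p \<partial>PM\<bar> \<le> 12 * D * L2n latM ?d" unfolding D_def by (rule leading_residual_orth[OF dL])
      ultimately show ?thesis by linarith
    qed
    moreover have "(\<integral>p. remainder p * ?V p \<partial>PM) \<le> D * V"
    proof -
      have "(\<integral>p. remainder p * ?V p \<partial>PM) \<le> L2n PM remainder * V"
        using Cauchy_Schwarz_integral(2)[OF remainder_bound(1) VL] by (simp add: V_def)
      also have "\<dots> \<le> D * V" unfolding D_def by (intro mult_right_mono remainder_bound V0)
      finally show ?thesis .
    qed
    ultimately show ?thesis by simp
  qed
  define E' where "E' = L2n PM (\<lambda>p. cell_values p - cpwl c0 (fst p) (snd p))"
  have E'0: "0 \<le> E'" by (simp add: E'_def)
  have "E'\<^sup>2 = (\<integral>p. (norm (?r p))\<^sup>2 - 2 * (?r p * ?V p) + (norm (?V p))\<^sup>2 \<partial>PM)"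
    unfolding E'_def L2n_sq
    by (intro Bochner_Integration.integral_cong refl) (simp add: cpwl_linear power2_eq_square algebra_simps)
  also have "\<dots> = R\<^sup>2 - 2 * (\<integral>p. ?r p * ?V p \<partial>PM) + V\<^sup>2"
    unfolding R_def V_def L2n_sq
    using in_L2_integrable[OF rL] in_L2_integrable[OF VL] Cauchy_Schwarz_integral(1)[OF rL VL] by simp
  also have "\<dots> \<ge> R\<^sup>2 - 2 * (145 * D * V) + V\<^sup>2" using rV by linarith
  finally have E2: "R\<^sup>2 - 2 * (145 * D * V) + V\<^sup>2 \<le> E'\<^sup>2" by simp
  have low: "R - 145 * D \<le> E'"
  proof (cases "R \<le> 145 * D")
    case True
    then show ?thesis using E'0 by linarith
  next
    case False
    have "(R - 145 * D)\<^sup>2 = R\<^sup>2 - 2 * (145 * D) * R + (145 * D)\<^sup>2" by (simp add: power2_diff)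
    also have "\<dots> \<le> R\<^sup>2 - 2 * (145 * D) * (145 * D) + (145 * D)\<^sup>2"
      using False D0 by (intro add_right_mono diff_left_mono mult_left_mono) auto
    \<comment> \<open>Completing the square in V.\<close>
    also have "\<dots> = R\<^sup>2 - 2 * (145 * D * V) + V\<^sup>2 - (V - 145 * D)\<^sup>2" by (simp add: power2_eq_square algebra_simps)
    also have "\<dots> \<le> E'\<^sup>2" using E2 zero_le_power2[of "V - 145 * D"] by linarith
    finally show ?thesis using E'0 by (rule power2_le_imp_le)
  qed
  define s where "s = sqrt \<bar>det X\<bar>"
  have s0: "0 < s" using det by (simp add: s_def)
  have up: "E' \<le> R" using min[OF quasi_coeff_L2] s0 unfolding E E'_def R_def s_def by simp
  have ree: "\<bar>R - L2n PM leading_residual\<bar> \<le> D"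
  proof -
    have "\<bar>L2n PM ?r - L2n PM leading_residual\<bar> \<le> L2n PM (\<lambda>p. ?r p - leading_residual p)" by (rule L2n_triangle_rev[OF rL leading_residual_L2])
    also have "(\<lambda>p. ?r p - leading_residual p) = remainder" by (simp add: remainder_def fun_eq_iff)
    finally show ?thesis using remainder_bound(2) by (simp add: R_def D_def)
  qed
  have eNC: "\<bar>L2n PM leading_residual - L2n PM moving_fields / sqrt 720\<bar> \<le> 3 * D"
  proof -
    have "\<bar>L2n PM leading_residual - L2n PM moving_fields / sqrt 720\<bar> = \<bar>L2n PM frozen_fields - L2n PM moving_fields\<bar> / sqrt 720"
      unfolding leading_residual_frozen diff_divide_distrib[symmetric] by simp
    also have "\<dots> \<le> \<bar>L2n PM frozen_fields - L2n PM moving_fields\<bar> / 1" by (intro divide_left_mono) auto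
    also have "\<dots> \<le> 3 * D" using frozen_moving_compare by (simp add: D_def)
    finally show ?thesis .
  qed
  \<comment> \<open>Contributions: 145 from the best approximation, 1 from the remainder, 3 from unfreezing.\<close>
  have "\<bar>E' - L2n PM moving_fields / sqrt 720\<bar> \<le> 150 * D" using low up ree eNC D0 by linarith
  then have "s * \<bar>E' - L2n PM moving_fields / sqrt 720\<bar> \<le> s * (150 * D)" using s0 by (intro mult_left_mono) auto
  moreover have "s * \<bar>E' - L2n PM moving_fields / sqrt 720\<bar> = \<bar>E - L2n lborel (\<lambda>x. Re (IFT (\<lambda>w. complex_of_real (hessian_symbol w) * G w) x)) / sqrt 720\<bar>"
    unfolding moving_fields_norm[symmetric] E E'_def[symmetric] s_def[symmetric] using s0
    by (simp add: abs_mult_pos' right_diff_distrib)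
  \<comment> \<open>The factor 1 / s in K cancels the square root of the cell area.\<close>
  moreover have "s * (150 * D) = 300 * pi * \<tau>^3 * L2n lborel G"
    using s0 by (simp add: D_def K_def s_def[symmetric])
  ultimately show ?thesis by simp
qed

end

section \<open>Grid matrices and the asymptotic error\<close>

lemma inner_matrix2:
  "(H :: real^2^2) \<bullet> vector [vector [a, b], vector [c, d]] = H$1$1 * a + H$1$2 * b + H$2$1 * c + H$2$2 * d"
  by (simp add: inner_vec_def sum_2)

lemma grid_sin_nz: "grid_angles \<theta>1 \<theta>2 \<Longrightarrow> sin (\<theta>2 - \<theta>1) \<noteq> 0"
proof -
  assume "grid_angles \<theta>1 \<theta>2"
  then have d: "0 < \<theta>2 - \<theta>1" "\<theta>2 - \<theta>1 < 2 * pi" "\<theta>2 - \<theta>1 \<noteq> pi" by (auto simp: grid_angles_def)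
  show ?thesis
  proof (cases "\<theta>2 - \<theta>1 < pi")
    case True
    then show ?thesis using sin_gt_zero[OF d(1)] by simp
  next
    case False
    then show ?thesis using sin_lt_zero[of "\<theta>2 - \<theta>1"] d by simp
  qed
qed

lemma grid_matrix_nth:
  "grid_matrix T \<theta>1 \<theta>2 $ 1 $ 1 = T / sqrt \<bar>sin (\<theta>2 - \<theta>1)\<bar> * cos \<theta>1"
  "grid_matrix T \<theta>1 \<theta>2 $ 1 $ 2 = T / sqrt \<bar>sin (\<theta>2 - \<theta>1)\<bar> * cos \<theta>2"
  "grid_matrix T \<theta>1 \<theta>2 $ 2 $ 1 = T / sqrt \<bar>sin (\<theta>2 - \<theta>1)\<bar> * sin \<theta>1"
  "grid_matrix T \<theta>1 \<theta>2 $ 2 $ 2 = T / sqrt \<bar>sin (\<theta>2 - \<theta>1)\<bar> * sin \<theta>2"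
  by (simp_all add: grid_matrix_def)

lemma grid_matrix_det:
  assumes "grid_angles \<theta>1 \<theta>2" "0 < T"
  shows "\<bar>det (grid_matrix T \<theta>1 \<theta>2)\<bar> = T\<^sup>2"
proof -
  define s where "s = sin (\<theta>2 - \<theta>1)"
  have s: "s \<noteq> 0" unfolding s_def by (rule grid_sin_nz[OF assms(1)])
  have "det (grid_matrix T \<theta>1 \<theta>2) = (T / sqrt \<bar>s\<bar>)\<^sup>2 * (cos \<theta>1 * sin \<theta>2 - cos \<theta>2 * sin \<theta>1)"
    unfolding det_2 grid_matrix_nth s_def[symmetric] by (simp add: power2_eq_square algebra_simps)
  also have "cos \<theta>1 * sin \<theta>2 - cos \<theta>2 * sin \<theta>1 = s" unfolding s_def sin_diff by simp
  also have "(T / sqrt \<bar>s\<bar>)\<^sup>2 = T\<^sup>2 / \<bar>s\<bar>" by (simp add: power_divide)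
  finally show ?thesis using s by (simp add: abs_mult)
qed

lemma xi_grid:
  "xi (grid_matrix T \<theta>1 \<theta>2) w $ 1 = T / sqrt \<bar>sin (\<theta>2 - \<theta>1)\<bar> * (cos \<theta>1 * w$1 + sin \<theta>1 * w$2)"
  "xi (grid_matrix T \<theta>1 \<theta>2) w $ 2 = T / sqrt \<bar>sin (\<theta>2 - \<theta>1)\<bar> * (cos \<theta>2 * w$1 + sin \<theta>2 * w$2)"
  by (simp_all add: xi_def matrix_vector_mult_def transpose_def sum_2 grid_matrix_nth algebra_simps)

text \<open>The link between grid coordinates and the coefficients of the asymptotic error.\<close>

lemma grid_quadratic_form:
  fixes T \<theta>1 \<theta>2 :: real
  assumes "grid_angles \<theta>1 \<theta>2"
  defines "a \<equiv> \<lambda>w. xi (grid_matrix T \<theta>1 \<theta>2) w $ 1" and "b \<equiv> \<lambda>w. xi (grid_matrix T \<theta>1 \<theta>2) w $ 2"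
  shows "(a w)\<^sup>2 + a w * b w + (b w)\<^sup>2 = T\<^sup>2 * (coeff_\<alpha> \<theta>1 \<theta>2 * (w$1)\<^sup>2 + coeff_\<gamma> \<theta>1 \<theta>2 * (w$1 * w$2) + coeff_\<beta> \<theta>1 \<theta>2 * (w$2)\<^sup>2)"
proof -
  define s where "s = \<bar>sin (\<theta>2 - \<theta>1)\<bar>"
  have s: "0 < s" using grid_sin_nz[OF assms(1)] by (simp add: s_def)
  define t where "t = T / sqrt s"
  have t: "t\<^sup>2 = T\<^sup>2 / s" using s by (simp add: t_def power_divide)
  have "(a w)\<^sup>2 + a w * b w + (b w)\<^sup>2 = t\<^sup>2 * ((cos \<theta>1 * w$1 + sin \<theta>1 * w$2)\<^sup>2 + (cos \<theta>1 * w$1 + sin \<theta>1 * w$2) * (cos \<theta>2 * w$1 + sin \<theta>2 * w$2) + (cos \<theta>2 * w$1 + sin \<theta>2 * w$2)\<^sup>2)"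
    unfolding a_def b_def xi_grid s_def[symmetric] t_def[symmetric] by (simp add: power2_eq_square algebra_simps)
  also have "\<dots> = T\<^sup>2 * (coeff_\<alpha> \<theta>1 \<theta>2 * (w$1)\<^sup>2 + coeff_\<gamma> \<theta>1 \<theta>2 * (w$1 * w$2) + coeff_\<beta> \<theta>1 \<theta>2 * (w$2)\<^sup>2)"
    unfolding t coeff_\<alpha>_def coeff_\<beta>_def coeff_\<gamma>_def s_def[symmetric] sin_double sin_add using s
    by (simp add: power2_eq_square field_simps)
  finally show ?thesis .
qed

theorem theorem1:
  fixes \<rho> :: real and f :: "real^2 \<Rightarrow> real" and \<theta>1 \<theta>2 :: real
  assumes "\<rho> > 2"
    and "f \<in> sobolev_space \<rho>"
    and "band_limited f"
    and "grid_angles \<theta>1 \<theta>2"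
  shows "\<exists>C. \<forall>T. 0 < T \<and> T < 1 \<longrightarrow>
           \<bar>approx_error (grid_matrix T \<theta>1 \<theta>2) f - asym_error T \<theta>1 \<theta>2 f\<bar> \<le> C * T powr min \<rho> 3"
proof -
  have f: "square_integrable f" using assms(2) by (simp add: sobolev_space_def)
  note ga = assms(4)
  obtain G B where GL: "in_L2 lborel G" and B: "0 \<le> B" "\<And>w. G w \<noteq> 0 \<Longrightarrow> norm w \<le> B"
    and sym: "\<And>w. G (- w) = cnj (G w)" and fG: "AE x in lborel. f x = Re (IFT G x)"
    by (rule band_limited_representation[OF f assms(3)]) blast
  have G: "spectrum_in B G" using GL B by (simp add: spectrum_in_def)
  define g where "g x = Re (IFT G x)" for x
  have gm: "g \<in> borel_measurable borel"
    unfolding g_def by (rule borel_measurable_continuous_onI[OF IFT_continuous[OF G]])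
  have fg: "AE x in lborel. f x = g x" using fG by (simp add: g_def)
  define h where "h x = hessian f x \<bullet> vector [vector [coeff_\<alpha> \<theta>1 \<theta>2, coeff_\<gamma> \<theta>1 \<theta>2], vector [0, coeff_\<beta> \<theta>1 \<theta>2]]" for x
  define S where "S = L2n lborel h / sqrt 720"
  have S0: "0 \<le> S" by (simp add: S_def)
  have sq720: "sqrt 720 = 12 * sqrt 5"
  proof -
    have "sqrt 720 = sqrt (144 * 5)" by simp
    also have "\<dots> = sqrt 144 * sqrt 5" by (rule real_sqrt_mult)
    also have "sqrt 144 = 12" by (rule real_sqrt_unique) auto
    finally show ?thesis .
  qed
  have asym: "asym_error T \<theta>1 \<theta>2 f = T\<^sup>2 * S" for T
    unfolding asym_error_def h_def[symmetric] S_def L2n_def sq720 by simp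
  have hx: "h x = coeff_\<alpha> \<theta>1 \<theta>2 * Re (IFT (deriv_spectrum 1 (deriv_spectrum 1 G)) x) + coeff_\<gamma> \<theta>1 \<theta>2 * Re (IFT (deriv_spectrum 1 (deriv_spectrum 2 G)) x) + coeff_\<beta> \<theta>1 \<theta>2 * Re (IFT (deriv_spectrum 2 (deriv_spectrum 2 G)) x)" for x
    unfolding h_def hessian_def smooth_representative_eq[OF G fG] IFT_hessian[OF G] inner_matrix2
    by (simp add: mult.commute)
  define N where "N = L2n lborel g"
  have N0: "0 \<le> N" by (simp add: N_def)
  have error_le: "0 \<le> approx_error (grid_matrix T \<theta>1 \<theta>2) f" "approx_error (grid_matrix T \<theta>1 \<theta>2) f \<le> N" if "0 < T" for T
  proof -
    let ?X = "grid_matrix T \<theta>1 \<theta>2"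
    have d: "det ?X \<noteq> 0" using grid_matrix_det[OF ga that] that by auto
    show "0 \<le> approx_error ?X f" by (simp add: approx_error_def L2_norm_L2n)
    have "approx_error ?X f \<le> sqrt \<bar>det ?X\<bar> * L2n PM (\<lambda>p. g (?X *v (real_of_int_vec (fst p) + snd p)) - cpwl (\<lambda>k. 0) (fst p) (snd p))"
      using approx_error_char(2)[OF d f gm fg] in_L2_zero[of latM] by blast
    also have "\<dots> = N"
      unfolding N_def lattice_L2(2)[OF d gm] by (simp add: cpwl_def)
    finally show "approx_error ?X f \<le> N" .
  qed
  define s where "s = \<bar>sin (\<theta>2 - \<theta>1)\<bar>"
  have s0: "0 < s" using grid_sin_nz[OF ga] by (simp add: s_def)
  \<comment> \<open>Frequencies of size B become, in grid coordinates, at most L * T.\<close>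
  define L where "L = 4 * B / sqrt s"
  have L0: "0 \<le> L" using B s0 by (simp add: L_def)
  \<comment> \<open>Below T0 the grid is fine; the added 1 covers the case L = 0.\<close>
  define T0 where "T0 = pi / (L + 1)"
  have T00: "0 < T0" using L0 by (simp add: T0_def)
  define C1 where "C1 = 300 * pi * L^3 * L2n lborel G"
  \<comment> \<open>For T above T0 the errors are bounded by N and S, while T0^3 is at most T^3.\<close>
  define C2 where "C2 = (N + S) / T0^3"
  have C10: "0 \<le> C1" using L0 by (simp add: C1_def)
  have C20: "0 \<le> C2" using N0 S0 T00 by (simp add: C2_def)
  have main: "\<bar>approx_error (grid_matrix T \<theta>1 \<theta>2) f - asym_error T \<theta>1 \<theta>2 f\<bar> \<le> (C1 + C2) * T^3" if T: "0 < T" "T < 1" for T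
  proof (cases "T \<le> T0")
    case True
    let ?X = "grid_matrix T \<theta>1 \<theta>2"
    have d: "det ?X \<noteq> 0" using grid_matrix_det[OF ga T(1)] T by auto
    interpret fine_grid ?X B "L * T" G
    proof
      show "det ?X \<noteq> 0" by (rule d)
      show "spectrum_in B G" by (rule G)
      show "G (- w) = cnj (G w)" for w by (rule sym)
      show "0 \<le> L * T" using L0 T by simp
      have "L * T \<le> (L + 1) * T0" using True L0 T00 T by (intro mult_mono) auto
      also have "\<dots> = pi" using L0 by (simp add: T0_def)
      finally show "L * T \<le> pi" .
      fix w :: "real^2" assume w: "norm w \<le> B"
      have e: "\<bar>T / sqrt s * (cos \<theta> * w$1 + sin \<theta> * w$2)\<bar> \<le> T / sqrt s * (2 * B)" for \<theta>
      proof -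
        have "\<bar>cos \<theta>\<bar> * \<bar>w$1\<bar> \<le> 1 * B" using component_le_norm_cart[of w 1] w by (intro mult_mono) auto
        moreover have "\<bar>sin \<theta>\<bar> * \<bar>w$2\<bar> \<le> 1 * B" using component_le_norm_cart[of w 2] w by (intro mult_mono) auto
        ultimately have "\<bar>cos \<theta> * w$1 + sin \<theta> * w$2\<bar> \<le> 2 * B"
          using abs_triangle_ineq[of "cos \<theta> * w$1" "sin \<theta> * w$2"] by (simp add: abs_mult)
        moreover have "0 \<le> T / sqrt s" using T s0 by simp
        ultimately show ?thesis by (simp only: abs_mult[of "T / sqrt s"] abs_of_nonneg mult_left_mono)
      qed
      have LT: "L * T = T / sqrt s * (2 * B) + T / sqrt s * (2 * B)" by (simp add: L_def)
      show "\<bar>xi ?X w $ 1\<bar> + \<bar>xi ?X w $ 2\<bar> \<le> L * T"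
        unfolding xi_grid s_def[symmetric] LT by (rule add_mono[OF e e])
    qed
    have q: "Re (IFT (\<lambda>w. complex_of_real (hessian_symbol w) * G w) x) = T\<^sup>2 * h x" for x
    proof -
      have qw: "complex_of_real (hessian_symbol w) * G w = complex_of_real (T\<^sup>2) * ((complex_of_real (coeff_\<alpha> \<theta>1 \<theta>2) * deriv_spectrum 1 (deriv_spectrum 1 G) w + complex_of_real (coeff_\<gamma> \<theta>1 \<theta>2) * deriv_spectrum 1 (deriv_spectrum 2 G) w) + complex_of_real (coeff_\<beta> \<theta>1 \<theta>2) * deriv_spectrum 2 (deriv_spectrum 2 G) w)" for w
      proof -
        have e: "hessian_symbol w = - (T\<^sup>2 * (coeff_\<alpha> \<theta>1 \<theta>2 * (w$1)\<^sup>2 + coeff_\<gamma> \<theta>1 \<theta>2 * (w$1 * w$2) + coeff_\<beta> \<theta>1 \<theta>2 * (w$2)\<^sup>2))"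
          unfolding grid_quadratic_form[OF ga, symmetric] by (simp add: hessian_symbol_def Let_def)
        show ?thesis unfolding e by (simp add: deriv_spectrum_def power2_eq_square algebra_simps)
      qed
      have b: "spectrum_in B (\<lambda>w. complex_of_real (coeff_\<alpha> \<theta>1 \<theta>2) * deriv_spectrum 1 (deriv_spectrum 1 G) w)" "spectrum_in B (\<lambda>w. complex_of_real (coeff_\<gamma> \<theta>1 \<theta>2) * deriv_spectrum 1 (deriv_spectrum 2 G) w)" "spectrum_in B (\<lambda>w. complex_of_real (coeff_\<beta> \<theta>1 \<theta>2) * deriv_spectrum 2 (deriv_spectrum 2 G) w)"
        by (intro spectrum_in_mult spectrum_in_deriv G continuous_intros)+
      have b12: "spectrum_in B (\<lambda>w. complex_of_real (coeff_\<alpha> \<theta>1 \<theta>2) * deriv_spectrum 1 (deriv_spectrum 1 G) w + complex_of_real (coeff_\<gamma> \<theta>1 \<theta>2) * deriv_spectrum 1 (deriv_spectrum 2 G) w)"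
        unfolding spectrum_in_def
      proof (intro conjI allI impI)
        show "in_L2 lborel (\<lambda>w. complex_of_real (coeff_\<alpha> \<theta>1 \<theta>2) * deriv_spectrum 1 (deriv_spectrum 1 G) w + complex_of_real (coeff_\<gamma> \<theta>1 \<theta>2) * deriv_spectrum 1 (deriv_spectrum 2 G) w)"
          by (intro in_L2_add spectrum_in_L2[OF b(1)] spectrum_in_L2[OF b(2)])
        fix w assume "complex_of_real (coeff_\<alpha> \<theta>1 \<theta>2) * deriv_spectrum 1 (deriv_spectrum 1 G) w + complex_of_real (coeff_\<gamma> \<theta>1 \<theta>2) * deriv_spectrum 1 (deriv_spectrum 2 G) w \<noteq> 0"
        then have "G w \<noteq> 0" by (auto simp: deriv_spectrum_def)
        then show "norm w \<le> B" by (rule B)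
      qed
      show ?thesis
        unfolding qw IFT_cmult IFT_add[OF b12 b(3)] IFT_add[OF b(1,2)] hx by (simp add: algebra_simps)
    qed
    have "L2n lborel (\<lambda>x. T\<^sup>2 * h x) = T\<^sup>2 * L2n lborel h"
      using L2n_scaleR[of lborel "T\<^sup>2" h] by simp
    then have qS: "L2n lborel (\<lambda>x. Re (IFT (\<lambda>w. complex_of_real (hessian_symbol w) * G w) x)) / sqrt 720 = asym_error T \<theta>1 \<theta>2 f"
      unfolding q asym S_def by simp
    have gte: "cell_values = (\<lambda>p. g (?X *v (real_of_int_vec (fst p) + snd p)))" by (simp add: cell_values_def g_def fun_eq_iff)
    obtain c0 where c0: "in_L2 latM c0" "approx_error ?X f = sqrt \<bar>det ?X\<bar> * L2n PM (\<lambda>p. cell_values p - cpwl c0 (fst p) (snd p))"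
      "\<And>c'. in_L2 latM c' \<Longrightarrow> approx_error ?X f \<le> sqrt \<bar>det ?X\<bar> * L2n PM (\<lambda>p. cell_values p - cpwl c' (fst p) (snd p))"
      using approx_error_char(2)[OF d f gm fg] unfolding gte by blast
    have "\<bar>approx_error ?X f - asym_error T \<theta>1 \<theta>2 f\<bar> \<le> 300 * pi * (L * T)^3 * L2n lborel G"
      using error_estimate[OF c0] unfolding qS .
    also have "\<dots> = C1 * T^3" by (simp add: C1_def power_mult_distrib)
    also have "\<dots> \<le> (C1 + C2) * T^3" using C20 T by (intro mult_right_mono) auto
    finally show ?thesis .
  next
    case False
    have "T\<^sup>2 \<le> 1" using T by (simp add: power_le_one)
    then have "T\<^sup>2 * S \<le> S" using S0 by (simp add: mult_left_le_one_le)
    moreover have "0 \<le> T\<^sup>2 * S" using S0 by simp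
    ultimately have "\<bar>approx_error (grid_matrix T \<theta>1 \<theta>2) f - asym_error T \<theta>1 \<theta>2 f\<bar> \<le> N + S"
      unfolding asym using error_le[OF T(1)] N0 S0 by linarith
    also have "\<dots> = C2 * T0^3" using T00 by (simp add: C2_def)
    also have "\<dots> \<le> (C1 + C2) * T^3" using False C10 C20 T00 by (intro mult_mono power_mono) auto
    finally show ?thesis .
  qed
  show ?thesis
  proof (intro exI[of _ "C1 + C2"] allI impI)
    fix T :: real assume T: "0 < T \<and> T < 1"
    have "T^3 = T powr 3" using T by (simp add: powr_numeral)
    also have "\<dots> \<le> T powr min \<rho> 3" using T by (intro powr_mono') auto
    finally have "(C1 + C2) * T^3 \<le> (C1 + C2) * T powr min \<rho> 3"
      using C10 C20 by (intro mult_left_mono) auto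
    then show "\<bar>approx_error (grid_matrix T \<theta>1 \<theta>2) f - asym_error T \<theta>1 \<theta>2 f\<bar> \<le> (C1 + C2) * T powr min \<rho> 3"
      using main[of T] T by linarith
  qed
qed

end
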